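(* With notation as in the context, the algebras $U^-_{\theta,\mathbf p}(\mathfrak g)$ and $\mathcal U^-_{\tilde\theta,\tilde{\mathbf p}}(\mathfrak g)$ have a structure of left $\mathrm B_{\tilde\theta,\tilde{\mathbf p}}(\mathfrak g)$-modules (with $f_i$ acting by left multiplication and $e_i'$ acting by the operator $e_i'$ of the context), and they are isomorphic as $\mathrm B_{\tilde\theta,\tilde{\mathbf p}}(\mathfrak g)$-modules.
   Context: **Cartan datum.** $I$ is an index set; $\mathsf A=(a_{ij})_{i,j\in I}$ is a symmetrizable Cartan matrix ($a_{ii}=2$, $a_{ij}\le0$ for $i\ne j$, $a_{ij}=0$ if $a_{ji}=0$, and $d_ia_{ij}=d_ja_{ji}$ for some positive integers $d_i$). $\Bbbk$ is a commutative ring. **Parameters.** $\theta=\{\theta_{ij}\}$, $\mathbf p=(\{p_{ij}\},\{p_i\})$, $\tilde\theta=\{\tilde\theta_{ij}\}$, $\tilde{\mathbf p}=\{\tilde p_i\}$ are families of invertible elements of $\Bbbk$ such that $p_{ij}^2=p_i^{2a_{ij}}$, $p_{ij}p_{ji}=\theta_{ij}\theta_{ji}p_i^{2a_{ij}}$, $p_{ii}=\theta_{ii}p_i^2$, $1-p_i^n$ and $1-\tilde p_i^n$ are invertible for $n>0$, and $\tilde\theta_{ij}=\theta_{ij}p_{ji}^{-1}$, $\tilde p_i=p_i^2$, $\tilde p_i^{a_{ij}}=p_{ij}^2$ (hence $\tilde\theta_{ij}\tilde\theta_{ji}=\tilde p_i^{-a_{ij}}$, $\tilde\theta_{ii}=\tilde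 p_i^{-1}$). $c_{ij}=p_{ij}p_i^{-a_{ij}}$; $[n]_i=\frac{p_i^n-p_i^{-n}}{p_i-p_i^{-1}}$, $[n]_i!=\prod_{k\le n}[k]_i$, $\genfrac{[}{]}{0pt}{}{m}{k}_i=\frac{[m]_i!}{[k]_i![m-k]_i!}$, $x^{(n)}=x^n/[n]_i!$, $x^{\langle n\rangle}=x^n/\prod_{k=1}^n\frac{1-\tilde p_i^k}{1-\tilde p_i}$ for $x=e_i,f_i$. **Algebras.** $U_{\theta,\mathbf p}(\mathfrak g)$ is the $\Bbbk$-algebra generated by $e_i,f_i,K_i^{\pm1}$ with relations $K_iK_j=K_jK_i$, $K_ie_jK_i^{-1}=p_{ij}e_j$, $K_if_jK_i^{-1}=p_{ij}^{-1}f_j$, $e_if_j-\theta_{ji}f_je_i=\delta_{ij}\frac{K_i-K_i^{-1}}{p_i-p_i^{-1}}$, and for $i\ne j$: $\sum_{k=0}^{1-a_{ij}}(-c_{ij}\theta_{ji}^{-1})^kf_i^{(1-a_{ij}-k)}f_jf_i^{(k)}=0$, $\sum_{k=0}^{1-a_{ij}}(-c_{ij}\theta_{ij})^ke_i^{(1-a_{ij}-k)}e_je_i^{(k)}=0$. $\mathcal U_{\tilde\theta,\tilde{\mathbf p}}(\mathfrak g)$ is the $\Bbbk$-algebra generated by $e_i,f_i,\tilde K_i^{\pm1}$ with relations $\tilde K_i\tilde K_j=\tilde K_j\tilde K_i$, $\tilde K_ie_j\tilde K_i^{-1}=\tilde p_i^{a_{ij}}e_j$, $\tilde K_if_j\tilde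 K_i^{-1}=\tilde p_i^{-a_{ij}}f_j$, $e_if_j-\tilde\theta_{ji}f_je_i=\delta_{ij}\frac{1-\tilde K_i}{1-\tilde p_i}$, and for $i\ne j$: $\sum_{k=0}^{1-a_{ij}}(-\tilde\theta_{ji})^{-k}\tilde p_i^{k(k-1)/2}f_i^{\langle1-a_{ij}-k\rangle}f_jf_i^{\langle k\rangle}=0$, $\sum_{k=0}^{1-a_{ij}}(-\tilde\theta_{ij})^{-k}\tilde p_i^{k(k-1)/2}e_i^{\langle k\rangle}e_je_i^{\langle1-a_{ij}-k\rangle}=0$. $U^-_{\theta,\mathbf p}(\mathfrak g)$, $\mathcal U^-_{\tilde\theta,\tilde{\mathbf p}}(\mathfrak g)$ are the subalgebras generated by the $f_i$'s; they are isomorphic algebras via $f_i\mapsto f_i$. **Operator $e_i'$.** Adjoin to $U_{\theta,\mathbf p}(\mathfrak g)$ mutually commuting invertible $T_i$ with $T_ie_jT_i^{-1}=\theta_{ji}e_j$, $T_if_jT_i^{-1}=\theta_{ji}^{-1}f_j$, $T_iK_jT_i^{-1}=K_j$. For every $P\in U^-_{\theta,\mathbf p}(\mathfrak g)$ there are unique $Q,R\in U^-_{\theta,\mathbf p}(\mathfrak g)$ with $e_iP-(T_i^{-1}PT_i)e_i=\frac{(T_i^{-1}QT_i)K_i-K_i^{-1}R}{p_i-p_i^{-1}}$; define $e_i'(P)=R$. Then $e_i'f_j=\tilde\theta_{ji}f_je_i'+\delta_{ij}$ as operators. Via the isomorphism above $e_i'$ also acts on $\mathcal U^-_{\tilde\theta,\tilde{\mathbf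 p}}(\mathfrak g)$. **Quantum boson algebra.** $\mathrm B_{\tilde\theta,\tilde{\mathbf p}}(\mathfrak g)$ is the $\Bbbk$-algebra generated by $e_i',f_i$ ($i\in I$) with relations $e_i'f_j=\tilde\theta_{ji}f_je_i'+\delta_{ij}$ and, for $i\ne j$, $\sum_{k=0}^{1-a_{ij}}(-\tilde\theta_{ij}p_i^{a_{ij}})^k\genfrac{[}{]}{0pt}{}{1-a_{ij}}{k}_ie_i'^{\,1-a_{ij}-k}e_j'e_i'^{\,k}=0$, $\sum_{k=0}^{1-a_{ij}}(-\tilde\theta_{ij}p_i^{a_{ij}})^k\genfrac{[}{]}{0pt}{}{1-a_{ij}}{k}_if_i^{1-a_{ij}-k}f_jf_i^k=0$. *)

theory Defs
  imports "HOL-Library.Poly_Mapping" "HOL-Library.FuncSet"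
    "HOL-Algebra.QuotRing" "HOL-Algebra.Module" "HOL-Algebra.Subrings"
begin

section \<open>Cartan data and parameters\<close>

definition symmetrizable_cartan :: "('i \<Rightarrow> 'i \<Rightarrow> int) \<Rightarrow> bool" where
  "symmetrizable_cartan a \<longleftrightarrow>
     (\<forall>i. a i i = 2) \<and>
     (\<forall>i j. i \<noteq> j \<longrightarrow> a i j \<le> 0) \<and>
     (\<forall>i j. a j i = 0 \<longrightarrow> a i j = 0) \<and>
     (\<exists>d :: 'i \<Rightarrow> int. (\<forall>i. d i > 0) \<and> (\<forall>i j. d i * a i j = d j * a j i))"

text \<open>The inverse of a unit of a commutative ring, and integer powers of units.
  Both are only meaningful for units; all arguments below are units under the standing
  assumptions on the parameters.\<close>

definition uinv :: "'k::comm_ring_1 \<Rightarrow> 'k" where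
  "uinv x = (THE y. x * y = 1)"

definition upow :: "'k::comm_ring_1 \<Rightarrow> int \<Rightarrow> 'k" where
  "upow x n = (if n \<ge> 0 then x ^ nat n else uinv x ^ nat (- n))"

text \<open>The field \<open>p2\<close> is the doubly indexed family $p_{ij}$ and \<open>p1\<close> the family $p_i$;
  \<open>ttheta\<close> and \<open>tp\<close> are $\tilde\theta_{ij}$ and $\tilde p_i$.\<close>

record ('i, 'k) datum =
  cartan :: "'i \<Rightarrow> 'i \<Rightarrow> int"
  theta :: "'i \<Rightarrow> 'i \<Rightarrow> 'k"
  p2 :: "'i \<Rightarrow> 'i \<Rightarrow> 'k"
  p1 :: "'i \<Rightarrow> 'k"
  ttheta :: "'i \<Rightarrow> 'i \<Rightarrow> 'k"
  tp :: "'i \<Rightarrow> 'k"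

definition admissible_parameters :: "('i, 'k::comm_ring_1) datum \<Rightarrow> bool" where
  "admissible_parameters D \<longleftrightarrow>
     (\<forall>i j. theta D i j dvd 1 \<and> p2 D i j dvd 1 \<and> ttheta D i j dvd 1) \<and>
     (\<forall>i. p1 D i dvd 1 \<and> tp D i dvd 1) \<and>
     (\<forall>i j. (p2 D i j)\<^sup>2 = upow (p1 D i) (2 * cartan D i j)) \<and>
     (\<forall>i j. p2 D i j * p2 D j i
             = theta D i j * theta D j i * upow (p1 D i) (2 * cartan D i j)) \<and>
     (\<forall>i. p2 D i i = theta D i i * (p1 D i)\<^sup>2) \<and>
     (\<forall>i. \<forall>n::nat. n > 0 \<longrightarrow> (1 - p1 D i ^ n) dvd 1 \<and> (1 - tp D i ^ n) dvd 1) \<and>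
     (\<forall>i j. ttheta D i j = theta D i j * uinv (p2 D j i)) \<and>
     (\<forall>i. tp D i = (p1 D i)\<^sup>2) \<and>
     (\<forall>i j. upow (tp D i) (cartan D i j) = (p2 D i j)\<^sup>2)"

definition cc :: "('i, 'k::comm_ring_1) datum \<Rightarrow> 'i \<Rightarrow> 'i \<Rightarrow> 'k" where
  "cc D i j = p2 D i j * upow (p1 D i) (- cartan D i j)"

definition qint :: "'k::comm_ring_1 \<Rightarrow> nat \<Rightarrow> 'k" where
  "qint q n = (q ^ n - uinv q ^ n) * uinv (q - uinv q)"

definition qfact :: "'k::comm_ring_1 \<Rightarrow> nat \<Rightarrow> 'k" where
  "qfact q n = (\<Prod>k = 1..n. qint q k)"

definition qbinom :: "'k::comm_ring_1 \<Rightarrow> nat \<Rightarrow> nat \<Rightarrow> 'k" where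
  "qbinom q m k = qfact q m * uinv (qfact q k * qfact q (m - k))"

section \<open>Algebras given by generators and relations\<close>

text \<open>The monoid of words is written additively so that the convolution product of
  \<^theory>\<open>HOL-Library.Poly_Mapping\<close> makes finitely supported functions on words the free
  associative unital algebra.\<close>

datatype 'g word = Word (letters: "'g list")

instantiation word :: (type) monoid_add
begin

definition zero_word :: "'a word" where "zero_word = Word []"

definition plus_word :: "'a word \<Rightarrow> 'a word \<Rightarrow> 'a word" where
  "plus_word v w = Word (letters v @ letters w)"

instance
  by standard (auto simp: zero_word_def plus_word_def)

end

type_synonym ('g, 'k) free = "'g word \<Rightarrow>\<^sub>0 'k"

definition var :: "'g \<Rightarrow> ('g, 'k::comm_ring_1) free" where
  "var g = Poly_Mapping.single (Word [g]) 1"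

definition const :: "'k::comm_ring_1 \<Rightarrow> ('g, 'k) free" where
  "const c = Poly_Mapping.single 0 c"

definition scale :: "'k::comm_ring_1 \<Rightarrow> ('g, 'k) free \<Rightarrow> ('g, 'k) free"  (infixr "\<cdot>" 75) where
  "c \<cdot> x = const c * x"

definition free_ring :: "('g, 'k::comm_ring_1) free ring" where
  "free_ring = \<lparr>carrier = UNIV, monoid.mult = (*), one = 1, zero = 0, add = (+)\<rparr>"

text \<open>The class, modulo the two-sided ideal generated by \<open>R\<close>, of an element of the free algebra.\<close>

definition cls :: "('g, 'k::comm_ring_1) free set \<Rightarrow> ('g, 'k) free \<Rightarrow> ('g, 'k) free set" where
  "cls R x = genideal free_ring R +>\<^bsub>free_ring\<^esub> x"

text \<open>Algebras over the coefficient ring are represented as \<^typ>\<open>('k, 'a) module\<close> records, which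
  extend rings by a scalar multiplication.\<close>

definition presented ::
  "('g, 'k::comm_ring_1) free set \<Rightarrow> ('k, ('g, 'k) free set) module" where
  "presented R =
     (let Q = free_ring Quot (genideal free_ring R)
      in ring.extend Q (module.fields (\<lambda>c X. cls R (const c) \<otimes>\<^bsub>Q\<^esub> X)))"

definition algebra_hom :: "('k, 'a) module \<Rightarrow> ('k, 'b) module \<Rightarrow> ('a \<Rightarrow> 'b) set" where
  "algebra_hom A B =
     {h \<in> ring_hom A B. \<forall>c. \<forall>x \<in> carrier A. h (c \<odot>\<^bsub>A\<^esub> x) = c \<odot>\<^bsub>B\<^esub> h x}"

definition k_subalgebra :: "'a set \<Rightarrow> ('k, 'a) module \<Rightarrow> bool" where
  "k_subalgebra S A \<longleftrightarrow> subring S A \<and> (\<forall>c. \<forall>x \<in> S. c \<odot>\<^bsub>A\<^esub> x \<in> S)"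

definition generated_subalgebra :: "('k, 'a) module \<Rightarrow> 'a set \<Rightarrow> ('k, 'a) module" where
  "generated_subalgebra A X = A\<lparr>carrier := \<Inter>{S. k_subalgebra S A \<and> X \<subseteq> S}\<rparr>"

text \<open>The algebra homomorphism determined by its values on a generating family \<open>g\<close>.
  It is taken extensional so that it is unique as a HOL function.\<close>

definition gen_hom ::
  "('k, 'a) module \<Rightarrow> ('k, 'b) module \<Rightarrow> ('x \<Rightarrow> 'a) \<Rightarrow> ('x \<Rightarrow> 'b) \<Rightarrow> 'a \<Rightarrow> 'b" where
  "gen_hom A B g h =
     (THE \<phi>. \<phi> \<in> algebra_hom A B \<and> \<phi> \<in> extensional (carrier A) \<and> (\<forall>x. \<phi> (g x) = h x))"

text \<open>The last axiom makes the scalar action on \<open>M\<close> induced by the algebra \<open>B\<close> agree with the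
  given one.\<close>

locale algebra_left_module = B: ring B + M: abelian_group M
  for B :: "('k, 'b) module" and M :: "('k, 'm) module" and act :: "'b \<Rightarrow> 'm \<Rightarrow> 'm" +
  assumes act_closed: "\<lbrakk>b \<in> carrier B; x \<in> carrier M\<rbrakk> \<Longrightarrow> act b x \<in> carrier M"
    and act_add_left: "\<lbrakk>b \<in> carrier B; c \<in> carrier B; x \<in> carrier M\<rbrakk>
      \<Longrightarrow> act (b \<oplus>\<^bsub>B\<^esub> c) x = act b x \<oplus>\<^bsub>M\<^esub> act c x"
    and act_add_right: "\<lbrakk>b \<in> carrier B; x \<in> carrier M; y \<in> carrier M\<rbrakk>
      \<Longrightarrow> act b (x \<oplus>\<^bsub>M\<^esub> y) = act b x \<oplus>\<^bsub>M\<^esub> act b y"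
    and act_mult: "\<lbrakk>b \<in> carrier B; c \<in> carrier B; x \<in> carrier M\<rbrakk>
      \<Longrightarrow> act (b \<otimes>\<^bsub>B\<^esub> c) x = act b (act c x)"
    and act_one: "x \<in> carrier M \<Longrightarrow> act \<one>\<^bsub>B\<^esub> x = x"
    and act_smult: "\<lbrakk>b \<in> carrier B; x \<in> carrier M\<rbrakk>
      \<Longrightarrow> act (t \<odot>\<^bsub>B\<^esub> b) x = t \<odot>\<^bsub>M\<^esub> act b x"

definition module_isos ::
  "('k, 'b) module \<Rightarrow> ('k, 'm) module \<Rightarrow> ('b \<Rightarrow> 'm \<Rightarrow> 'm) \<Rightarrow>
   ('k, 'n) module \<Rightarrow> ('b \<Rightarrow> 'n \<Rightarrow> 'n) \<Rightarrow> ('m \<Rightarrow> 'n) set" where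
  "module_isos B M actM N actN =
     {h. bij_betw h (carrier M) (carrier N) \<and>
         (\<forall>x \<in> carrier M. \<forall>y \<in> carrier M. h (x \<oplus>\<^bsub>M\<^esub> y) = h x \<oplus>\<^bsub>N\<^esub> h y) \<and>
         (\<forall>b \<in> carrier B. \<forall>x \<in> carrier M. h (actM b x) = actN b (h x))}"

section \<open>The algebras $U_{\theta,\mathbf p}(\mathfrak g)$ and
  $\mathcal U_{\tilde\theta,\tilde{\mathbf p}}(\mathfrak g)$\<close>

text \<open>\<open>KI\<close> is the inverse of \<open>K\<close>. For the second algebra \<open>K\<close> stands for $\tilde K_i$.
  A relation $l = r$ is represented by the element $l - r$ of the free algebra.\<close>

datatype 'i ugen = E 'i | F 'i | K 'i | KI 'i

definition divpow :: "('i, 'k::comm_ring_1) datum \<Rightarrow> 'i \<Rightarrow> ('g, 'k) free \<Rightarrow> nat \<Rightarrow> ('g, 'k) free" where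
  "divpow D i x n = uinv (qfact (p1 D i) n) \<cdot> x ^ n"

definition angpow :: "('i, 'k::comm_ring_1) datum \<Rightarrow> 'i \<Rightarrow> ('g, 'k) free \<Rightarrow> nat \<Rightarrow> ('g, 'k) free" where
  "angpow D i x n = uinv (\<Prod>k = 1..n. (1 - tp D i ^ k) * uinv (1 - tp D i)) \<cdot> x ^ n"

text \<open>$1 - a_{ij}$, which is positive for $i \neq j$.\<close>

definition serre_len :: "('i, 'k) datum \<Rightarrow> 'i \<Rightarrow> 'i \<Rightarrow> nat" where
  "serre_len D i j = nat (1 - cartan D i j)"

text \<open>The generators are parameters, because the relations are needed in two different
  free algebras.\<close>

definition U_rels ::
  "('i, 'k::comm_ring_1) datum \<Rightarrow> ('i ugen \<Rightarrow> ('g, 'k) free) \<Rightarrow> ('g, 'k) free set" where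
  "U_rels D x =
     (let e = x \<circ> E; f = x \<circ> F; k = x \<circ> K; k' = x \<circ> KI in
      {k i * k' i - 1 | i. True} \<union> {k' i * k i - 1 | i. True} \<union>
      {k i * k j - k j * k i | i j. True} \<union>
      {k i * e j * k' i - p2 D i j \<cdot> e j | i j. True} \<union>
      {k i * f j * k' i - uinv (p2 D i j) \<cdot> f j | i j. True} \<union>
      {e i * f j - theta D j i \<cdot> (f j * e i)
        - (if i = j then uinv (p1 D i - uinv (p1 D i)) \<cdot> (k i - k' i) else 0) | i j. True} \<union>
      {\<Sum>r\<le>serre_len D i j. (- cc D i j * uinv (theta D j i)) ^ r
         \<cdot> (divpow D i (f i) (serre_len D i j - r) * f j * divpow D i (f i) r) | i j. i \<noteq> j} \<union>
      {\<Sum>r\<le>serre_len D i j. (- cc D i j * theta D i j) ^ r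
         \<cdot> (divpow D i (e i) (serre_len D i j - r) * e j * divpow D i (e i) r) | i j. i \<noteq> j})"

definition cU_rels ::
  "('i, 'k::comm_ring_1) datum \<Rightarrow> ('i ugen, 'k) free set" where
  "cU_rels D =
     (let e = var \<circ> E; f = var \<circ> F; k = var \<circ> K; k' = var \<circ> KI in
      {k i * k' i - 1 | i. True} \<union> {k' i * k i - 1 | i. True} \<union>
      {k i * k j - k j * k i | i j. True} \<union>
      {k i * e j * k' i - upow (tp D i) (cartan D i j) \<cdot> e j | i j. True} \<union>
      {k i * f j * k' i - upow (tp D i) (- cartan D i j) \<cdot> f j | i j. True} \<union>
      {e i * f j - ttheta D j i \<cdot> (f j * e i)
        - (if i = j then uinv (1 - tp D i) \<cdot> (1 - k i) else 0) | i j. True} \<union>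
      {\<Sum>r\<le>serre_len D i j. (upow (- ttheta D j i) (- int r) * tp D i ^ (r * (r - 1) div 2))
         \<cdot> (angpow D i (f i) (serre_len D i j - r) * f j * angpow D i (f i) r) | i j. i \<noteq> j} \<union>
      {\<Sum>r\<le>serre_len D i j. (upow (- ttheta D i j) (- int r) * tp D i ^ (r * (r - 1) div 2))
         \<cdot> (angpow D i (e i) r * e j * angpow D i (e i) (serre_len D i j - r)) | i j. i \<noteq> j})"

definition U :: "('i, 'k::comm_ring_1) datum \<Rightarrow> ('k, ('i ugen, 'k) free set) module" where
  "U D = presented (U_rels D var)"

definition U_gen :: "('i, 'k::comm_ring_1) datum \<Rightarrow> 'i ugen \<Rightarrow> ('i ugen, 'k) free set" where
  "U_gen D g = cls (U_rels D var) (var g)"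

definition cU :: "('i, 'k::comm_ring_1) datum \<Rightarrow> ('k, ('i ugen, 'k) free set) module" where
  "cU D = presented (cU_rels D)"

definition cU_gen :: "('i, 'k::comm_ring_1) datum \<Rightarrow> 'i ugen \<Rightarrow> ('i ugen, 'k) free set" where
  "cU_gen D g = cls (cU_rels D) (var g)"

definition Uminus :: "('i, 'k::comm_ring_1) datum \<Rightarrow> ('k, ('i ugen, 'k) free set) module" where
  "Uminus D = generated_subalgebra (U D) (range (\<lambda>i. U_gen D (F i)))"

definition cUminus :: "('i, 'k::comm_ring_1) datum \<Rightarrow> ('k, ('i ugen, 'k) free set) module" where
  "cUminus D = generated_subalgebra (cU D) (range (\<lambda>i. cU_gen D (F i)))"

text \<open>The isomorphism $f_i \mapsto f_i$ between the two subalgebras.\<close>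

definition minus_iso ::
  "('i, 'k::comm_ring_1) datum \<Rightarrow> ('i ugen, 'k) free set \<Rightarrow> ('i ugen, 'k) free set" where
  "minus_iso D =
     gen_hom (Uminus D) (cUminus D) (\<lambda>i. U_gen D (F i)) (\<lambda>i. cU_gen D (F i))"

section \<open>The operators $e_i'$\<close>

datatype 'i tgen = Base "'i ugen" | T 'i | TI 'i

definition UT_rels :: "('i, 'k::comm_ring_1) datum \<Rightarrow> ('i tgen, 'k) free set" where
  "UT_rels D =
     (let e = var \<circ> Base \<circ> E; f = var \<circ> Base \<circ> F; k = var \<circ> Base \<circ> K;
          t = var \<circ> T; t' = var \<circ> TI in
      U_rels D (var \<circ> Base) \<union>
      {t i * t' i - 1 | i. True} \<union> {t' i * t i - 1 | i. True} \<union>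
      {t i * t j - t j * t i | i j. True} \<union>
      {t i * e j * t' i - theta D j i \<cdot> e j | i j. True} \<union>
      {t i * f j * t' i - uinv (theta D j i) \<cdot> f j | i j. True} \<union>
      {t i * k j * t' i - k j | i j. True})"

definition UT :: "('i, 'k::comm_ring_1) datum \<Rightarrow> ('k, ('i tgen, 'k) free set) module" where
  "UT D = presented (UT_rels D)"

definition UT_gen :: "('i, 'k::comm_ring_1) datum \<Rightarrow> 'i tgen \<Rightarrow> ('i tgen, 'k) free set" where
  "UT_gen D g = cls (UT_rels D) (var g)"

text \<open>The canonical map from $U_{\theta,\mathbf p}(\mathfrak g)$ to its extension by the $T_i$.\<close>

definition UT_incl ::
  "('i, 'k::comm_ring_1) datum \<Rightarrow> ('i ugen, 'k) free set \<Rightarrow> ('i tgen, 'k) free set" where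
  "UT_incl D = gen_hom (U D) (UT D) (U_gen D) (UT_gen D \<circ> Base)"

definition eprime_eq ::
  "('i, 'k::comm_ring_1) datum \<Rightarrow> 'i \<Rightarrow> ('i ugen, 'k) free set \<Rightarrow> ('i ugen, 'k) free set \<Rightarrow>
   ('i ugen, 'k) free set \<Rightarrow> bool" where
  "eprime_eq D i P Q R \<longleftrightarrow>
     (let A = UT D; e = UT_gen D (Base (E i)); k = UT_gen D (Base (K i));
          k' = UT_gen D (Base (KI i));
          conj = (\<lambda>X. UT_gen D (TI i) \<otimes>\<^bsub>A\<^esub> UT_incl D X \<otimes>\<^bsub>A\<^esub> UT_gen D (T i))
      in e \<otimes>\<^bsub>A\<^esub> UT_incl D P \<ominus>\<^bsub>A\<^esub> conj P \<otimes>\<^bsub>A\<^esub> e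
         = uinv (p1 D i - uinv (p1 D i))
             \<odot>\<^bsub>A\<^esub> (conj Q \<otimes>\<^bsub>A\<^esub> k \<ominus>\<^bsub>A\<^esub> k' \<otimes>\<^bsub>A\<^esub> UT_incl D R))"

definition eprime ::
  "('i, 'k::comm_ring_1) datum \<Rightarrow> 'i \<Rightarrow> ('i ugen, 'k) free set \<Rightarrow> ('i ugen, 'k) free set" where
  "eprime D i P =
     snd (THE (Q, R). Q \<in> carrier (Uminus D) \<and> R \<in> carrier (Uminus D) \<and> eprime_eq D i P Q R)"

definition cU_eprime ::
  "('i, 'k::comm_ring_1) datum \<Rightarrow> 'i \<Rightarrow> ('i ugen, 'k) free set \<Rightarrow> ('i ugen, 'k) free set" where
  "cU_eprime D i P =
     minus_iso D (eprime D i (inv_into (carrier (Uminus D)) (minus_iso D) P))"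

section \<open>The quantum boson algebra\<close>

datatype 'i bgen = BE 'i | BF 'i

definition boson_serre ::
  "('i, 'k::comm_ring_1) datum \<Rightarrow> ('i \<Rightarrow> ('g, 'k) free) \<Rightarrow> 'i \<Rightarrow> 'i \<Rightarrow> ('g, 'k) free" where
  "boson_serre D x i j =
     (\<Sum>r\<le>serre_len D i j.
        ((- ttheta D i j * upow (p1 D i) (cartan D i j)) ^ r * qbinom (p1 D i) (serre_len D i j) r)
        \<cdot> (x i ^ (serre_len D i j - r) * x j * x i ^ r))"

definition boson_rels :: "('i, 'k::comm_ring_1) datum \<Rightarrow> ('i bgen, 'k) free set" where
  "boson_rels D =
     {var (BE i) * var (BF j) - ttheta D j i \<cdot> (var (BF j) * var (BE i))
        - (if i = j then 1 else 0) | i j. True} \<union>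
     {boson_serre D (var \<circ> BE) i j | i j. i \<noteq> j} \<union>
     {boson_serre D (var \<circ> BF) i j | i j. i \<noteq> j}"

definition boson :: "('i, 'k::comm_ring_1) datum \<Rightarrow> ('k, ('i bgen, 'k) free set) module" where
  "boson D = presented (boson_rels D)"

definition boson_gen :: "('i, 'k::comm_ring_1) datum \<Rightarrow> 'i bgen \<Rightarrow> ('i bgen, 'k) free set" where
  "boson_gen D g = cls (boson_rels D) (var g)"

end

theory Submission
  imports Defs
begin

text \<open>Let \<open>A\<close> be the free algebra on the \<open>f\<^sub>i\<close> and \<open>S\<close> its ideal generated by the Serre elements.
  On \<open>A\<close> there are skew derivations \<open>e\<^sub>i\<close> with \<open>e\<^sub>i 1 = 0\<close> and
  \<open>e\<^sub>i f\<^sub>j = t\<^sub>i\<^sub>j f\<^sub>j e\<^sub>i + \<delta>\<^sub>i\<^sub>j H\<^sub>i\<close>, where \<open>H\<^sub>i\<close> is a combination of two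
  automorphisms rescaling the generators. For suitable \<open>t\<close> and \<open>H\<close>
  these are the boson operators \<open>e\<^sub>i'\<close> and the action of the \<open>e\<^sub>i\<close> of either quantum group on a Verma
  module. One computation shows that the quantum Serre element of a pair \<open>x\<^sub>i, x\<^sub>j\<close> commutes
  with the opposite generators up to units. Applied to the \<open>e\<^sub>i\<close>, it shows that their Serre element
  vanishes, as it kills 1; applied to the \<open>f\<^sub>i\<close>, it shows that the \<open>e\<^sub>i\<close> preserve \<open>S\<close>.
  So both quantum groups act on \<open>A / S\<close>, which proves that their negative parts are both equal to
  \<open>A / S\<close>, and the boson algebra acts there as well. The elements \<open>Q\<close> and \<open>R\<close> defining \<open>e\<^sub>i'\<close> are
  separated by letting the extended algebra act on Verma modules of two different highest weights.\<close>

text \<open>The negative parts are defined as subalgebras, so it is not known beforehand that the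
  Serre relations generate all their relations. Explicit actions take the place of a triangular
  decomposition, and they make sense over any commutative ring in which the required scalars are
  units. No quotient module is ever formed: an element acts on \<open>A / S\<close> through an
  operator on \<open>A\<close> that preserves \<open>S\<close>. A word in the \<open>f\<close>s acts
  by left multiplication, so applying it to 1 returns the word, and this gives faithfulness at once.
  The obstacle in the Serre computation is that for the quantum groups \<open>H\<close> has two
  summands which rescale the generators differently, so no single commutation rule holds for
  \<open>H\<close>. The errors are additive in \<open>H\<close>, and each summand is treated
  separately, with the quantum parameter p_i or with its inverse. One Serre element serves both
  because quantum binomials do not change when the parameter is inverted.\<close>

section \<open>Units and quantum binomial coefficients\<close>

lemma uinv_eqI: "x * y = 1 \<Longrightarrow> uinv x = (y::'k::comm_ring_1)"
  unfolding uinv_def by (rule the_equality) (assumption, metis mult.assoc mult.commute mult_1_right)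

lemma mult_uinv [simp]: "x dvd 1 \<Longrightarrow> x * uinv x = (1::'k::comm_ring_1)"
  by (metis dvdE uinv_eqI)

lemma uinv_mult_self [simp]: "x dvd 1 \<Longrightarrow> uinv x * x = (1::'k::comm_ring_1)"
  by (simp add: mult.commute)

lemma uinv_unit [simp]: "x dvd 1 \<Longrightarrow> uinv x dvd (1::'k::comm_ring_1)"
  by (metis dvd_triv_left uinv_mult_self)

lemma uinv_uinv [simp]: "x dvd 1 \<Longrightarrow> uinv (uinv x) = (x::'k::comm_ring_1)"
  by (simp add: uinv_eqI)

lemma uinv_one [simp]: "uinv 1 = (1::'k::comm_ring_1)"
  by (simp add: uinv_eqI)

lemma unit_mult [simp]: "x dvd 1 \<Longrightarrow> y dvd 1 \<Longrightarrow> x * y dvd (1::'k::comm_ring_1)"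
  by (metis mult_dvd_mono mult_1_right)

lemma unit_power [simp]: "x dvd 1 \<Longrightarrow> x ^ n dvd (1::'k::comm_ring_1)"
  by (induction n) auto

lemma uinv_mult: "x dvd 1 \<Longrightarrow> y dvd 1 \<Longrightarrow> uinv (x * y) = uinv x * uinv (y::'k::comm_ring_1)"
  using mult_uinv[of x] mult_uinv[of y] by (intro uinv_eqI) (metis (no_types) mult.left_commute
      mult.right_neutral mult.assoc)

lemma uinv_power: "x dvd 1 \<Longrightarrow> uinv (x ^ n) = uinv (x::'k::comm_ring_1) ^ n"
  by (induction n) (simp_all add: uinv_mult)

lemma uinv_uminus: "x dvd 1 \<Longrightarrow> uinv (- x) = - uinv (x::'k::comm_ring_1)"
  by (rule uinv_eqI) simp

lemma unit_cancel_assoc [simp]: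
  "x dvd 1 \<Longrightarrow> x * (uinv x * y) = (y::'k::comm_ring_1)"
  "x dvd 1 \<Longrightarrow> uinv x * (x * y) = y"
  by (simp_all flip: mult.assoc)

lemma unit_cancel: "(u::'k::comm_ring_1) dvd 1 \<Longrightarrow> u * x = u * y \<longleftrightarrow> x = y"
  by (metis unit_cancel_assoc(2))

lemma power_uinv_cancel:
  "x dvd 1 \<Longrightarrow> x ^ n * uinv x ^ n = (1::'k::comm_ring_1)"
  "x dvd 1 \<Longrightarrow> uinv x ^ n * x ^ n = (1::'k::comm_ring_1)"
  by (simp_all flip: power_mult_distrib)

lemma unit_prod: "finite A \<Longrightarrow> (\<And>a. a \<in> A \<Longrightarrow> f a dvd 1) \<Longrightarrow> prod f A dvd (1::'k::comm_ring_1)"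
  by (induction A rule: finite_induct) auto

lemma upow_minus: "x dvd 1 \<Longrightarrow> upow x (- n) = uinv (upow (x::'k::comm_ring_1) n)"
  by (auto simp: upow_def uinv_power)

lemma upow_double: "upow (x::'k::comm_ring_1) (2 * n) = (upow x n)\<^sup>2"
proof -
  have "nat (2 * n) = nat n * 2" "nat (- (2 * n)) = nat (- n) * 2" by auto
  then show ?thesis by (simp only: upow_def power_mult) auto
qed

text \<open>Over a ring this takes the place of "not a root of unity": every quantum integer of
  positive index becomes a unit, so factorials can be divided by.\<close>

definition generic :: "'k::comm_ring_1 \<Rightarrow> bool" where
  "generic q \<longleftrightarrow> q dvd 1 \<and> (\<forall>n>0. (1 - q ^ n) dvd 1)"

lemma generic_unit [simp]: "generic q \<Longrightarrow> q dvd 1"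
  by (simp add: generic_def)

lemma generic_power_unit: "generic q \<Longrightarrow> n > 0 \<Longrightarrow> (1 - q ^ n) dvd 1"
  by (simp only: generic_def)

lemma generic_uinv [simp]:
  fixes q :: "'k::comm_ring_1"
  assumes "generic q"
  shows "generic (uinv q)"
  unfolding generic_def
proof (intro conjI allI impI)
  fix n :: nat assume "n > 0"
  have "1 - uinv q ^ n = - (uinv q ^ n * (1 - q ^ n))"
    using power_uinv_cancel[of q n] assms by (simp add: algebra_simps)
  with \<open>n > 0\<close> assms show "1 - uinv q ^ n dvd 1"
    by (simp add: generic_power_unit)
qed (use assms in simp)

lemma generic_diff_unit:
  fixes q :: "'k::comm_ring_1"
  assumes "generic q" "n > 0"
  shows "(q ^ n - uinv q ^ n) dvd 1"
proof -
  have "q ^ n - uinv q ^ n = - (uinv q ^ n * (1 - q ^ (2 * n)))"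
    using power_uinv_cancel[of q n] assms
    by (simp add: right_diff_distrib mult_2 power_add flip: mult.assoc)
  with assms show ?thesis
    by (simp add: generic_power_unit)
qed

lemma generic_diff_unit1 [simp]: "generic q \<Longrightarrow> (q - uinv q) dvd (1::'k::comm_ring_1)"
  using generic_diff_unit[of q 1] by simp

lemma qint_unit [simp]: "generic q \<Longrightarrow> n > 0 \<Longrightarrow> qint q n dvd 1"
  by (simp add: qint_def generic_diff_unit)

lemma qfact_unit [simp]: "generic q \<Longrightarrow> qfact q n dvd 1"
  by (auto simp: qfact_def intro!: unit_prod qint_unit)

lemma qint_0 [simp]: "qint q 0 = 0"
  by (simp add: qint_def)

lemma qint_1 [simp]: "generic q \<Longrightarrow> qint q (Suc 0) = 1"
  by (simp add: qint_def)

lemma qint_add: "qint q (a + b) = q ^ a * qint q b + uinv q ^ b * qint q a"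
  by (simp add: qint_def power_add algebra_simps)

lemma qint_uinv: "generic q \<Longrightarrow> qint (uinv q) n = qint q n"
proof -
  assume q: "generic q"
  have "uinv q - q = - (q - uinv q)" by simp
  with q have "uinv (uinv q - q) = - uinv (q - uinv q)"
    by (metis uinv_uminus generic_diff_unit1)
  with q show ?thesis
    by (simp add: qint_def algebra_simps)
qed

lemma qfact_0 [simp]: "qfact q 0 = 1"
  by (simp add: qfact_def)

lemma qfact_Suc: "qfact q (Suc n) = qint q (Suc n) * qfact q n"
  by (simp add: qfact_def mult.commute)

lemma qfact_uinv: "generic q \<Longrightarrow> qfact (uinv q) n = qfact q n"
  by (simp add: qfact_def qint_uinv)

text \<open>This symmetry lets the same Serre element be analysed with \<open>q\<close> for one
  summand of \<open>H\<close> and with \<open>uinv q\<close> for the other.\<close>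

lemma qbinom_uinv: "generic q \<Longrightarrow> qbinom (uinv q) m k = qbinom q m k"
  by (simp add: qbinom_def qfact_uinv)

lemma qbinom_mult_qfact:
  "generic q \<Longrightarrow> qbinom q m k * (qfact q k * qfact q (m - k)) = qfact q m"
  by (simp add: qbinom_def mult.assoc)

lemma qbinom_0 [simp]: "generic q \<Longrightarrow> qbinom q m 0 = 1"
  by (simp add: qbinom_def)

lemma qbinom_self [simp]: "generic q \<Longrightarrow> qbinom q m m = 1"
  by (simp add: qbinom_def)

text \<open>Absorption: both sides are [m]! / ([k]! [m-k-1]!). It is what makes neighbouring error
  terms of a Serre element cancel.\<close>

lemma qbinom_Suc_mult:
  assumes "generic q" "k < m"
  shows "qbinom q m (Suc k) * qint q (Suc k) = qbinom q m k * qint q (m - k)"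
proof -
  have m: "m - k = Suc (m - Suc k)" using assms by simp
  have "(qfact q k * qfact q (m - Suc k)) * (qbinom q m (Suc k) * qint q (Suc k))
      = qbinom q m (Suc k) * (qfact q (Suc k) * qfact q (m - Suc k))"
    by (simp add: qfact_Suc mult_ac)
  also have "\<dots> = qbinom q m k * (qfact q k * qfact q (m - k))"
    using assms by (simp only: qbinom_mult_qfact)
  also have "\<dots> = (qfact q k * qfact q (m - Suc k)) * (qbinom q m k * qint q (m - k))"
    by (simp add: m qfact_Suc mult_ac)
  finally show ?thesis
    using assms by (subst (asm) unit_cancel) auto
qed

text \<open>The identity is \<open>qint_add\<close> for the splitting of \<open>Suc m\<close> into
  \<open>Suc k\<close> and \<open>m - k\<close>. The bound on \<open>k\<close> keeps away from the
  entry beyond the diagonal, where truncated subtraction makes \<open>qbinom\<close> a unit instead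
  of 0.\<close>

lemma qbinom_pascal:
  assumes "generic q" "Suc k \<le> m"
  shows "qbinom q (Suc m) (Suc k) = q ^ Suc k * qbinom q m (Suc k) + uinv q ^ (m - k) * qbinom q m k"
proof (cases "Suc k = m")
  case True
  have "qint q (Suc m) = q ^ m + uinv q * qint q m"
    using qint_add[of q m 1] assms by simp
  moreover have "m - k = 1"
    using True by simp
  moreover have "qbinom q m k = qint q m" "qbinom q (Suc m) m = qint q (Suc m)"
    using qbinom_Suc_mult[of q k m] qbinom_Suc_mult[of q m "Suc m"] assms True \<open>m - k = 1\<close>
    by simp_all
  ultimately show ?thesis using assms True by simp
next
  case False
  let ?f = "qfact q (Suc k) * qfact q (m - k)"
  have k: "m - k = Suc (m - Suc k)" using assms by simp
  have "?f * (q ^ Suc k * qbinom q m (Suc k) + uinv q ^ (m - k) * qbinom q m k)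
      = q ^ Suc k * qint q (m - k) * (qbinom q m (Suc k) * (qfact q (Suc k) * qfact q (m - Suc k)))
        + uinv q ^ (m - k) * qint q (Suc k) * (qbinom q m k * (qfact q k * qfact q (m - k)))"
    by (simp add: k qfact_Suc algebra_simps)
  also have "\<dots> = (q ^ Suc k * qint q (m - k) + uinv q ^ (m - k) * qint q (Suc k)) * qfact q m"
    using assms by (simp only: qbinom_mult_qfact) (simp only: algebra_simps)
  also have "q ^ Suc k * qint q (m - k) + uinv q ^ (m - k) * qint q (Suc k) = qint q (Suc k + (m - k))"
    by (simp only: qint_add)
  also have "Suc k + (m - k) = Suc m" using assms by simp
  also have "qint q (Suc m) * qfact q m = ?f * qbinom q (Suc m) (Suc k)"
    using qbinom_mult_qfact[of q "Suc m" "Suc k"] assms by (simp add: qfact_Suc mult_ac)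
  finally show ?thesis
    using assms by (subst (asm) unit_cancel) auto
qed

text \<open>The vanishing of the full alternating sum is not inductive by itself. The truncated sums
  have a closed form, and Pascal's rule carries it from \<open>k\<close> to
  \<open>Suc k\<close>.\<close>

lemma qbinom_partial_alternating:
  assumes "generic q" "k \<le> m"
  shows "(\<Sum>r\<le>k. (- (q ^ m)) ^ r * qbinom q (Suc m) r) = (-1) ^ k * q ^ (k * Suc m) * qbinom q m k"
  using assms(2)
proof (induction k)
  case 0
  then show ?case using assms by simp
next
  case (Suc k)
  have 1: "q ^ (m * Suc k) * q ^ Suc k = q ^ (Suc k * Suc m)"
    by (simp flip: power_add power_Suc add: algebra_simps)
  have 2: "q ^ (m * Suc k) * uinv q ^ (m - k) = q ^ (k * Suc m)"
  proof -
    have "m * Suc k = k * Suc m + (m - k)"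
      using Suc.prems by (simp add: algebra_simps)
    then have "q ^ (m * Suc k) = q ^ (k * Suc m) * q ^ (m - k)"
      by (metis power_add)
    then show ?thesis using assms by (simp add: mult.assoc power_uinv_cancel)
  qed
  have "(- (q ^ m)) ^ Suc k = (-1) ^ Suc k * q ^ (m * Suc k)"
    by (metis power_minus power_mult)
  then have "(- (q ^ m)) ^ Suc k * qbinom q (Suc m) (Suc k)
     = (-1) ^ Suc k * ((q ^ (m * Suc k) * q ^ Suc k) * qbinom q m (Suc k)
        + (q ^ (m * Suc k) * uinv q ^ (m - k)) * qbinom q m k)"
    using assms Suc.prems by (simp only: qbinom_pascal ring_distribs mult.assoc)
  then show ?case
    using Suc unfolding 1 2 sum.atMost_Suc by (simp add: algebra_simps del: mult_Suc mult_Suc_right)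
qed

text \<open>The closed form at \<open>k = m\<close> is the negative of the remaining term, the one
  of index \<open>Suc m\<close>.\<close>

lemma qbinom_alternating:
  assumes "generic q"
  shows "(\<Sum>r\<le>Suc m. (- (q ^ m)) ^ r * qbinom q (Suc m) r) = 0"
proof -
  have "(- (q ^ m)) ^ Suc m = (-1) ^ Suc m * q ^ (m * Suc m)"
    by (metis power_minus power_mult)
  then show ?thesis
    unfolding sum.atMost_Suc qbinom_partial_alternating[OF assms order_refl]
    using assms by (simp only: qbinom_self) simp
qed

text \<open>Commuting a power past \<open>H\<close> produces geometric sums of ratio q^2; this turns
  them into quantum integers.\<close>

lemma qint_geometric:
  assumes "generic q"
  shows "q * (\<Sum>s<n. (q\<^sup>2) ^ s) = q ^ n * qint q n"
proof (induction n)
  case (Suc n)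
  have "qint q (Suc n) = q ^ n + uinv q * qint q n"
    using qint_add[of q n 1] assms by simp
  then have "q ^ Suc n * qint q (Suc n) = q * (q ^ n * q ^ n) + q ^ n * (q * uinv q) * qint q n"
    by (simp add: algebra_simps)
  also have "\<dots> = q * (q\<^sup>2) ^ n + q ^ n * qint q n"
    using assms by (simp add: power2_eq_square power_mult_distrib)
  finally show ?case
    by (simp only: sum.lessThan_Suc distrib_left Suc add.commute)
qed simp

section \<open>The quantum Serre element\<close>

text \<open>Interpreted both for the free algebra and for its endomorphisms, so that relations and
  operators share one Serre calculus.\<close>

locale ring_algebra =
  fixes sc :: "'k::comm_ring_1 \<Rightarrow> 'r::ring_1 \<Rightarrow> 'r" (infixr "\<bullet>" 75)
  assumes sc_add_left: "(a + b) \<bullet> x = a \<bullet> x + b \<bullet> x"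
    and sc_add_right: "a \<bullet> (x + y) = a \<bullet> x + a \<bullet> y"
    and sc_sc [simp]: "a \<bullet> b \<bullet> x = (a * b) \<bullet> x"
    and sc_one [simp]: "1 \<bullet> x = x"
    and mult_sc_left [simp]: "(a \<bullet> x) * y = a \<bullet> (x * y)"
    and mult_sc_right [simp]: "x * (a \<bullet> y) = a \<bullet> (x * y)"
begin

lemma sc_zero_left [simp]: "0 \<bullet> x = 0"
  using sc_add_left[of 0 0 x] by simp

lemma sc_zero_right [simp]: "a \<bullet> 0 = 0"
  using sc_add_right[of a 0 0] by simp

lemma sc_minus_left: "(- a) \<bullet> x = - (a \<bullet> x)"
  using sc_add_left[of a "- a" x] by (simp add: eq_neg_iff_add_eq_0 add.commute)

lemma sc_minus_right: "a \<bullet> (- x) = - (a \<bullet> x)"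
  using sc_add_right[of a x "- x"] by (simp add: eq_neg_iff_add_eq_0 add.commute)

lemma sc_diff_left: "(a - b) \<bullet> x = a \<bullet> x - b \<bullet> x"
  using sc_add_left[of a "- b"] by (simp add: sc_minus_left)

lemma sc_diff_right: "a \<bullet> (x - y) = a \<bullet> x - a \<bullet> y"
  using sc_add_right[of a x "- y"] by (simp add: sc_minus_right)

lemma sc_sum_left: "sum f A \<bullet> x = (\<Sum>a\<in>A. f a \<bullet> x)"
  by (induction A rule: infinite_finite_induct) (auto simp: sc_add_left)

lemma sc_sum_right: "a \<bullet> sum f A = (\<Sum>x\<in>A. a \<bullet> f x)"
  by (induction A rule: infinite_finite_induct) (auto simp: sc_add_right)

lemma sc_power: "(a \<bullet> x) ^ n = (a ^ n) \<bullet> x ^ n"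
  by (induction n) (auto simp: mult.commute)

definition serre :: "'k \<Rightarrow> 'k \<Rightarrow> nat \<Rightarrow> 'r \<Rightarrow> 'r \<Rightarrow> 'r" where
  "serre x q N e d = (\<Sum>r\<le>N. (x ^ r * qbinom q N r) \<bullet> (e ^ (N - r) * d * e ^ r))"

text \<open>The error \<open>e ^ n * f - (t ^ n) \<bullet> (f * e ^ n)\<close> caused by \<open>H\<close> in \<open>e * f = t \<bullet> (f * e) + H\<close>.
  Below, \<open>serre_err_i\<close> and \<open>serre_err_j\<close> are the errors for the whole Serre element when \<open>f\<close> is opposite
  to \<open>e\<close> and to \<open>d\<close>, respectively; they are additive in \<open>H\<close>, so \<open>H\<close> may be assumed to \<open>q\<close>-commute
      with \<open>e\<close> and \<open>d\<close>.\<close>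

primrec comm_err :: "'k \<Rightarrow> 'r \<Rightarrow> 'r \<Rightarrow> nat \<Rightarrow> 'r" where
  "comm_err t e H 0 = 0"
| "comm_err t e H (Suc n) = e * comm_err t e H n + (t ^ n) \<bullet> (H * e ^ n)"

lemma power_skew:
  assumes "e * f = t \<bullet> (f * e) + H"
  shows "e ^ n * f = (t ^ n) \<bullet> (f * e ^ n) + comm_err t e H n"
proof (induction n)
  case (Suc n)
  have "e ^ Suc n * f = e * (e ^ n * f)"
    by (simp add: mult.assoc)
  also have "\<dots> = (t ^ n) \<bullet> ((e * f) * e ^ n) + e * comm_err t e H n"
    by (simp add: Suc distrib_left mult.assoc)
  also have "\<dots> = (t ^ Suc n) \<bullet> (f * e ^ Suc n) + comm_err t e H (Suc n)"
    by (simp add: assms distrib_left distrib_right mult.assoc mult.commute[of t] sc_add_right)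
  finally show ?case .
qed simp

lemma comm_err_add: "comm_err t e (H + H') n = comm_err t e H n + comm_err t e H' n"
  by (induction n) (simp_all add: algebra_simps sc_add_right)

lemma comm_err_zero [simp]: "comm_err t e 0 n = 0"
  by (induction n) simp_all

lemma power_q_commute:
  assumes "H * e = h \<bullet> (e * H)"
  shows "H * e ^ n = (h ^ n) \<bullet> (e ^ n * H)"
proof (induction n)
  case (Suc n)
  have "H * e ^ Suc n = (H * e) * e ^ n"
    by (simp add: mult.assoc)
  also have "\<dots> = h \<bullet> (e * (H * e ^ n))"
    by (simp add: assms mult.assoc)
  also have "\<dots> = (h ^ Suc n) \<bullet> (e ^ Suc n * H)"
    by (simp add: Suc mult.assoc)
  finally show ?case .
qed simp

text \<open>Each summand of the error has one \<open>H\<close> among powers of \<open>e\<close>.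
  Moving it to the right end multiplies by a power of \<open>h\<close>, so all summands become
  proportional and their coefficients form a geometric sum.\<close>

lemma comm_err_Suc:
  assumes "H * e = h \<bullet> (e * H)"
  shows "comm_err t e H (Suc n) = (\<Sum>k<Suc n. (t * h) ^ k) \<bullet> (e ^ n * H)"
proof (induction n)
  case (Suc n)
  have "comm_err t e H (Suc (Suc n))
      = e * ((\<Sum>k<Suc n. (t * h) ^ k) \<bullet> (e ^ n * H)) + (t ^ Suc n) \<bullet> (H * e ^ Suc n)"
    by (subst comm_err.simps) (simp only: Suc)
  also have "\<dots> = (\<Sum>k<Suc n. (t * h) ^ k) \<bullet> (e ^ Suc n * H)
      + (t ^ Suc n * h ^ Suc n) \<bullet> (e ^ Suc n * H)"
    unfolding power_q_commute[OF assms] mult_sc_right sc_sc by (simp only: power_Suc mult.assoc)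
  also have "\<dots> = (\<Sum>k<Suc (Suc n). (t * h) ^ k) \<bullet> (e ^ Suc n * H)"
    by (simp only: sum.lessThan_Suc[of _ "Suc n"] sc_add_left power_mult_distrib)
  finally show ?case .
qed simp

definition serre_err_i :: "'k \<Rightarrow> 'k \<Rightarrow> nat \<Rightarrow> 'r \<Rightarrow> 'r \<Rightarrow> 'k \<Rightarrow> 'k \<Rightarrow> 'r \<Rightarrow> 'r" where
  "serre_err_i x q N e d t t' H =
     (\<Sum>r\<le>N. (x ^ r * qbinom q N r) \<bullet> (e ^ (N - r) * d * comm_err t e H r
        + (t ^ r * t') \<bullet> (comm_err t e H (N - r) * d * e ^ r)))"

definition serre_err_j :: "'k \<Rightarrow> 'k \<Rightarrow> nat \<Rightarrow> 'r \<Rightarrow> 'k \<Rightarrow> 'r \<Rightarrow> 'r" where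
  "serre_err_j x q N e t H = (\<Sum>r\<le>N. (x ^ r * qbinom q N r * t ^ r) \<bullet> (e ^ (N - r) * H * e ^ r))"

text \<open>Moving \<open>f\<close> to the left costs \<open>t\<close> for each of the
  \<open>N\<close> factors \<open>e\<close> and \<open>t'\<close> for \<open>d\<close>, wherever
  \<open>d\<close> stands. The leading terms therefore have a common factor and recombine to the
  Serre element.\<close>

lemma serre_skew_i_err:
  assumes ef: "e * f = t \<bullet> (f * e) + H" and df: "d * f = t' \<bullet> (f * d)"
  shows "serre x q N e d * f = (t ^ N * t') \<bullet> (f * serre x q N e d) + serre_err_i x q N e d t t' H"
proof -
  have "e ^ (N - r) * d * e ^ r * f = (t ^ N * t') \<bullet> (f * (e ^ (N - r) * d * e ^ r))
     + (e ^ (N - r) * d * comm_err t e H r + (t ^ r * t') \<bullet> (comm_err t e H (N - r) * d * e ^ r))"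
    if "r \<le> N" for r
  proof -
    have "e ^ (N - r) * d * e ^ r * f = e ^ (N - r) * d * (e ^ r * f)"
      by (simp add: mult.assoc)
    also have "\<dots> = (t ^ r) \<bullet> (e ^ (N - r) * (d * f) * e ^ r) + e ^ (N - r) * d * comm_err t e H r"
      by (simp add: power_skew[OF ef] distrib_left mult.assoc)
    also have "e ^ (N - r) * (d * f) * e ^ r = t' \<bullet> ((e ^ (N - r) * f) * d * e ^ r)"
      by (simp add: df mult.assoc)
    also have "(t ^ r) \<bullet> \<dots> = (t ^ N * t') \<bullet> (f * (e ^ (N - r) * d * e ^ r))
        + (t ^ r * t') \<bullet> (comm_err t e H (N - r) * d * e ^ r)"
    proof -
      have "t ^ r * t' * t ^ (N - r) = t ^ N * t'"
        using that by (simp add: mult.commute[of _ t'] mult.assoc flip: power_add)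
      then show ?thesis
        by (simp add: power_skew[OF ef] distrib_left distrib_right mult.assoc sc_add_right)
    qed
    finally show ?thesis by (simp add: add_ac)
  qed
  then show ?thesis
    unfolding serre_def serre_err_i_def
    by (simp add: sum_distrib_left sum_distrib_right sc_sum_right sc_add_right mult.commute
        flip: sum.distrib)
qed

lemma serre_skew_j_err:
  assumes ef: "e * f = t \<bullet> (f * e)" and df: "d * f = t' \<bullet> (f * d) + H"
  shows "serre x q N e d * f = (t ^ N * t') \<bullet> (f * serre x q N e d) + serre_err_j x q N e t H"
proof -
  have ef': "e ^ n * f = (t ^ n) \<bullet> (f * e ^ n)" for n
    using power_skew[of e f t 0 n] ef by simp
  have "e ^ (N - r) * d * e ^ r * f = (t ^ N * t') \<bullet> (f * (e ^ (N - r) * d * e ^ r))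
     + (t ^ r) \<bullet> (e ^ (N - r) * H * e ^ r)"
    if "r \<le> N" for r
  proof -
    have "e ^ (N - r) * d * e ^ r * f = (t ^ r) \<bullet> (e ^ (N - r) * (d * f) * e ^ r)"
      by (simp add: mult.assoc ef')
    also have "e ^ (N - r) * (d * f) * e ^ r
        = t' \<bullet> ((e ^ (N - r) * f) * d * e ^ r) + e ^ (N - r) * H * e ^ r"
      by (simp add: df mult.assoc distrib_left distrib_right)
    also have "(t ^ r) \<bullet> \<dots> = (t ^ N * t') \<bullet> (f * (e ^ (N - r) * d * e ^ r))
        + (t ^ r) \<bullet> (e ^ (N - r) * H * e ^ r)"
    proof -
      have "t ^ r * t' * t ^ (N - r) = t ^ N * t'"
        using that by (simp add: mult.commute[of _ t'] mult.assoc flip: power_add)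
      then show ?thesis
        by (simp add: ef' mult.assoc sc_add_right)
    qed
    finally show ?thesis .
  qed
  then show ?thesis
    unfolding serre_def serre_err_j_def
    by (simp add: sum_distrib_left sum_distrib_right sc_sum_right sc_add_right mult.commute
        flip: sum.distrib)
qed

section \<open>Vanishing of the error terms\<close>

lemma serre_err_i_add:
  "serre_err_i x q N e d t t' (H + H') = serre_err_i x q N e d t t' H + serre_err_i x q N e d t t' H'"
  by (simp add: serre_err_i_def comm_err_add algebra_simps sum.distrib sc_add_right)

lemma serre_err_j_add:
  "serre_err_j x q N e t (H + H') = serre_err_j x q N e t H + serre_err_j x q N e t H'"
  by (simp add: serre_err_j_def algebra_simps sum.distrib sc_add_right)

text \<open>The error from the factors right of \<open>d\<close> at index \<open>Suc r\<close> and
  the error from the factors left of \<open>d\<close> at index \<open>r\<close> are multiples of the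
  same monomial \<open>e ^ (m - r) * d * e ^ r * H\<close>. The condition on \<open>t * h\<close>
  makes their coefficients quantum integers, and the value of \<open>x\<close> makes each such pair
  cancel.\<close>

lemma serre_err_i_eq_0_aux:
  assumes q: "generic q" and He: "H * e = h \<bullet> (e * H)" and Hd: "H * d = h' \<bullet> (d * H)"
    and th: "t * h = q\<^sup>2" and x: "x = - (t' * h' * q ^ m)"
  shows "serre_err_i x q (Suc m) e d t t' H = 0"
proof -
  define G where "G n = (\<Sum>k<n. (q\<^sup>2) ^ k)" for n
  define A where "A r = (x ^ r * qbinom q (Suc m) r) \<bullet> (e ^ (Suc m - r) * d * comm_err t e H r)" for r
  define B where "B r = (x ^ r * qbinom q (Suc m) r * (t ^ r * t')) \<bullet> (comm_err t e H (Suc m - r) *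
      d * e ^ r)" for r
  have err: "comm_err t e H (Suc n) = G (Suc n) \<bullet> (e ^ n * H)" for n
    unfolding comm_err_Suc[OF He] th G_def ..
  have A: "A (Suc r) = (x ^ Suc r * qbinom q (Suc m) (Suc r) * G (Suc r)) \<bullet> (e ^ (m - r) * d * e ^ r
      * H)" for r
    unfolding A_def err by (simp add: mult.assoc)
  have B: "B r = (x ^ r * qbinom q (Suc m) r * ((t * h) ^ r * t' * h') * G (Suc m - r)) \<bullet> (e ^ (m -
      r) * d * e ^ r * H)"
    if "r \<le> m" for r
  proof -
    have "Suc m - r = Suc (m - r)" using that by simp
    moreover have "H * (d * e ^ r) = (h' * h ^ r) \<bullet> (d * (e ^ r * H))"
      by (metis Hd mult.assoc mult_sc_left mult_sc_right sc_sc power_q_commute[OF He])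
    ultimately show ?thesis
      unfolding B_def by (simp add: err mult.assoc del: comm_err.simps) (simp add:
          power_mult_distrib mult_ac)
  qed
  \<comment> \<open>The extra unit \<open>q\<close> is the factor needed by
    \<open>qint_geometric\<close>. Absorption then makes the binomial parts of both terms equal, and
    the definition of \<open>x\<close> gives them opposite signs.\<close>
  have 0: "x ^ Suc r * qbinom q (Suc m) (Suc r) * G (Suc r)
        + x ^ r * qbinom q (Suc m) r * ((t * h) ^ r * t' * h') * G (Suc m - r) = 0" (is "?u = 0")
    if "r \<le> m" for r
  proof -
    have "q * ?u = x ^ Suc r * qbinom q (Suc m) (Suc r) * (q * G (Suc r))
        + x ^ r * qbinom q (Suc m) r * ((t * h) ^ r * t' * h') * (q * G (Suc m - r))"
      by (simp only: algebra_simps)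
    also have "\<dots> = x ^ Suc r * qbinom q (Suc m) (Suc r) * (q ^ Suc r * qint q (Suc r))
        + x ^ r * qbinom q (Suc m) r * (q ^ (2 * r) * t' * h') * (q ^ (Suc m - r) * qint q (Suc m - r))"
      unfolding G_def qint_geometric[OF q] th power_mult ..
    also have "\<dots> = x ^ r * q ^ Suc r * (x * (qbinom q (Suc m) (Suc r) * qint q (Suc r)))
        + x ^ r * (q ^ (2 * r) * q ^ (Suc m - r)) * (t' * h') * (qbinom q (Suc m) r * qint q (Suc m - r))"
      by (simp only: algebra_simps power_Suc)
    also have "qbinom q (Suc m) (Suc r) * qint q (Suc r) = qbinom q (Suc m) r * qint q (Suc m - r)"
      using that by (intro qbinom_Suc_mult q) simp
    also have "q ^ (2 * r) * q ^ (Suc m - r) = q ^ Suc r * q ^ m"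
      using that by (simp only: power_add[symmetric]) simp
    finally have "q * ?u = 0"
      by (simp add: x algebra_simps)
    then show ?thesis
      using unit_cancel[of q ?u 0] q by simp
  qed
  have "serre_err_i x q (Suc m) e d t t' H = (\<Sum>r\<le>Suc m. A r) + (\<Sum>r\<le>Suc m. B r)"
    by (simp add: serre_err_i_def A_def B_def sc_add_right del: sum.atMost_Suc flip: sum.distrib)
  \<comment> \<open>\<open>A 0\<close> and \<open>B (Suc m)\<close> vanish because
    \<open>comm_err\<close> is 0 at exponent 0, so the two sums can be matched with a shift by
    one.\<close>
  also have "(\<Sum>r\<le>Suc m. A r) = (\<Sum>r\<le>m. A (Suc r))"
    by (subst sum.atMost_Suc_shift) (simp add: A_def)
  also have "(\<Sum>r\<le>Suc m. B r) = (\<Sum>r\<le>m. B r)"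
    by (subst sum.atMost_Suc) (simp add: B_def)
  also have "(\<Sum>r\<le>m. A (Suc r)) + (\<Sum>r\<le>m. B r) = (\<Sum>r\<le>m. A (Suc r) + B r)"
    by (simp add: sum.distrib)
  also have "\<dots> = 0"
    by (intro sum.neutral ballI) (simp add: A B 0 flip: sc_add_left del: power_Suc)
  finally show ?thesis .
qed

text \<open>Here \<open>H\<close> replaces \<open>d\<close>. Once \<open>H\<close> is moved to the
  right, all terms are multiples of the one monomial \<open>e ^ Suc m * H\<close>, and the total
  coefficient is the alternating sum of quantum binomials.\<close>

lemma serre_err_j_eq_0_aux:
  assumes q: "generic q" and He: "H * e = h \<bullet> (e * H)" and x: "x * t * h = - (q ^ m)"
  shows "serre_err_j x q (Suc m) e t H = 0"
proof -
  have "serre_err_j x q (Suc m) e t H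
      = (\<Sum>r\<le>Suc m. ((x * t * h) ^ r * qbinom q (Suc m) r) \<bullet> (e ^ Suc m * H))"
    unfolding serre_err_j_def
  proof (rule sum.cong)
    fix r assume "r \<in> {..Suc m}"
    then have "e ^ (Suc m - r) * e ^ r = e ^ Suc m"
      by (simp flip: power_add)
    then have "e ^ (Suc m - r) * H * e ^ r = (h ^ r) \<bullet> (e ^ Suc m * H)"
      by (simp only: mult.assoc power_q_commute[OF He] mult_sc_right) (simp only: flip: mult.assoc)
    then show "(x ^ r * qbinom q (Suc m) r * t ^ r) \<bullet> (e ^ (Suc m - r) * H * e ^ r)
      = ((x * t * h) ^ r * qbinom q (Suc m) r) \<bullet> (e ^ Suc m * H)"
      by (simp only: sc_sc power_mult_distrib mult_ac)
  qed simp
  also have "\<dots> = 0"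
    by (simp only: x qbinom_alternating[OF q] sc_zero_left flip: sc_sum_left)
  finally show ?thesis .
qed

text \<open>Inverting the parameter does not change the binomials, so \<open>y\<close> can be
  whichever of \<open>q\<close> and \<open>uinv q\<close> fits the scaling of the given summand of
  \<open>H\<close>.\<close>

lemma serre_err_i_eq_0:
  assumes "generic q" "y \<in> {q, uinv q}" "H * e = h \<bullet> (e * H)" "H * d = h' \<bullet> (d * H)"
    "t * h = y\<^sup>2" "x = - (t' * h' * y ^ m)"
  shows "serre_err_i x q (Suc m) e d t t' H = 0"
proof -
  have "serre_err_i x q (Suc m) e d t t' H = serre_err_i x y (Suc m) e d t t' H"
    using assms(1,2) by (auto simp: serre_err_i_def qbinom_uinv)
  then show ?thesis
    using serre_err_i_eq_0_aux[of y H e h d h' t x t' m] assms by auto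
qed

lemma serre_err_j_eq_0:
  assumes "generic q" "y \<in> {q, uinv q}" "H * e = h \<bullet> (e * H)" "x * t * h = - (y ^ m)"
  shows "serre_err_j x q (Suc m) e t H = 0"
proof -
  have "serre_err_j x q (Suc m) e t H = serre_err_j x y (Suc m) e t H"
    using assms(1,2) by (auto simp: serre_err_j_def qbinom_uinv)
  then show ?thesis
    using serre_err_j_eq_0_aux[of y H e h x t m] assms by auto
qed

end

section \<open>Free algebras and their endomorphisms\<close>

lemma free_single_induct [case_names single add]:
  assumes single: "\<And>w c. P (Poly_Mapping.single w c)" and add: "\<And>x y. P x \<Longrightarrow> P y \<Longrightarrow> P (x + y)"
  shows "P (x :: ('g, 'k::comm_ring_1) free)"
proof (induction x rule: update_induct)
  case const
  show ?case using single[of 0 0] by simp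
next
  case (update f a b)
  have "Poly_Mapping.update a b f = f + Poly_Mapping.single a b"
    using update(1) by (auto intro!: poly_mapping_eqI simp: lookup_update lookup_add lookup_single
        in_keys_iff when_def)
  then show ?case using update single add by simp
qed

lemma const_central: "const c * x = x * const c"
  by (induction x rule: free_single_induct) (simp_all add: const_def mult_single mult.commute
      algebra_simps)

interpretation free: ring_algebra "scale :: 'k::comm_ring_1 \<Rightarrow> ('g, 'k) free \<Rightarrow> ('g, 'k) free"
proof
  fix a b :: 'k and x y :: "('g, 'k) free"
  show "(a + b) \<cdot> x = a \<cdot> x + b \<cdot> x" "a \<cdot> (x + y) = a \<cdot> x + a \<cdot> y"
    by (simp_all add: scale_def const_def single_add algebra_simps)
  show "a \<cdot> b \<cdot> x = (a * b) \<cdot> x" "1 \<cdot> x = x"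
    by (simp_all add: scale_def const_def mult_single flip: mult.assoc)
  show "(a \<cdot> x) * y = a \<cdot> (x * y)"
    by (simp add: scale_def mult.assoc)
  show "x * (a \<cdot> y) = a \<cdot> (x * y)"
    unfolding scale_def by (metis const_central mult.assoc)
qed

lemma single_scale: "Poly_Mapping.single w c = c \<cdot> Poly_Mapping.single w 1"
  by (simp add: scale_def const_def mult_single)

lemma single_Word_Cons: "Poly_Mapping.single (Word (g # w)) 1 = var g * Poly_Mapping.single (Word w) 1"
  by (simp add: var_def mult_single plus_word_def)

lemma single_Word_Nil: "Poly_Mapping.single (Word []) 1 = 1"
  by (simp flip: zero_word_def)

lemma free_induct [case_names one add scale var]:
  assumes one: "P 1" and add: "\<And>x y. P x \<Longrightarrow> P y \<Longrightarrow> P (x + y)" and scale: "\<And>c x. P x \<Longrightarrow> P (c \<cdot> x)"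
    and var: "\<And>g x. P x \<Longrightarrow> P (var g * x)"
  shows "P (x :: ('g, 'k::comm_ring_1) free)"
proof (induction x rule: free_single_induct)
  case (single w c)
  have "P (Poly_Mapping.single (Word l) 1)" for l
    by (induction l) (simp_all add: one var single_Word_Cons single_Word_Nil)
  then show ?case
    by (subst single_scale) (metis scale word.collapse)
qed (rule add)

subsection \<open>Linear and multiplicative extension\<close>

context ring_algebra
begin

definition lin_ext :: "('g word \<Rightarrow> 'r) \<Rightarrow> ('g, 'k) free \<Rightarrow> 'r" where
  "lin_ext h X = (\<Sum>w\<in>Poly_Mapping.keys X. Poly_Mapping.lookup X w \<bullet> h w)"

lemma lin_ext_superset:
  assumes "finite A" "Poly_Mapping.keys X \<subseteq> A"
  shows "lin_ext h X = (\<Sum>w\<in>A. Poly_Mapping.lookup X w \<bullet> h w)"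
  unfolding lin_ext_def using assms by (intro sum.mono_neutral_left) (auto simp: in_keys_iff)

lemma lin_ext_add: "lin_ext h (X + Y) = lin_ext h X + lin_ext h Y"
proof -
  have "Poly_Mapping.keys (X + Y) \<subseteq> Poly_Mapping.keys X \<union> Poly_Mapping.keys Y"
    by (rule keys_add)
  then show ?thesis
    by (simp add: lin_ext_superset[of "Poly_Mapping.keys X \<union> Poly_Mapping.keys Y"] lookup_add
        sc_add_left sum.distrib)
qed

lemma lin_ext_single: "lin_ext h (Poly_Mapping.single w c) = c \<bullet> h w"
  by (simp add: lin_ext_def)

lemma lin_ext_scale: "lin_ext h (c \<cdot> X) = c \<bullet> lin_ext h X"
proof (induction X rule: free_single_induct)
  case (single w b)
  then show ?case
    by (simp add: scale_def const_def mult_single lin_ext_single)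
next
  case (add x y)
  then show ?case by (simp add: free.sc_add_right lin_ext_add sc_add_right)
qed

definition lift :: "('g \<Rightarrow> 'r) \<Rightarrow> ('g, 'k) free \<Rightarrow> 'r" where
  "lift h = lin_ext (\<lambda>w. prod_list (map h (letters w)))"

lemma lift_add [simp]: "lift h (X + Y) = lift h X + lift h Y"
  by (simp add: lift_def lin_ext_add)

lemma lift_scale [simp]: "lift h (c \<cdot> X) = c \<bullet> lift h X"
  by (simp add: lift_def lin_ext_scale)

lemma lift_one [simp]: "lift h 1 = 1"
  using lin_ext_single[of "\<lambda>w. prod_list (map h (letters w))" 0 1]
  by (simp add: lift_def) (simp add: zero_word_def)

lemma lift_var [simp]: "lift h (var g) = h g"
  by (simp add: lift_def var_def lin_ext_single)

lemma lift_mult [simp]: "lift h (X * Y) = lift h X * lift h Y"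
proof (induction X rule: free_induct)
  case (var g X)
  have "lift h (var g * Z) = h g * lift h Z" for Z
  proof (induction Z rule: free_single_induct)
    case (single w c)
    then show ?case
      by (simp add: lift_def var_def mult_single lin_ext_single plus_word_def)
  qed (simp add: distrib_left)
  then show ?case using var by (simp add: mult.assoc)
qed (simp_all add: algebra_simps)

lemma lift_zero [simp]: "lift h 0 = 0"
  using lift_add[of h 0 0] by simp

lemma lift_uminus [simp]: "lift h (- X) = - lift h X"
  using lift_add[of h X "- X"] by (simp add: eq_neg_iff_add_eq_0 add.commute)

lemma lift_diff [simp]: "lift h (X - Y) = lift h X - lift h Y"
  using lift_add[of h X "- Y"] by simp

lemma lift_sum [simp]: "lift h (sum f A) = (\<Sum>a\<in>A. lift h (f a))"
  by (induction A rule: infinite_finite_induct) auto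

lemma lift_power [simp]: "lift h (X ^ n) = lift h X ^ n"
  by (induction n) auto

lemma lift_serre [simp]: "lift h (free.serre x q N e d) = serre x q N (lift h e) (lift h d)"
  by (simp add: free.serre_def serre_def)

end

subsection \<open>Linear endomorphisms of a free algebra\<close>

text \<open>A type instead of a set of maps, so that operators form a \<open>ring_1\<close> and the
  Serre calculus applies to them.\<close>

typedef (overloaded) ('g, 'k::comm_ring_1) endo =
  "{f :: ('g, 'k) free \<Rightarrow> ('g, 'k) free. (\<forall>x y. f (x + y) = f x + f y) \<and> (\<forall>c x. f (c \<cdot> x) = c \<cdot> f x)}"
  morphisms app Endo
  by (rule exI[of _ id]) simp

setup_lifting type_definition_endo

lemma app_add [simp]: "app f (x + y) = app f x + app f y"
  using app[of f] by simp

lemma app_scale [simp]: "app f (c \<cdot> x) = c \<cdot> app f x"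
  using app[of f] by simp

lemma app_zero [simp]: "app f 0 = 0"
  using app_add[of f 0 0] by simp

lemma app_uminus [simp]: "app f (- x) = - app f x"
  using app_add[of f x "- x"] by (simp add: eq_neg_iff_add_eq_0 add.commute)

lemma app_diff [simp]: "app f (x - y) = app f x - app f y"
  using app_add[of f x "- y"] by simp

lemma endo_eqI: "(\<And>x. app f x = app g x) \<Longrightarrow> f = g"
  by (metis app_inject ext)

instantiation endo :: (type, comm_ring_1) ring_1
begin

lift_definition zero_endo :: "('a, 'b) endo" is "\<lambda>x. 0" by simp
lift_definition one_endo :: "('a, 'b) endo" is "\<lambda>x. x" by simp
lift_definition plus_endo :: "('a, 'b) endo \<Rightarrow> ('a, 'b) endo \<Rightarrow> ('a, 'b) endo"
  is "\<lambda>f g x. f x + g x" by (simp add: free.sc_add_right)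
lift_definition minus_endo :: "('a, 'b) endo \<Rightarrow> ('a, 'b) endo \<Rightarrow> ('a, 'b) endo"
  is "\<lambda>f g x. f x - g x" by (simp add: free.sc_diff_right)
lift_definition uminus_endo :: "('a, 'b) endo \<Rightarrow> ('a, 'b) endo"
  is "\<lambda>f x. - f x" by (simp add: free.sc_minus_right)
lift_definition times_endo :: "('a, 'b) endo \<Rightarrow> ('a, 'b) endo \<Rightarrow> ('a, 'b) endo"
  is "\<lambda>f g x. f (g x)" by simp

lemma app_simps [simp]:
  "app 0 x = 0" "app 1 x = x" "app (f + g) x = app f x + app g x" "app (f - g) x = app f x - app g x"
  "app (- f) x = - app f x" "app (f * g) x = app f (app g x)"
  by (transfer; simp)+

instance
proof
  have "app 0 1 \<noteq> app (1 :: ('a, 'b) endo) 1"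
    by simp
  then show "0 \<noteq> (1 :: ('a, 'b) endo)"
    by metis
qed (auto intro!: endo_eqI simp: algebra_simps)

end

lift_definition escale :: "'k \<Rightarrow> ('g, 'k::comm_ring_1) endo \<Rightarrow> ('g, 'k) endo" is "\<lambda>c f x. c \<cdot> f x"
  by (simp add: free.sc_add_right mult.commute)

lemma app_escale [simp]: "app (escale c f) x = c \<cdot> app f x"
  by (transfer; simp)

interpretation endo: ring_algebra escale
  by standard (auto intro!: endo_eqI simp: free.sc_add_right free.sc_add_left)

lemma app_sum: "app (sum f A) x = (\<Sum>a\<in>A. app (f a) x)"
  by (induction A rule: infinite_finite_induct) auto

definition lmult :: "('g, 'k::comm_ring_1) free \<Rightarrow> ('g, 'k) endo" where
  "lmult a = Endo ((*) a)"

lemma app_lmult [simp]: "app (lmult a) x = a * x"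
  by (simp add: lmult_def Endo_inverse distrib_left)

lemma lmult_hom:
  "lmult (a + b) = lmult a + lmult b" "lmult (a * b) = lmult a * lmult b" "lmult 1 = 1"
  "lmult (c \<cdot> a) = escale c (lmult a)"
  by (auto intro!: endo_eqI simp: algebra_simps)

text \<open>Hence evaluating at 1 recovers an element of the free algebra from its action; the
  computation of the kernels rests on this.\<close>

lemma lift_lmult: "endo.lift (\<lambda>j. lmult (f j)) x = lmult (free.lift f x)"
  by (induction x rule: free_induct) (simp_all add: lmult_hom)

lemma lift_var_id: "free.lift var x = x"
  by (induction x rule: free_induct) simp_all

text \<open>With 1 as highest weight vector, the torus elements \<open>K i\<close> and
  \<open>T i\<close> act on a Verma module by such automorphisms, up to a scalar given by the
  highest weight.\<close>

definition dg :: "('g \<Rightarrow> 'k::comm_ring_1) \<Rightarrow> ('g, 'k) endo" where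
  "dg \<chi> = Endo (free.lift (\<lambda>j. \<chi> j \<cdot> var j))"

lemma app_dg: "app (dg \<chi>) = free.lift (\<lambda>j. \<chi> j \<cdot> var j)"
  unfolding dg_def by (rule Endo_inverse) simp

lemma app_dg_simps [simp]:
  "app (dg \<chi>) 1 = 1" "app (dg \<chi>) (x * y) = app (dg \<chi>) x * app (dg \<chi>) y" "app (dg \<chi>) (var j) = \<chi> j \<cdot> var j"
  by (simp_all add: app_dg)

lemma dg_lmult_var: "dg \<chi> * lmult (var j) = escale (\<chi> j) (lmult (var j) * dg \<chi>)"
  by (rule endo_eqI) simp

text \<open>Left multiplications by generators carry 1 to every word, and \<open>X\<close> passes
  each of them at the cost of a scalar only.\<close>

lemma endo_eq_zero:
  assumes "app X 1 = 0" "\<And>j. \<exists>c. X * lmult (var j) = escale c (lmult (var j) * X)"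
  shows "X = 0"
proof (rule endo_eqI)
  fix x show "app X x = app 0 x"
  proof (induction x rule: free_induct)
    case (var j x)
    obtain c where "X * lmult (var j) = escale c (lmult (var j) * X)"
      using assms(2) by blast
    then have "app (X * lmult (var j)) x = app (escale c (lmult (var j) * X)) x"
      by simp
    then show ?case using var by simp
  qed (use assms(1) in simp_all)
qed

lemma dg_mult: "dg \<chi> * dg \<chi>' = dg (\<lambda>j. \<chi> j * \<chi>' j)"
proof (rule endo_eqI)
  fix x show "app (dg \<chi> * dg \<chi>') x = app (dg (\<lambda>j. \<chi> j * \<chi>' j)) x"
    by (induction x rule: free_induct) (simp_all add: mult.commute)
qed

lemma dg_one [simp]: "dg (\<lambda>j. 1) = 1"
proof (rule endo_eqI)
  fix x show "app (dg (\<lambda>j. 1)) x = app 1 x"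
    by (induction x rule: free_induct) simp_all
qed

lemma dg_commute: "dg \<chi> * dg \<chi>' = dg \<chi>' * dg \<chi>"
  by (simp add: dg_mult mult.commute)

subsection \<open>Skew derivations\<close>

context
  fixes t :: "'g \<Rightarrow> 'k::comm_ring_1" and i :: 'g and H :: "('g, 'k) endo"
begin

text \<open>The recursion on the first letter is forced by the wanted commutation rule with left
  multiplication. In the free algebra there is nothing to check; compatibility with the Serre
  relations is a separate matter, settled in \<open>E_op_serre_ideal\<close>.\<close>

fun der_word :: "'g list \<Rightarrow> ('g, 'k) free" where
  "der_word [] = 0"
| "der_word (j # w) =
     t j \<cdot> (var j * der_word w) + (if i = j then app H (Poly_Mapping.single (Word w) 1) else 0)"

definition der :: "('g, 'k) endo" where
  "der = Endo (free.lin_ext (\<lambda>w. der_word (letters w)))"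

lemma app_der: "app der = free.lin_ext (\<lambda>w. der_word (letters w))"
  unfolding der_def by (rule Endo_inverse) (simp add: free.lin_ext_add free.lin_ext_scale)

lemma der_one [simp]: "app der 1 = 0"
  using free.lin_ext_single[of "\<lambda>w. der_word (letters w)" 0 1]
  by (simp add: app_der) (simp add: zero_word_def)

lemma der_var_mult:
  "app der (var j * x) = t j \<cdot> (var j * app der x) + (if i = j then app H x else 0)"
proof (induction x rule: free_single_induct)
  case (single w c)
  have "app der (var j * Poly_Mapping.single w 1)
      = t j \<cdot> (var j * app der (Poly_Mapping.single w 1)) + (if i = j then app H
          (Poly_Mapping.single w 1) else 0)"
    by (simp add: var_def mult_single plus_word_def app_der free.lin_ext_single)
  then show ?case
    by (subst (1 2 3) single_scale) (simp add: free.sc_add_right mult.commute)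
qed (simp add: algebra_simps free.sc_add_right)

lemma der_lmult_var: "der * lmult (var j) = escale (t j) (lmult (var j) * der) + (if i = j then H else 0)"
  by (rule endo_eqI) (simp add: der_var_mult)

text \<open>The operator \<open>der\<close> removes one letter \<open>i\<close>, and with it the
  factor that \<open>dg\<close> attaches to this letter.\<close>

lemma der_dg:
  assumes "H * dg \<chi> = dg \<chi> * H"
  shows "der * dg \<chi> = escale (\<chi> i) (dg \<chi> * der)"
proof (rule endo_eqI)
  fix x
  have H: "app H (app (dg \<chi>) x) = app (dg \<chi>) (app H x)" for x
    using arg_cong[OF assms, of "\<lambda>f. app f x"] by simp
  show "app (der * dg \<chi>) x = app (escale (\<chi> i) (dg \<chi> * der)) x"
    by (induction x rule: free_induct)
      (simp_all add: der_var_mult free.sc_add_right H mult_ac)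
qed

end

section \<open>Two-sided ideals and presented algebras\<close>

text \<open>The generators are taken with arbitrary factors on both sides, so closure under addition
  is enough; negatives come from the factor -1. The inductive form provides the induction principle
  used for all arguments modulo relations.\<close>

inductive_set idl :: "'r::ring_1 set \<Rightarrow> 'r set" for R where
  idl_zero [simp]: "0 \<in> idl R"
| idl_gen: "r \<in> R \<Longrightarrow> a * r * b \<in> idl R"
| idl_add: "x \<in> idl R \<Longrightarrow> y \<in> idl R \<Longrightarrow> x + y \<in> idl R"

lemma idl_base: "r \<in> R \<Longrightarrow> r \<in> idl R"
  using idl_gen[of r R 1 1] by simp

lemma idl_mult_left: "x \<in> idl R \<Longrightarrow> c * x \<in> idl R"
  by (induction rule: idl.induct)
    (auto simp: distrib_left intro: idl_add idl_gen simp flip: mult.assoc)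

lemma idl_mult_right: "x \<in> idl R \<Longrightarrow> x * c \<in> idl R"
proof (induction rule: idl.induct)
  case (idl_gen r a b)
  then show ?case
    using idl.idl_gen[of r R a "b * c"] by (simp add: mult.assoc)
qed (auto simp: distrib_right intro: idl_add)

lemma idl_uminus: "x \<in> idl R \<Longrightarrow> - x \<in> idl R"
  using idl_mult_left[of x R "-1"] by simp

lemma idl_diff: "x \<in> idl R \<Longrightarrow> y \<in> idl R \<Longrightarrow> x - y \<in> idl R"
  using idl_add[of x R "- y"] by (simp add: idl_uminus)

lemma idl_scale: "x \<in> idl R \<Longrightarrow> c \<cdot> x \<in> idl R"
  by (simp add: scale_def idl_mult_left)

lemma lift_idl:
  assumes "x \<in> idl R" "\<And>r. r \<in> R \<Longrightarrow> free.lift h r \<in> idl R'"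
  shows "free.lift h x \<in> idl R'"
  using assms(1)
  by (induction rule: idl.induct) (auto intro: idl_add idl_mult_left idl_mult_right assms(2))

section \<open>Congruences and the comparison with ideals of ring records\<close>

definition idl_cong :: "'r::ring_1 set \<Rightarrow> 'r \<Rightarrow> 'r \<Rightarrow> bool" where
  "idl_cong R x y \<longleftrightarrow> x - y \<in> idl R"

lemma idl_cong_refl [simp, intro]: "idl_cong R x x"
  by (simp add: idl_cong_def)

lemma idl_cong_sym: "idl_cong R x y \<Longrightarrow> idl_cong R y x"
  unfolding idl_cong_def by (metis idl_uminus minus_diff_eq)

lemma idl_cong_trans [trans]: "idl_cong R x y \<Longrightarrow> idl_cong R y z \<Longrightarrow> idl_cong R x z"
  unfolding idl_cong_def using idl_add[of "x - y" R "y - z"] by simp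

lemma idl_cong_add: "idl_cong R x y \<Longrightarrow> idl_cong R x' y' \<Longrightarrow> idl_cong R (x + x') (y + y')"
  unfolding idl_cong_def using idl_add[of "x - y" R "x' - y'"] by (simp add: algebra_simps)

lemma idl_cong_diff: "idl_cong R x y \<Longrightarrow> idl_cong R x' y' \<Longrightarrow> idl_cong R (x - x') (y - y')"
  unfolding idl_cong_def using idl_diff[of "x - y" R "x' - y'"] by (simp add: algebra_simps)

lemma idl_cong_mult: "idl_cong R x y \<Longrightarrow> idl_cong R x' y' \<Longrightarrow> idl_cong R (x * x') (y * y')"
  unfolding idl_cong_def
  using idl_add[OF idl_mult_right[of "x - y" R x'] idl_mult_left[of "x' - y'" R y]]
  by (simp add: algebra_simps)

lemma idl_cong_scale: "idl_cong R x y \<Longrightarrow> idl_cong R (c \<cdot> x) (c \<cdot> y)"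
  unfolding idl_cong_def by (metis idl_scale free.sc_diff_right)

lemma ring_free_ring: "ring (free_ring :: ('g, 'k::comm_ring_1) free ring)"
proof (intro ringI abelian_groupI monoidI; (simp add: free_ring_def algebra_simps; fail)?)
  show "\<exists>y\<in>carrier free_ring. y \<oplus>\<^bsub>free_ring\<^esub> x = \<zero>\<^bsub>free_ring\<^esub>" for x :: "('g, 'k) free"
    by (rule bexI[of _ "- x"]) (simp_all add: free_ring_def)
qed

lemma ideal_idl: "ideal (idl R) (free_ring :: ('g, 'k::comm_ring_1) free ring)"
proof (rule idealI[OF ring_free_ring])
  interpret ring "free_ring :: ('g, 'k) free ring"
    by (rule ring_free_ring)
  have "\<ominus>\<^bsub>free_ring\<^esub> x = - x" for x :: "('g, 'k) free"
    by (rule minus_equality) (simp_all add: free_ring_def)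
  then show "subgroup (idl R) (add_monoid (free_ring :: ('g, 'k) free ring))"
    by (intro add.subgroupI) (auto simp: idl_uminus idl_add free_ring_def simp flip: a_inv_def
        intro: idl_zero)
qed (auto simp: free_ring_def idl_mult_left idl_mult_right)

lemma genideal_eq_idl: "genideal free_ring R = idl R"
proof -
  interpret ring "free_ring :: ('g, 'k::comm_ring_1) free ring"
    by (rule ring_free_ring)
  have R: "R \<subseteq> carrier free_ring"
    by (simp add: free_ring_def)
  interpret I: ideal "genideal free_ring R" free_ring
    by (rule genideal_ideal[OF R])
  show ?thesis
  proof
    show "genideal free_ring R \<subseteq> idl R"
      by (rule genideal_minimal[OF ideal_idl]) (auto intro: idl_base)
    show "idl R \<subseteq> genideal free_ring R"
    proof
      fix x assume "x \<in> idl R"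
      then show "x \<in> genideal free_ring R"
      proof (induction rule: idl.induct)
        case idl_zero
        then show ?case using I.zero_closed by (simp add: free_ring_def)
      next
        case (idl_gen r a b)
        then have "r \<in> genideal free_ring R" using genideal_self[OF R] by auto
        then show ?case
          using I.I_r_closed[OF I.I_l_closed, of r a b] by (simp add: free_ring_def)
      next
        case (idl_add x y)
        then show ?case using I.a_closed[of x y] by (simp add: free_ring_def)
      qed
    qed
  qed
qed

lemma cls_eq_coset: "cls R x = (\<lambda>i. i + x) ` idl R"
  unfolding cls_def genideal_eq_idl by (auto simp: a_r_coset_def' free_ring_def)

lemma cls_eq_iff: "cls R x = cls R y \<longleftrightarrow> idl_cong R x y"
proof
  assume "cls R x = cls R y"
  moreover have "x \<in> cls R x"
    unfolding cls_eq_coset by (rule image_eqI[of _ _ 0]) simp_all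
  ultimately show "idl_cong R x y"
    unfolding idl_cong_def cls_eq_coset by auto
next
  have "cls R x \<subseteq> cls R y" if "idl_cong R x y" for x y
  proof
    fix z assume "z \<in> cls R x"
    then obtain i where "i \<in> idl R" "z = i + x"
      unfolding cls_eq_coset by blast
    then show "z \<in> cls R y"
      using that unfolding idl_cong_def cls_eq_coset
      by (intro image_eqI[of _ _ "i + (x - y)"]) (auto intro: idl_add)
  qed
  then show "idl_cong R x y \<Longrightarrow> cls R x = cls R y"
    by (blast dest: idl_cong_sym)
qed

section \<open>Algebras as images of free algebras\<close>

locale free_hom =
  fixes A :: "('k::comm_ring_1, 'a) module" and \<pi> :: "('x, 'k) free \<Rightarrow> 'a"
  assumes pi_closed [simp]: "\<pi> x \<in> carrier A"
    and pi_add: "\<pi> (x + y) = \<pi> x \<oplus>\<^bsub>A\<^esub> \<pi> y"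
    and pi_mult: "\<pi> (x * y) = \<pi> x \<otimes>\<^bsub>A\<^esub> \<pi> y"
    and pi_one: "\<pi> 1 = \<one>\<^bsub>A\<^esub>"
    and pi_zero: "\<pi> 0 = \<zero>\<^bsub>A\<^esub>"
    and pi_scale: "\<pi> (c \<cdot> x) = c \<odot>\<^bsub>A\<^esub> \<pi> x"

text \<open>Every element has a representative in the free algebra, so the ring axioms are inherited
  and statements about the carrier become computations with representatives.\<close>

locale free_image = free_hom A \<pi>
  for A :: "('k::comm_ring_1, 'a) module" and \<pi> :: "('x, 'k) free \<Rightarrow> 'a" +
  assumes carrier_eq: "carrier A = range \<pi>"
begin

lemma carrierE [elim]:
  assumes "a \<in> carrier A" obtains x where "a = \<pi> x"
  using assms by (auto simp: carrier_eq)

sublocale ring A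
proof (intro ringI abelian_groupI monoidI)
  fix a assume "a \<in> carrier A"
  then obtain x where "a = \<pi> x" ..
  then show "\<exists>b\<in>carrier A. b \<oplus>\<^bsub>A\<^esub> a = \<zero>\<^bsub>A\<^esub>"
    by (intro bexI[of _ "\<pi> (- x)"]) (simp_all flip: pi_add pi_zero)
qed (auto simp: carrier_eq algebra_simps simp flip: pi_add pi_mult pi_one pi_zero)

lemma pi_uminus: "\<ominus>\<^bsub>A\<^esub> \<pi> x = \<pi> (- x)"
  by (rule minus_equality) (simp_all flip: pi_add pi_zero)

lemma pi_diff: "\<pi> (x - y) = \<pi> x \<ominus>\<^bsub>A\<^esub> \<pi> y"
  by (simp add: a_minus_def pi_uminus flip: pi_add)

text \<open>Uniqueness is induction over the free algebra. For existence the map is defined through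
  chosen preimages under \<open>\<pi>\<close>; the second assumption makes the choice irrelevant,
  and the restriction makes the map extensional as the definite description demands.\<close>

lemma gen_hom_eq:
  assumes "free_hom B \<psi>" and "\<And>x y. \<pi> x = \<pi> y \<Longrightarrow> \<psi> x = \<psi> y"
  shows "gen_hom A B (\<lambda>g. \<pi> (var g)) (\<lambda>g. \<psi> (var g)) (\<pi> x) = \<psi> x"
proof -
  interpret B: free_hom B \<psi> by fact
  have uniq: "\<phi> (\<pi> x) = \<psi> x" if "\<phi> \<in> algebra_hom A B" "\<forall>g. \<phi> (\<pi> (var g)) = \<psi> (var g)" for \<phi> x
  proof (induction x rule: free_induct)
    case one
    then show ?case using that(1) by (simp add: pi_one B.pi_one algebra_hom_def ring_hom_def)
  next
    case (add x y)
    then show ?case using that(1) by (simp add: pi_add B.pi_add algebra_hom_def ring_hom_def)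
  next
    case (scale c x)
    then show ?case using that(1) by (simp add: pi_scale B.pi_scale algebra_hom_def)
  next
    case (var g x)
    then show ?case using that by (simp add: pi_mult B.pi_mult algebra_hom_def ring_hom_def)
  qed
  define \<phi> where "\<phi> = restrict (\<lambda>a. \<psi> (SOME x. \<pi> x = a)) (carrier A)"
  have \<phi>: "\<phi> (\<pi> x) = \<psi> x" for x
  proof -
    have "\<pi> (SOME y. \<pi> y = \<pi> x) = \<pi> x"
      by (rule someI) (rule refl)
    then have "\<psi> (SOME y. \<pi> y = \<pi> x) = \<psi> x"
      by (rule assms(2))
    then show ?thesis
      by (simp add: \<phi>_def)
  qed
  have "\<phi> \<in> ring_hom A B"
  proof (rule ring_hom_memI)
    fix a b assume "a \<in> carrier A" "b \<in> carrier A"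
    then obtain x y where [simp]: "a = \<pi> x" "b = \<pi> y"
      by (metis carrierE)
    show "\<phi> (a \<otimes>\<^bsub>A\<^esub> b) = \<phi> a \<otimes>\<^bsub>B\<^esub> \<phi> b"
      using \<phi>[of "x * y"] by (simp add: pi_mult B.pi_mult \<phi>)
    show "\<phi> (a \<oplus>\<^bsub>A\<^esub> b) = \<phi> a \<oplus>\<^bsub>B\<^esub> \<phi> b"
      using \<phi>[of "x + y"] by (simp add: pi_add B.pi_add \<phi>)
  next
    fix a assume "a \<in> carrier A"
    then show "\<phi> a \<in> carrier B"
      by (metis carrierE \<phi> B.pi_closed)
  next
    show "\<phi> \<one>\<^bsub>A\<^esub> = \<one>\<^bsub>B\<^esub>"
      using \<phi>[of 1] by (simp add: pi_one B.pi_one)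
  qed
  moreover have "\<phi> (c \<odot>\<^bsub>A\<^esub> a) = c \<odot>\<^bsub>B\<^esub> \<phi> a" if "a \<in> carrier A" for c a
    using that by (metis carrierE \<phi> pi_scale B.pi_scale)
  ultimately have hom: "\<phi> \<in> algebra_hom A B"
    by (simp add: algebra_hom_def)
  have ext: "\<phi> \<in> extensional (carrier A)"
    by (simp add: \<phi>_def)
  have "gen_hom A B (\<lambda>g. \<pi> (var g)) (\<lambda>g. \<psi> (var g)) = \<phi>"
    unfolding gen_hom_def
  proof (rule the_equality)
    show "\<phi> \<in> algebra_hom A B \<and> \<phi> \<in> extensional (carrier A) \<and> (\<forall>g. \<phi> (\<pi> (var g)) = \<psi> (var g))"
      using hom ext \<phi> by blast
  next
    fix \<phi>' assume \<phi>': "\<phi>' \<in> algebra_hom A B \<and> \<phi>' \<in> extensional (carrier A) \<and> (\<forall>g. \<phi>' (\<pi> (var g)) = \<psi>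
        (var g))"
    show "\<phi>' = \<phi>"
    proof (rule extensionalityI)
      fix a assume "a \<in> carrier A"
      then show "\<phi>' a = \<phi> a"
        using uniq \<phi>' \<phi> by (metis carrierE)
    qed (use \<phi>' ext in auto)
  qed
  then show ?thesis by (simp add: \<phi>)
qed

text \<open>This presents a negative part as an image of the free algebra on the index set alone,
  with its kernel still to be found.\<close>

lemma free_image_generated_subalgebra:
  fixes h :: "'y \<Rightarrow> ('x, 'k) free"
  shows "free_image (generated_subalgebra A (range (\<lambda>j. \<pi> (h j)))) (\<lambda>x. \<pi> (free.lift h x))"
proof -
  have "\<Inter>{S. k_subalgebra S A \<and> range (\<lambda>j. \<pi> (h j)) \<subseteq> S} = range (\<lambda>x. \<pi> (free.lift h x))"
  proof
    have "subring (range (\<lambda>x. \<pi> (free.lift h x))) A"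
    proof (rule subringI)
      show "\<one>\<^bsub>A\<^esub> \<in> range (\<lambda>x. \<pi> (free.lift h x))"
        by (rule range_eqI[of _ _ 1]) (simp add: pi_one)
    next
      fix a assume "a \<in> range (\<lambda>x. \<pi> (free.lift h x))"
      then show "\<ominus>\<^bsub>A\<^esub> a \<in> range (\<lambda>x. \<pi> (free.lift h x))"
        by (auto simp: pi_uminus simp flip: free.lift_uminus)
    next
      fix a b assume "a \<in> range (\<lambda>x. \<pi> (free.lift h x))" "b \<in> range (\<lambda>x. \<pi> (free.lift h x))"
      then show "a \<otimes>\<^bsub>A\<^esub> b \<in> range (\<lambda>x. \<pi> (free.lift h x))" "a \<oplus>\<^bsub>A\<^esub> b \<in> range (\<lambda>x. \<pi> (free.lift h x))"
        by (auto simp flip: pi_mult pi_add free.lift_mult free.lift_add)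
    qed auto
    moreover have "range (\<lambda>j. \<pi> (h j)) \<subseteq> range (\<lambda>x. \<pi> (free.lift h x))"
      by (rule image_subsetI, rule range_eqI[of _ _ "var _"]) simp
    ultimately show "\<Inter>{S. k_subalgebra S A \<and> range (\<lambda>j. \<pi> (h j)) \<subseteq> S} \<subseteq> range (\<lambda>x. \<pi> (free.lift h x))"
      by (intro Inter_lower) (auto simp: k_subalgebra_def simp flip: pi_scale free.lift_scale)
  next
    have "\<pi> (free.lift h x) \<in> S" if "k_subalgebra S A" "range (\<lambda>j. \<pi> (h j)) \<subseteq> S" for S x
      using that
      by (induction x rule: free_induct)
        (auto simp: pi_add pi_mult pi_scale pi_one k_subalgebra_def dest: subringE)
    then show "range (\<lambda>x. \<pi> (free.lift h x)) \<subseteq> \<Inter>{S. k_subalgebra S A \<and> range (\<lambda>j. \<pi> (h j)) \<subseteq> S}"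
      by blast
  qed
  then show ?thesis
    by unfold_locales
      (auto simp: generated_subalgebra_def pi_add pi_mult pi_scale pi_one pi_zero)
qed

end

lemma free_image_presented: "free_image (presented R) (cls R)"
proof -
  interpret I: ideal "genideal free_ring R" free_ring
    unfolding genideal_eq_idl by (rule ideal_idl)
  have carrier_free [simp]: "x \<in> carrier free_ring" for x :: "('a, 'b) free"
    by (simp add: free_ring_def)
  have ops: "x \<otimes>\<^bsub>free_ring\<^esub> y = x * y" "x \<oplus>\<^bsub>free_ring\<^esub> y = x + y" "\<one>\<^bsub>free_ring\<^esub> = 1" "\<zero>\<^bsub>free_ring\<^esub> = 0"
    for x y :: "('a, 'b) free"
    by (simp_all add: free_ring_def)
  note defs = presented_def Let_def ring.defs module.defs FactRing_def
  have mult: "cls R x \<otimes>\<^bsub>presented R\<^esub> cls R y = cls R (x * y)" for x y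
    using I.rcoset_mult_add[of x y] by (simp add: defs cls_def ops)
  show ?thesis
  proof
    show "cls R x \<in> carrier (presented R)" for x
      by (auto simp: defs cls_def A_RCOSETS_def')
    show "cls R (x + y) = cls R x \<oplus>\<^bsub>presented R\<^esub> cls R y" for x y
      using I.a_rcos_sum[of x y] by (simp add: defs cls_def ops)
    show "cls R (x * y) = cls R x \<otimes>\<^bsub>presented R\<^esub> cls R y" for x y
      by (simp add: mult)
    show "cls R 1 = \<one>\<^bsub>presented R\<^esub>"
      by (simp add: defs cls_def ops)
    show "cls R 0 = \<zero>\<^bsub>presented R\<^esub>"
      unfolding cls_eq_coset by (simp add: defs genideal_eq_idl)
    show "cls R (c \<cdot> x) = c \<odot>\<^bsub>presented R\<^esub> cls R x" for c x
      using mult[of "const c" x] by (simp add: defs scale_def)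
    show "carrier (presented R) = range (cls R)"
      by (auto simp: defs cls_def A_RCOSETS_def')
  qed
qed

section \<open>Skew derivations and the Serre ideal\<close>

locale quantum_datum =
  fixes D :: "('i, 'k::comm_ring_1) datum"
  assumes cartan: "symmetrizable_cartan (cartan D)"
    and params: "admissible_parameters D"
begin

abbreviation serre_coeff :: "'i \<Rightarrow> 'i \<Rightarrow> 'k" where
  "serre_coeff i j \<equiv> - ttheta D i j * upow (p1 D i) (cartan D i j)"

lemma boson_serre_eq:
  "boson_serre D x i j = free.serre (serre_coeff i j) (p1 D i) (serre_len D i j) (x i) (x j)"
  by (simp add: boson_serre_def free.serre_def)

definition serre_ideal :: "('i, 'k) free set" where
  "serre_ideal = idl {boson_serre D var i j | i j. i \<noteq> j}"

lemma units [simp]: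
  "theta D i j dvd 1" "p2 D i j dvd 1" "ttheta D i j dvd 1" "p1 D i dvd 1" "tp D i dvd 1"
  using params by (auto simp: admissible_parameters_def)

lemma generic_p1 [simp]: "generic (p1 D i)"
  using params unfolding generic_def admissible_parameters_def by blast

lemma generic_tp [simp]: "generic (tp D i)"
  using params unfolding generic_def admissible_parameters_def by blast

lemma tp_eq: "tp D i = (p1 D i)\<^sup>2"
  using params by (auto simp: admissible_parameters_def)

lemma ttheta_eq: "ttheta D i j = theta D i j * uinv (p2 D j i)"
  using params by (auto simp: admissible_parameters_def)

lemma p2_square: "(p2 D i j)\<^sup>2 = (upow (p1 D i) (cartan D i j))\<^sup>2"
  using params by (auto simp: admissible_parameters_def upow_double)

lemma upow_tp: "upow (tp D i) (cartan D i j) = (p2 D i j)\<^sup>2"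
  using params by (auto simp: admissible_parameters_def)

text \<open>The condition on p_ij p_ji contains p_i^(2 a_ij), which equals p_ij^2, so one factor
  p_ij can be cancelled.\<close>

lemma p2_mult_swap: "p2 D j i = theta D i j * theta D j i * p2 D i j"
proof -
  have "p2 D i j * p2 D j i = theta D i j * theta D j i * (p2 D i j)\<^sup>2"
    using params unfolding p2_square by (auto simp: admissible_parameters_def upow_double)
  then have "p2 D i j * p2 D j i = p2 D i j * (theta D i j * theta D j i * p2 D i j)"
    by (simp add: power2_eq_square mult_ac)
  then show ?thesis
    by (subst (asm) unit_cancel) simp_all
qed

text \<open>Exchanging \<open>i\<close> and \<open>j\<close> twice by \<open>p2_mult_swap\<close>
  returns p_ij multiplied by this square.\<close>

lemma theta_square: "(theta D i j * theta D j i)\<^sup>2 = 1"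
proof -
  have "p2 D i j * 1 = p2 D i j * (theta D i j * theta D j i)\<^sup>2"
    using p2_mult_swap[of i j] p2_mult_swap[of j i] by (simp add: power2_eq_square mult_ac)
  then show ?thesis
    by (subst (asm) unit_cancel) simp_all
qed

lemma cartan_nonpos: "i \<noteq> j \<Longrightarrow> cartan D i j \<le> 0"
  using cartan by (simp add: symmetrizable_cartan_def)

lemma serre_len_eq: "i \<noteq> j \<Longrightarrow> serre_len D i j = Suc (nat (- cartan D i j))"
  using cartan_nonpos[of i j] by (simp add: serre_len_def)

lemma upow_cartan: "i \<noteq> j \<Longrightarrow> upow (p1 D i) (cartan D i j) = uinv (p1 D i) ^ nat (- cartan D i j)"
  using cartan_nonpos[of i j] by (auto simp: upow_def)

lemma p2_diag: "p2 D i i = theta D i i * (p1 D i)\<^sup>2"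
  using params by (auto simp: admissible_parameters_def)

lemma theta_diag: "theta D i i * theta D i i = 1"
  using p2_mult_swap[of i i] unit_cancel[of "p2 D i i" 1 "theta D i i * theta D i i"] by (simp add:
      mult_ac)

end

lemma boson_serre_lift: "free.lift h (boson_serre D x i j) = boson_serre D (free.lift h \<circ> x) i j"
  by (simp add: boson_serre_def)

text \<open>The compatibility conditions are the hypotheses under which the errors \<open>serre_err_i\<close> and
  \<open>serre_err_j\<close> vanish, for each of the two summands of \<open>H i\<close>; \<open>xe i j\<close> is the coefficient of the
  Serre element of the \<open>e\<^sub>i\<close>.\<close>

locale skew_system = quantum_datum D for D :: "('i, 'k::comm_ring_1) datum" +
  fixes t \<alpha> \<beta> :: "'i \<Rightarrow> 'i \<Rightarrow> 'k" and a b :: "'i \<Rightarrow> 'k" and xe :: "'i \<Rightarrow> 'i \<Rightarrow> 'k"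
  assumes t_unit [simp]: "t i j dvd 1" and \<alpha>_unit [simp]: "\<alpha> i j dvd 1" and \<beta>_unit [simp]: "\<beta> i j dvd 1"
    and compat: "i \<noteq> j \<Longrightarrow> \<gamma> \<in> {\<alpha>, \<beta>} \<Longrightarrow> \<exists>y \<in> {p1 D i, uinv (p1 D i)}.
      t i i * uinv (\<gamma> i i) = y\<^sup>2 \<and>
      xe i j = - (t j i * uinv (\<gamma> i j) * y ^ nat (- cartan D i j)) \<and>
      serre_coeff i j = - (uinv (t i j) * \<gamma> i j * uinv y ^ nat (- cartan D i j))"
    and compat_e: "i \<noteq> j \<Longrightarrow> \<gamma> \<in> {\<alpha>, \<beta>} \<Longrightarrow> \<exists>y \<in> {p1 D i, uinv (p1 D i)}.
      xe i j * t i j * uinv (\<gamma> j i) = - (y ^ nat (- cartan D i j))"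
    and compat_f: "i \<noteq> j \<Longrightarrow> \<gamma> \<in> {\<alpha>, \<beta>} \<Longrightarrow> \<exists>y \<in> {p1 D i, uinv (p1 D i)}.
      serre_coeff i j * uinv (t j i) * \<gamma> j i = - (y ^ nat (- cartan D i j))"
begin

definition H :: "'i \<Rightarrow> ('i, 'k) endo" where
  "H i = escale (a i) (dg (\<alpha> i)) + escale (b i) (dg (\<beta> i))"

definition E_op :: "'i \<Rightarrow> ('i, 'k) endo" where
  "E_op i = der (t i) i (H i)"

abbreviation F_op :: "'i \<Rightarrow> ('i, 'k) endo" where
  "F_op j \<equiv> lmult (var j)"

lemma EF: "E_op i * F_op j = escale (t i j) (F_op j * E_op i) + (if i = j then H i else 0)"
  by (simp add: E_op_def der_lmult_var)

lemma E_dg: "E_op i * dg \<chi> = escale (\<chi> i) (dg \<chi> * E_op i)"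
  unfolding E_op_def by (rule der_dg) (simp add: H_def algebra_simps dg_commute)

lemma dg_E: "\<chi> i dvd 1 \<Longrightarrow> escale c (dg \<chi>) * E_op i = escale (uinv (\<chi> i)) (E_op i * escale c (dg \<chi>))"
  by (simp add: E_dg mult_ac)

lemma E_one [simp]: "app (E_op i) 1 = 0"
  by (simp add: E_op_def)

lemma E_serre:
  assumes "i \<noteq> j"
  shows "endo.serre (xe i j) (p1 D i) (serre_len D i j) (E_op i) (E_op j) = 0"
proof (rule endo_eq_zero)
  \<comment> \<open>In each term the operator applied first to 1 is \<open>E_op i\<close>, or
    \<open>E_op j\<close> when \<open>r = 0\<close>.\<close>
  have "app (E_op i ^ r) 1 = 0" if "r > 0" for r
    using that by (cases r) (simp_all add: power_Suc2 del: power_Suc)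
  then have "app (E_op j * E_op i ^ r) 1 = 0" for r
    by (cases "r = 0") simp_all
  then show "app (endo.serre (xe i j) (p1 D i) (serre_len D i j) (E_op i) (E_op j)) 1 = 0"
    by (simp add: endo.serre_def app_sum)
next
  fix k
  define m where "m = nat (- cartan D i j)"
  have N: "serre_len D i j = Suc m"
    using assms by (simp add: serre_len_eq m_def)
  let ?S = "endo.serre (xe i j) (p1 D i) (serre_len D i j) (E_op i) (E_op j)"
  consider "k = i" | "k = j" | "k \<noteq> i" "k \<noteq> j" by blast
  then show "\<exists>c. ?S * F_op k = escale c (F_op k * ?S)"
  proof cases
    case 1
    have "endo.serre_err_i (xe i j) (p1 D i) (Suc m) (E_op i) (E_op j) (t i i) (t j i) (escale c (dg
        (\<gamma> i))) = 0"
      if "\<gamma> \<in> {\<alpha>, \<beta>}" for \<gamma> c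
    proof -
      have [simp]: "\<gamma> i l dvd 1" for l
        using that by auto
      obtain y where y: "y \<in> {p1 D i, uinv (p1 D i)}" "t i i * uinv (\<gamma> i i) = y\<^sup>2"
        "xe i j = - (t j i * uinv (\<gamma> i j) * y ^ m)"
        using compat[OF assms \<open>\<gamma> \<in> {\<alpha>, \<beta>}\<close>] unfolding m_def by blast
      show ?thesis
        by (rule endo.serre_err_i_eq_0[OF generic_p1 y(1) dg_E[of "\<gamma> i" i c] dg_E[of "\<gamma> i" j c]
            y(2,3)]) simp_all
    qed
    then have "endo.serre_err_i (xe i j) (p1 D i) (Suc m) (E_op i) (E_op j) (t i i) (t j i) (H i) = 0"
      by (simp add: H_def endo.serre_err_i_add)
    then show ?thesis
      using endo.serre_skew_i_err[of "E_op i" "F_op k" "t i i" "H i" "E_op j" "t j i" "xe i j" "p1 D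
          i" "Suc m"] 1 assms N
      by (auto simp: EF)
  next
    case 2
    have "endo.serre_err_j (xe i j) (p1 D i) (Suc m) (E_op i) (t i j) (escale c (dg (\<gamma> j))) = 0"
      if "\<gamma> \<in> {\<alpha>, \<beta>}" for \<gamma> c
    proof -
      have [simp]: "\<gamma> j l dvd 1" for l
        using that by auto
      obtain y where y: "y \<in> {p1 D i, uinv (p1 D i)}" "xe i j * t i j * uinv (\<gamma> j i) = - (y ^ m)"
        using compat_e[OF assms \<open>\<gamma> \<in> {\<alpha>, \<beta>}\<close>] unfolding m_def by blast
      show ?thesis
        by (rule endo.serre_err_j_eq_0[OF generic_p1 y(1) dg_E[of "\<gamma> j" i c] y(2)]) simp
    qed
    then have "endo.serre_err_j (xe i j) (p1 D i) (Suc m) (E_op i) (t i j) (H j) = 0"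
      by (simp add: H_def endo.serre_err_j_add)
    then show ?thesis
      using endo.serre_skew_j_err[of "E_op i" "F_op k" "t i j" "E_op j" "t j j" "H j" "xe i j" "p1 D
          i" "Suc m"] 2 assms N
      by (auto simp: EF)
  next
    case 3
    \<comment> \<open>\<open>F_op k\<close> is opposite to neither operator, so the computation for
      \<open>j\<close> applies with error term \<open>H\<close> equal to 0.\<close>
    then show ?thesis
      using endo.serre_skew_j_err[of "E_op i" "F_op k" "t i k" "E_op j" "t j k" 0 "xe i j" "p1 D i"
          "Suc m"] assms N
      by (auto simp: EF endo.serre_err_j_def)
  qed
qed

lemma FE: "F_op j * E_op k = escale (uinv (t k j)) (E_op k * F_op j) + (if j = k then escale (- uinv
    (t k j)) (H k) else 0)"
  by (auto simp: EF endo.sc_add_right endo.sc_minus_left)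

lemma dg_F: "escale c (dg \<chi>) * F_op j = escale (\<chi> j) (F_op j * escale c (dg \<chi>))"
  by (simp add: dg_lmult_var mult_ac)

text \<open>Solving for \<open>F_op j * E_op k\<close>, the roles of \<open>E\<close> and \<open>F\<close> in the Serre computation are exchanged.\<close>

lemma serre_F_E:
  assumes "i \<noteq> j"
  shows "\<exists>c. c dvd 1 \<and>
    lmult (boson_serre D var i j) * E_op k = escale c (E_op k * lmult (boson_serre D var i j))"
proof -
  define m where "m = nat (- cartan D i j)"
  have N: "serre_len D i j = Suc m"
    using assms by (simp add: serre_len_eq m_def)
  let ?S = "endo.serre (serre_coeff i j) (p1 D i) (Suc m) (F_op i) (F_op j)"
  have S: "lmult (boson_serre D var i j) = ?S"
  proof -
    have "lmult (boson_serre D var i j) = endo.lift (\<lambda>j. F_op j) (boson_serre D var i j)"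
      by (simp add: lift_lmult lift_var_id)
    also have "\<dots> = ?S"
      unfolding boson_serre_eq N by simp
    finally show ?thesis .
  qed
  consider "k = i" | "k = j" | "k \<noteq> i" "k \<noteq> j" by blast
  then have "\<exists>c. c dvd 1 \<and> ?S * E_op k = escale c (E_op k * ?S)"
  proof cases
    case 1
    have "endo.serre_err_i (serre_coeff i j) (p1 D i) (Suc m) (F_op i) (F_op j) (uinv (t i i)) (uinv
        (t i j)) (escale c (dg (\<gamma> i))) = 0"
      if "\<gamma> \<in> {\<alpha>, \<beta>}" for \<gamma> c
    proof -
      have [simp]: "\<gamma> i l dvd 1" for l
        using that by auto
      obtain y where y: "y \<in> {p1 D i, uinv (p1 D i)}" and y2: "t i i * uinv (\<gamma> i i) = y\<^sup>2"
        and x: "serre_coeff i j = - (uinv (t i j) * \<gamma> i j * uinv y ^ nat (- cartan D i j))"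
        using compat[OF assms \<open>\<gamma> \<in> {\<alpha>, \<beta>}\<close>] by blast
      have [simp]: "y dvd 1" using y by auto
      have "uinv (t i i * uinv (\<gamma> i i)) = uinv (y\<^sup>2)"
        using y2 by simp
      then have "uinv (t i i) * \<gamma> i i = (uinv y)\<^sup>2"
        by (simp add: uinv_mult uinv_power)
      moreover have "uinv y \<in> {p1 D i, uinv (p1 D i)}"
        using y by auto
      ultimately show ?thesis
        by (intro endo.serre_err_i_eq_0[OF generic_p1 _ dg_F[of c "\<gamma> i" i] dg_F[of c "\<gamma> i" j] _
            x[folded m_def]])
    qed
    then have "endo.serre_err_i (serre_coeff i j) (p1 D i) (Suc m) (F_op i) (F_op j) (uinv (t i i))
        (uinv (t i j)) (escale (- uinv (t i i)) (H i)) = 0"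
      by (simp add: H_def endo.serre_err_i_add endo.sc_add_right)
    then have "?S * E_op k = escale (uinv (t i i) ^ Suc m * uinv (t i j)) (E_op k * ?S)"
      using endo.serre_skew_i_err[of "F_op i" "E_op k" "uinv (t i i)" "escale (- uinv (t i i)) (H
          i)" "F_op j" "uinv (t i j)" "serre_coeff i j" "p1 D i" "Suc m"] 1 assms
      by (auto simp: FE)
    moreover have "uinv (t i i) ^ Suc m * uinv (t i j) dvd 1"
      by (intro unit_mult unit_power uinv_unit t_unit)
    ultimately show ?thesis
      by blast
  next
    case 2
    have "endo.serre_err_j (serre_coeff i j) (p1 D i) (Suc m) (F_op i) (uinv (t j i)) (escale c (dg
        (\<gamma> j))) = 0"
      if "\<gamma> \<in> {\<alpha>, \<beta>}" for \<gamma> c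
    proof -
      obtain y where y: "y \<in> {p1 D i, uinv (p1 D i)}"
        "serre_coeff i j * uinv (t j i) * \<gamma> j i = - (y ^ m)"
        using compat_f[OF assms \<open>\<gamma> \<in> {\<alpha>, \<beta>}\<close>] unfolding m_def by blast
      show ?thesis
        by (rule endo.serre_err_j_eq_0[OF generic_p1 y(1) dg_F[of c "\<gamma> j" i] y(2)])
    qed
    then have "endo.serre_err_j (serre_coeff i j) (p1 D i) (Suc m) (F_op i) (uinv (t j i)) (escale
        (- uinv (t j j)) (H j)) = 0"
      by (simp add: H_def endo.serre_err_j_add endo.sc_add_right)
    then have "?S * E_op k = escale (uinv (t j i) ^ Suc m * uinv (t j j)) (E_op k * ?S)"
      using endo.serre_skew_j_err[of "F_op i" "E_op k" "uinv (t j i)" "F_op j" "uinv (t j j)"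
          "escale (- uinv (t j j)) (H j)" "serre_coeff i j" "p1 D i" "Suc m"] 2 assms
      by (auto simp: FE)
    moreover have "uinv (t j i) ^ Suc m * uinv (t j j) dvd 1"
      by (intro unit_mult unit_power uinv_unit t_unit)
    ultimately show ?thesis
      by blast
  next
    case 3
    then have "?S * E_op k = escale (uinv (t k i) ^ Suc m * uinv (t k j)) (E_op k * ?S)"
      using endo.serre_skew_j_err[of "F_op i" "E_op k" "uinv (t k i)" "F_op j" "uinv (t k j)" 0
          "serre_coeff i j" "p1 D i" "Suc m"] assms
      by (auto simp: FE endo.serre_err_j_def)
    moreover have "uinv (t k i) ^ Suc m * uinv (t k j) dvd 1"
      by (intro unit_mult unit_power uinv_unit t_unit)
    ultimately show ?thesis
      by blast
  qed
  then show ?thesis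
    by (simp add: S)
qed

text \<open>Serre elements are homogeneous: all their monomials contain \<open>i\<close> and
  \<open>j\<close> equally often, so rescaling the generators multiplies them by a scalar.\<close>

lemma dg_serre_ideal:
  assumes "x \<in> serre_ideal"
  shows "app (dg \<chi>) x \<in> serre_ideal"
  using assms unfolding serre_ideal_def
proof (induction rule: idl.induct)
  case (idl_gen r c d)
  then obtain i j where r: "r = boson_serre D var i j" and ij: "i \<noteq> j"
    by blast
  define N where "N = serre_len D i j"
  let ?h = "\<lambda>j. \<chi> j \<cdot> var j"
  have "free.lift ?h r = (\<chi> i ^ N * \<chi> j) \<cdot> r"
  proof -
    have "(\<chi> i \<cdot> var i) ^ (N - k) * (\<chi> j \<cdot> var j) * (\<chi> i \<cdot> var i) ^ k
      = (\<chi> i ^ N * \<chi> j) \<cdot> (var i ^ (N - k) * var j * var i ^ k)" if "k \<le> N" for k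
    proof -
      have "\<chi> i ^ N = \<chi> i ^ (N - k) * \<chi> i ^ k"
        using that by (simp flip: power_add)
      then show ?thesis
        by (simp add: free.sc_power mult_ac)
    qed
    then show ?thesis
      unfolding r boson_serre_eq free.lift_serre free.lift_var
      by (simp add: free.serre_def N_def free.sc_sum_right mult.commute)
  qed
  then have "app (dg \<chi>) (c * r * d) = (\<chi> i ^ N * \<chi> j) \<cdot> (app (dg \<chi>) c * r * app (dg \<chi>) d)"
    by (simp add: app_dg)
  with idl_gen show ?case
    by (simp add: idl_scale idl.idl_gen)
qed (auto intro: idl_add)

lemma H_serre_ideal: "x \<in> serre_ideal \<Longrightarrow> app (H i) x \<in> serre_ideal"
  using dg_serre_ideal unfolding serre_ideal_def by (auto simp: H_def intro!: idl_add idl_scale)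

text \<open>A multiple \<open>r * v\<close> of a Serre element is handled by
  \<open>serre_F_E\<close>; left factors are then restored letter by letter.\<close>

lemma E_op_serre_ideal:
  assumes "x \<in> serre_ideal"
  shows "app (E_op k) x \<in> serre_ideal"
  using assms unfolding serre_ideal_def
proof (induction rule: idl.induct)
  case (idl_gen r c d)
  then obtain i j where r: "r = boson_serre D var i j" and ij: "i \<noteq> j"
    by blast
  have rJ: "u * r * v \<in> serre_ideal" for u v
    unfolding serre_ideal_def by (rule idl.idl_gen) (rule idl_gen)
  have base: "app (E_op k) (r * v) \<in> serre_ideal" for v
  proof -
    obtain z where z: "z dvd 1" "lmult r * E_op k = escale z (E_op k * lmult r)"
      using serre_F_E[OF ij, of k] unfolding r by blast
    \<comment> \<open>Here it matters that the scalar in \<open>serre_F_E\<close> is a unit: the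
      equation is solved for \<open>app (E_op k) (r * v)\<close>, which thus lies in the
      ideal.\<close>
    have "r * app (E_op k) v = z \<cdot> app (E_op k) (r * v)"
      using arg_cong[OF z(2), of "\<lambda>f. app f v"] by simp
    then have "uinv z \<cdot> (1 * r * app (E_op k) v) = app (E_op k) (r * v)"
      using z(1) by simp
    then show ?thesis
      using idl_scale[OF rJ[of 1 "app (E_op k) v", unfolded serre_ideal_def], of "uinv z"]
      unfolding serre_ideal_def by (simp only:)
  qed
  \<comment> \<open>The skew Leibniz rule passes one letter at a time, and its extra term stays in
    the ideal because \<open>H k\<close> preserves it.\<close>
  have "app (E_op k) (c * r * v) \<in> serre_ideal" for v
  proof (induction c rule: free_induct)
    case one
    show ?case using base by simp
  next
    case (add x y)
    then show ?case
      unfolding serre_ideal_def distrib_right app_add by (rule idl_add)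
  next
    case (scale z x)
    then show ?case
      unfolding serre_ideal_def by (simp add: idl_scale)
  next
    case (var l c)
    have "var l * app (E_op k) (c * r * v) \<in> serre_ideal" 
      using var unfolding serre_ideal_def by (rule idl_mult_left)
    moreover have "app (H k) (c * r * v) \<in> serre_ideal"
      by (rule H_serre_ideal[OF rJ])
    ultimately have "t k l \<cdot> (var l * app (E_op k) (c * r * v)) + (if k = l then app (H k) (c * r *
        v) else 0) \<in> serre_ideal"
      unfolding serre_ideal_def by (auto intro!: idl_add idl_scale simp del: app_add)
    then show ?case
      by (simp only: E_op_def der_var_mult mult.assoc)
  qed
  then show ?case by (simp add: serre_ideal_def)
qed (auto intro: idl_add)

end

section \<open>Parameters of the boson algebra and of the two quantum groups\<close>

context quantum_datum
begin

lemma ttheta_diag: "ttheta D i i = (uinv (p1 D i))\<^sup>2"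
  by (simp add: ttheta_eq p2_diag uinv_mult uinv_power mult.assoc)

lemma p2_diag_square: "(p2 D i i)\<^sup>2 = p1 D i ^ 4"
proof -
  have "(theta D i i)\<^sup>2 = 1"
    using theta_diag[of i] by (simp add: power2_eq_square)
  then show ?thesis
    unfolding p2_diag by (simp add: power_mult_distrib flip: power_mult)
qed

lemma upow_tp_minus: "upow (tp D i) (- cartan D i j) = uinv ((p2 D i j)\<^sup>2)"
  by (simp add: upow_minus upow_tp)

text \<open>For \<open>i \<noteq> j\<close> all parameters are monomials in \<open>P = p2 D i j\<close>, \<open>S = theta D j i\<close>, \<open>T = theta D i j\<close>,
  \<open>w = p1 D i ^ (- cartan D i j)\<close> and its inverse \<open>u\<close>, whose only relations are the listed ones.\<close>

lemma off_diagonal: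
  assumes "i \<noteq> j"
  obtains P S T u w where
    "theta D i j = T" "theta D j i = S" "p2 D i j = P" "p2 D j i = S * (T * P)"
    "p1 D i ^ nat (- cartan D i j) = w" "uinv (p1 D i) ^ nat (- cartan D i j) = u"
    "upow (p1 D i) (cartan D i j) = u" "upow (p1 D i) (- cartan D i j) = w"
    "ttheta D i j = P * (S * (T * (T * (w * w))))" "ttheta D j i = P * (S * (w * w))"
    "uinv P = P * (w * w)" "uinv S = S * (T * T)" "uinv T = S * (S * T)"
    "P dvd 1" "S dvd 1" "T dvd 1" "u dvd 1" "w dvd 1" "uinv u = w" "uinv w = u"
    "u * w = 1" "\<And>z. u * (w * z) = z" "P * P = u * u" "\<And>z. P * (P * z) = u * (u * z)"
    "S * (S * (T * T)) = 1" "\<And>z. S * (S * (T * (T * z))) = z"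
proof -
  define P S T u w where defs: "P = p2 D i j" "S = theta D j i" "T = theta D i j"
    "u = uinv (p1 D i) ^ nat (- cartan D i j)" "w = p1 D i ^ nat (- cartan D i j)"
  have units': "P dvd 1" "S dvd 1" "T dvd 1" "u dvd 1" "w dvd 1"
    by (simp_all add: defs)
  have upow: "upow (p1 D i) (cartan D i j) = u"
    using assms by (simp add: upow_cartan defs)
  have uw: "u * w = 1"
    by (simp add: defs power_uinv_cancel)
  then have uw': "u * (w * z) = z" for z
    by (simp flip: mult.assoc)
  have PP: "P * P = u * u"
    using p2_square[of i j] by (simp add: power2_eq_square upow defs(1))
  then have PP': "P * (P * z) = u * (u * z)" for z
    by (simp flip: mult.assoc)
  have ST: "S * (S * (T * T)) = 1"
    using theta_square[of i j] by (simp add: power2_eq_square mult_ac defs)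
  then have ST': "S * (S * (T * (T * z))) = z" for z
    by (simp flip: mult.assoc)
  have P2: "p2 D j i = S * (T * P)"
    unfolding p2_mult_swap[of j i] defs by (simp add: mult_ac)
  have inv: "uinv P = P * (w * w)" "uinv S = S * (T * T)" "uinv T = S * (S * T)"
    by (rule uinv_eqI, simp add: PP PP' ST ST' uw uw' mult_ac)+
  have inv_u: "uinv u = w" "uinv w = u"
    by (rule uinv_eqI, simp add: uw mult_ac)+
  have tt: "ttheta D i j = P * (S * (T * (T * (w * w))))" "ttheta D j i = P * (S * (w * w))"
  proof -
    have "uinv (S * (T * P)) = P * (S * (T * (w * w)))"
      by (rule uinv_eqI) (simp add: PP PP' ST ST' uw uw' mult_ac)
    then show "ttheta D i j = P * (S * (T * (T * (w * w))))"
      unfolding ttheta_eq P2 by (simp add: defs(3)[symmetric] mult_ac)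
    show "ttheta D j i = P * (S * (w * w))"
      unfolding ttheta_eq defs(1)[symmetric] defs(2)[symmetric] inv by (simp add: mult_ac)
  qed
  show thesis
    by (rule that[of T S P w u])
      (fact units' upow uw uw' PP PP' ST ST' P2 inv inv_u tt defs[symmetric] | simp add: upow_minus
          upow inv_u)+
qed

text \<open>These are the compatibility conditions, sorted by the scaling \<open>\<gamma>\<close>:
  items 1 to 4 for the constant 1, items 5 to 8 for p_ij^(-2), items 9 to 12 for p_ij^(-1), items 13
  to 16 for p_ij. Item 17 identifies the coefficient in the \<open>f\<close>-Serre relation of
  \<open>U\<close> with \<open>serre_coeff\<close>.\<close>

lemma serre_coeff_eqs:
  assumes "i \<noteq> j"
  defines "m \<equiv> nat (- cartan D i j)"
  shows "serre_coeff i j = - (ttheta D i j * uinv (p1 D i) ^ m)"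
    "serre_coeff i j = - (uinv (ttheta D j i) * p1 D i ^ m)"
    "serre_coeff i j * ttheta D j i = - (p1 D i ^ m)"
    "serre_coeff i j * uinv (ttheta D i j) = - (uinv (p1 D i) ^ m)"
    "serre_coeff i j = - (ttheta D i j * (p2 D i j)\<^sup>2 * p1 D i ^ m)"
    "serre_coeff i j = - (uinv (ttheta D j i) * uinv ((p2 D i j)\<^sup>2) * uinv (p1 D i) ^ m)"
    "serre_coeff i j * ttheta D j i * (p2 D j i)\<^sup>2 = - (uinv (p1 D i) ^ m)"
    "serre_coeff i j * uinv (ttheta D i j) * uinv ((p2 D j i)\<^sup>2) = - (p1 D i ^ m)"
    "cc D i j * theta D i j = theta D i j * p2 D i j * p1 D i ^ m"
    "serre_coeff i j = - (uinv (theta D j i) * uinv (p2 D i j) * uinv (p1 D i) ^ m)"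
    "cc D i j * theta D i j * theta D j i * p2 D j i = uinv (p1 D i) ^ m"
    "serre_coeff i j * uinv (theta D i j) * uinv (p2 D j i) = - (p1 D i ^ m)"
    "cc D i j * theta D i j = theta D i j * uinv (p2 D i j) * uinv (p1 D i) ^ m"
    "serre_coeff i j = - (uinv (theta D j i) * p2 D i j * p1 D i ^ m)"
    "cc D i j * theta D i j * theta D j i * uinv (p2 D j i) = p1 D i ^ m"
    "serre_coeff i j * uinv (theta D i j) * p2 D j i = - (uinv (p1 D i) ^ m)"
    "serre_coeff i j = - (cc D i j * uinv (theta D j i))"
    "uinv (ttheta D j i) * p1 D i ^ m = ttheta D i j * uinv (p1 D i) ^ m"
  unfolding m_def cc_def
  by (rule off_diagonal[OF assms(1)],
      simp add: power2_eq_square uinv_mult mult.assoc; simp add: mult_ac; fail)+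

lemma skew_system_boson:
  "skew_system D (\<lambda>i j. ttheta D j i) (\<lambda>i j. 1) (\<lambda>i j. 1) serre_coeff"
proof
  fix i j :: 'i and \<gamma> :: "'i \<Rightarrow> 'i \<Rightarrow> 'k" assume ij: "i \<noteq> j" and "\<gamma> \<in> {\<lambda>i j. 1, \<lambda>i j. 1}"
  then have [simp]: "\<gamma> = (\<lambda>i j. 1)" by simp
  show "\<exists>y \<in> {p1 D i, uinv (p1 D i)}.
      ttheta D i i * uinv (\<gamma> i i) = y\<^sup>2 \<and>
      serre_coeff i j = - (ttheta D i j * uinv (\<gamma> i j) * y ^ nat (- cartan D i j)) \<and>
      serre_coeff i j = - (uinv (ttheta D j i) * \<gamma> i j * uinv y ^ nat (- cartan D i j))"
    using serre_coeff_eqs(1,2)[OF ij] by (intro bexI[of _ "uinv (p1 D i)"]) (simp_all add: ttheta_diag)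
  show "\<exists>y \<in> {p1 D i, uinv (p1 D i)}.
      serre_coeff i j * ttheta D j i * uinv (\<gamma> j i) = - (y ^ nat (- cartan D i j))"
    using serre_coeff_eqs(3)[OF ij] by (intro bexI[of _ "p1 D i"]) simp_all
  show "\<exists>y \<in> {p1 D i, uinv (p1 D i)}.
      serre_coeff i j * uinv (ttheta D i j) * \<gamma> j i = - (y ^ nat (- cartan D i j))"
    using serre_coeff_eqs(4)[OF ij] by (intro bexI[of _ "uinv (p1 D i)"]) simp_all
qed simp_all

text \<open>The two scalings describe how 1 and \<open>K i\<close> pass the generators, since the
  relation between \<open>e\<close> and \<open>f\<close> involves the difference of 1 and
  \<open>K i\<close>. The first needs \<open>y\<close> to be the inverse of p_i, the second p_i
  itself, because the squares of the diagonal p_ii equal p_i^4.\<close>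

lemma skew_system_cU:
  "skew_system D (\<lambda>i j. ttheta D j i) (\<lambda>i j. 1) (\<lambda>i j. uinv ((p2 D i j)\<^sup>2)) serre_coeff"
proof
  fix i j :: 'i and \<gamma> :: "'i \<Rightarrow> 'i \<Rightarrow> 'k"
  assume ij: "i \<noteq> j" and "\<gamma> \<in> {\<lambda>i j. 1, \<lambda>i j. uinv ((p2 D i j)\<^sup>2)}"
  then consider "\<gamma> = (\<lambda>i j. 1)" | "\<gamma> = (\<lambda>i j. uinv ((p2 D i j)\<^sup>2))"
    by blast
  then show "\<exists>y \<in> {p1 D i, uinv (p1 D i)}.
      ttheta D i i * uinv (\<gamma> i i) = y\<^sup>2 \<and>
      serre_coeff i j = - (ttheta D i j * uinv (\<gamma> i j) * y ^ nat (- cartan D i j)) \<and>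
      serre_coeff i j = - (uinv (ttheta D j i) * \<gamma> i j * uinv y ^ nat (- cartan D i j))"
  proof cases
    case 1
    then show ?thesis
      using serre_coeff_eqs(1,2)[OF ij] by (intro bexI[of _ "uinv (p1 D i)"]) (simp_all add: ttheta_diag)
  next
    case 2
    have "p1 D i ^ 4 = (p1 D i)\<^sup>2 * (p1 D i)\<^sup>2"
      by (simp flip: power_add)
    then have "(uinv (p1 D i))\<^sup>2 * p1 D i ^ 4 = ((uinv (p1 D i))\<^sup>2 * (p1 D i)\<^sup>2) * (p1 D i)\<^sup>2"
      by (simp only: mult.assoc)
    then have "(uinv (p1 D i))\<^sup>2 * p1 D i ^ 4 = (p1 D i)\<^sup>2"
      by (simp only: power_uinv_cancel units mult_1_left)
    then show ?thesis
      using serre_coeff_eqs(5,6)[OF ij] 2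
      by (intro bexI[of _ "p1 D i"]) (simp_all add: ttheta_diag p2_diag_square)
  qed
  show "\<exists>y \<in> {p1 D i, uinv (p1 D i)}.
      serre_coeff i j * ttheta D j i * uinv (\<gamma> j i) = - (y ^ nat (- cartan D i j))"
    using \<open>\<gamma> \<in> _\<close> serre_coeff_eqs(3,7)[OF ij] by (elim insertE) simp_all
  show "\<exists>y \<in> {p1 D i, uinv (p1 D i)}.
      serre_coeff i j * uinv (ttheta D i j) * \<gamma> j i = - (y ^ nat (- cartan D i j))"
    using \<open>\<gamma> \<in> _\<close> serre_coeff_eqs(4,8)[OF ij] by (elim insertE) simp_all
qed simp_all

text \<open>The two scalings belong to \<open>K i\<close> and \<open>KI i\<close>; they need
  \<open>y\<close> equal to p_i and to its inverse, respectively.\<close>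

lemma skew_system_U:
  "skew_system D (\<lambda>i j. theta D j i) (\<lambda>i j. uinv (p2 D i j)) (p2 D) (\<lambda>i j. - cc D i j * theta D i j)"
proof
  fix i j :: 'i and \<gamma> :: "'i \<Rightarrow> 'i \<Rightarrow> 'k"
  assume ij: "i \<noteq> j" and "\<gamma> \<in> {\<lambda>i j. uinv (p2 D i j), p2 D}"
  then consider "\<gamma> = (\<lambda>i j. uinv (p2 D i j))" | "\<gamma> = p2 D"
    by blast
  then show "\<exists>y \<in> {p1 D i, uinv (p1 D i)}.
      theta D i i * uinv (\<gamma> i i) = y\<^sup>2 \<and>
      - cc D i j * theta D i j = - (theta D i j * uinv (\<gamma> i j) * y ^ nat (- cartan D i j)) \<and>
      serre_coeff i j = - (uinv (theta D j i) * \<gamma> i j * uinv y ^ nat (- cartan D i j))"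
  proof cases
    case 1
    have "theta D i i * p2 D i i = (p1 D i)\<^sup>2"
      using theta_diag[of i] by (simp add: p2_diag flip: mult.assoc)
    then show ?thesis
      using serre_coeff_eqs(9,10)[OF ij] 1 by (intro bexI[of _ "p1 D i"]) simp_all
  next
    case 2
    have "theta D i i * uinv (p2 D i i) = (uinv (p1 D i))\<^sup>2"
      by (simp add: p2_diag uinv_mult uinv_power)
    then show ?thesis
      using serre_coeff_eqs(13,14)[OF ij] 2
      by (intro bexI[of _ "uinv (p1 D i)"]) simp_all
  qed
  show "\<exists>y \<in> {p1 D i, uinv (p1 D i)}.
      - cc D i j * theta D i j * theta D j i * uinv (\<gamma> j i) = - (y ^ nat (- cartan D i j))"
    using \<open>\<gamma> \<in> _\<close> serre_coeff_eqs(11,15)[OF ij] by (elim insertE) simp_all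
  show "\<exists>y \<in> {p1 D i, uinv (p1 D i)}.
      serre_coeff i j * uinv (theta D i j) * \<gamma> j i = - (y ^ nat (- cartan D i j))"
    using \<open>\<gamma> \<in> _\<close> serre_coeff_eqs(12,16)[OF ij] by (elim insertE) simp_all
qed simp_all

end

section \<open>Serre relations in divided powers\<close>

text \<open>The factorials of the divided powers are those of the binomial, except for the common
  one of index \<open>N\<close>.\<close>

lemma serre_divided_powers:
  assumes "generic q"
  shows "(\<Sum>r\<le>N. y ^ r \<cdot> ((uinv (qfact q (N - r)) \<cdot> e ^ (N - r)) * d * (uinv (qfact q r) \<cdot> e ^ r)))
    = uinv (qfact q N) \<cdot> free.serre y q N e d"
proof -
  have "uinv (qfact q N) * qbinom q N r = uinv (qfact q r) * uinv (qfact q (N - r))" for r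
    using assms by (simp add: qbinom_def uinv_mult)
  then have "y ^ r * (uinv (qfact q (N - r)) * uinv (qfact q r)) = uinv (qfact q N) * (y ^ r *
      qbinom q N r)" for r
    by (metis mult.commute mult.left_commute)
  then show ?thesis
    unfolding free.serre_def free.sc_sum_right
    by (intro sum.cong refl) (simp add: mult_ac)
qed

definition triangle :: "nat \<Rightarrow> nat" where
  "triangle n = n * (n - 1) div 2"

lemma triangle_0 [simp]: "triangle 0 = 0"
  by (simp add: triangle_def)

lemma triangle_Suc: "triangle (Suc n) = n + triangle n"
  by (cases n) (simp_all add: triangle_def)

lemma triangle_add: "triangle (r + s) = triangle r + triangle s + r * s"
  by (induction r) (simp_all add: triangle_Suc)

lemma triangle_reflect:
  assumes "r \<le> Suc m"
  shows "triangle r + triangle (Suc m) = triangle (Suc m - r) + r * m"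
proof -
  have double: "triangle (Suc n) + triangle (Suc n) = Suc n * n" for n
    by (induction n) (simp_all add: triangle_Suc)
  obtain s where s: "Suc m = r + s"
    using assms le_Suc_ex by blast
  show ?thesis
  proof (cases r)
    case (Suc n)
    then have "m = n + s" using s by simp
    then show ?thesis
      unfolding s triangle_add using double[of n] Suc by (simp add: algebra_simps)
  qed simp
qed

text \<open>The angle factorials contribute powers of \<open>q\<close> with quadratic exponents.
  Together with the quadratic exponent in the relation they leave one that is linear in
  \<open>r\<close>, up to a factor independent of \<open>r\<close>, so it can be absorbed into the
  base of the Serre coefficient.\<close>

lemma triangle_power_reflect:
  fixes q :: "'k::comm_ring_1"
  assumes "q dvd 1" "r \<le> Suc m"
  shows "(q\<^sup>2) ^ triangle r * (uinv q ^ triangle (Suc m - r) * uinv q ^ triangle r)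
    = uinv q ^ triangle (Suc m) * (q ^ m) ^ r"
proof -
  let ?X = "q ^ triangle r" and ?Y = "q ^ triangle (Suc m - r)" and ?Z = "q ^ triangle (Suc m)"
  let ?X' = "uinv q ^ triangle r" and ?Y' = "uinv q ^ triangle (Suc m - r)"
    and ?Z' = "uinv q ^ triangle (Suc m)"
  have XX': "?X * ?X' = 1" "?Y * ?Y' = 1" "?Z * ?Z' = 1"
    using assms(1) by (simp_all add: power_uinv_cancel)
  have XZ: "?X * ?Z = ?Y * (q ^ m) ^ r"
    using triangle_reflect[OF assms(2)] by (simp add: mult.commute[of r] flip: power_add power_mult)
  have "(q\<^sup>2) ^ triangle r * (?Y' * ?X') = (?X * ?X') * (?X * ?Y')"
    by (simp only: power2_eq_square power_mult_distrib mult_ac)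
  also have "\<dots> = (?Z * ?Z') * (?X * ?Y')"
    by (simp only: XX')
  also have "\<dots> = (?X * ?Z) * ?Y' * ?Z'"
    by (simp only: mult_ac)
  also have "\<dots> = (?Y * ?Y') * (?Z' * (q ^ m) ^ r)"
    unfolding XZ by (simp only: mult_ac)
  finally show ?thesis
    by (simp only: XX' mult_1_left)
qed

text \<open>The factor of index \<open>k\<close> is the quantum integer [k] times q^(k-1); the
  exponents add up to \<open>triangle n\<close>.\<close>

lemma angle_factorial:
  assumes "generic q" "generic (q\<^sup>2)"
  shows "(\<Prod>k = 1..n. (1 - (q\<^sup>2) ^ k) * uinv (1 - q\<^sup>2)) = q ^ triangle n * qfact q n"
proof (induction n)
  case (Suc n)
  have u: "1 - q\<^sup>2 dvd 1"
    using assms(2) generic_power_unit[of "q\<^sup>2" 1] by simp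
  have geom: "(1 - q\<^sup>2) * (\<Sum>k<Suc n. (q\<^sup>2) ^ k) = 1 - (q\<^sup>2) ^ Suc n"
    by (metis one_diff_power_eq)
  have "q * ((1 - (q\<^sup>2) ^ Suc n) * uinv (1 - q\<^sup>2)) = q * (\<Sum>k<Suc n. (q\<^sup>2) ^ k)"
    unfolding geom[symmetric] using u by (simp add: mult_ac)
  also have "\<dots> = q * (q ^ n * qint q (Suc n))"
    by (simp only: qint_geometric[OF assms(1)] power_Suc mult.assoc)
  finally have "(1 - (q\<^sup>2) ^ Suc n) * uinv (1 - q\<^sup>2) = q ^ n * qint q (Suc n)"
    using assms(1) by (simp only: unit_cancel generic_unit)
  then show ?case
    using Suc by (simp add: triangle_Suc qfact_Suc power_add mult_ac)
qed simp

lemma upow_minus_nat: "x dvd 1 \<Longrightarrow> upow x (- int r) = uinv x ^ r"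
  by (cases "r = 0") (simp_all add: upow_def)

context quantum_datum
begin

lemma angpow_eq:
  "angpow D i x n = (uinv (p1 D i) ^ triangle n * uinv (qfact (p1 D i) n)) \<cdot> x ^ n"
  using generic_tp[of i] unfolding angpow_def tp_eq
  by (simp add: angle_factorial[unfolded One_nat_def] uinv_mult uinv_power)

lemma serre_angpow:
  assumes "\<And>r. r \<le> N \<Longrightarrow>
    c r * (uinv (p1 D i) ^ triangle (N - r) * uinv (p1 D i) ^ triangle r) = C * y ^ r"
  shows "(\<Sum>r\<le>N. c r \<cdot> (angpow D i e (N - r) * d * angpow D i e r))
    = (C * uinv (qfact (p1 D i) N)) \<cdot> free.serre y (p1 D i) N e d"
proof -
  let ?f = "\<lambda>n. uinv (qfact (p1 D i) n)"
  have "c r \<cdot> (angpow D i e (N - r) * d * angpow D i e r)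
      = C \<cdot> (y ^ r \<cdot> ((?f (N - r) \<cdot> e ^ (N - r)) * d * (?f r \<cdot> e ^ r)))" if "r \<le> N" for r
  proof -
    have "c r \<cdot> (angpow D i e (N - r) * d * angpow D i e r)
      = (c r * (uinv (p1 D i) ^ triangle (N - r) * uinv (p1 D i) ^ triangle r) * (?f (N - r) * ?f r))
        \<cdot> (e ^ (N - r) * d * e ^ r)"
      unfolding angpow_eq by (simp add: mult_ac)
    then show ?thesis
      unfolding assms[OF that] by (simp add: mult_ac)
  qed
  then have "(\<Sum>r\<le>N. c r \<cdot> (angpow D i e (N - r) * d * angpow D i e r))
    = C \<cdot> (\<Sum>r\<le>N. y ^ r \<cdot> ((?f (N - r) \<cdot> e ^ (N - r)) * d * (?f r \<cdot> e ^ r)))"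
    unfolding free.sc_sum_right by (intro sum.cong refl) simp
  then show ?thesis
    by (simp only: serre_divided_powers generic_p1 free.sc_sc)
qed

lemma U_F_serre:
  assumes "i \<noteq> j"
  shows "(\<Sum>r\<le>serre_len D i j. (- cc D i j * uinv (theta D j i)) ^ r
         \<cdot> (divpow D i (f i) (serre_len D i j - r) * f j * divpow D i (f i) r))
    = uinv (qfact (p1 D i) (serre_len D i j)) \<cdot> boson_serre D f i j"
proof -
  have "- cc D i j * uinv (theta D j i) = serre_coeff i j"
    using serre_coeff_eqs(17)[OF assms] by simp
  then show ?thesis
    unfolding divpow_def boson_serre_eq by (simp only: serre_divided_powers generic_p1)
qed

lemma U_E_serre:
  "(\<Sum>r\<le>serre_len D i j. (- cc D i j * theta D i j) ^ r
         \<cdot> (divpow D i (e i) (serre_len D i j - r) * e j * divpow D i (e i) r))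
    = uinv (qfact (p1 D i) (serre_len D i j))
       \<cdot> free.serre (- cc D i j * theta D i j) (p1 D i) (serre_len D i j) (e i) (e j)"
  unfolding divpow_def by (simp only: serre_divided_powers generic_p1)

text \<open>The scalar must be a unit: the relation then generates the same ideal as the Serre
  element, which the computation of the kernel needs in both directions.\<close>

lemma cU_F_serre:
  assumes "i \<noteq> j"
  shows "\<exists>C. C dvd 1 \<and>
    (\<Sum>r\<le>serre_len D i j. (upow (- ttheta D j i) (- int r) * tp D i ^ (r * (r - 1) div 2))
         \<cdot> (angpow D i (f i) (serre_len D i j - r) * f j * angpow D i (f i) r))
    = C \<cdot> boson_serre D f i j"
proof -
  define m where "m = nat (- cartan D i j)"
  have N: "serre_len D i j = Suc m"
    using assms by (simp add: serre_len_eq m_def)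
  let ?u = "uinv (p1 D i)"
  have y: "uinv (- ttheta D j i) * p1 D i ^ m = serre_coeff i j"
    using serre_coeff_eqs(2)[OF assms] by (simp add: uinv_uminus m_def)
  have "upow (- ttheta D j i) (- int r) * tp D i ^ (r * (r - 1) div 2)
      * (?u ^ triangle (Suc m - r) * ?u ^ triangle r) = ?u ^ triangle (Suc m) * serre_coeff i j ^ r"
    if "r \<le> Suc m" for r
    unfolding y[symmetric] power_mult_distrib
    using triangle_power_reflect[of "p1 D i" r m] that
    by (simp only: upow_minus_nat minus_dvd_iff units mult.assoc tp_eq flip: triangle_def)
      (simp only: mult.left_commute)
  then show ?thesis
    unfolding boson_serre_eq N
    by (intro exI[of _ "?u ^ triangle (Suc m) * uinv (qfact (p1 D i) (Suc m))"] conjI serre_angpow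
        unit_mult unit_power uinv_unit units qfact_unit generic_p1)
qed

text \<open>This relation lists the powers of \<open>e i\<close> in the opposite order, so the sum
  is read backwards. The base \<open>z\<close> of its coefficients is inverse to
  \<open>serre_coeff i j\<close>; hence the power \<open>Suc m - r\<close> of \<open>z\<close> is a
  constant times the power \<open>r\<close> of \<open>serre_coeff i j\<close>.\<close>

lemma cU_E_serre:
  assumes "i \<noteq> j"
  shows "\<exists>C. (\<Sum>r\<le>serre_len D i j. (upow (- ttheta D i j) (- int r) * tp D i ^ (r * (r - 1) div 2))
         \<cdot> (angpow D i (e i) r * e j * angpow D i (e i) (serre_len D i j - r)))
    = C \<cdot> free.serre (serre_coeff i j) (p1 D i) (serre_len D i j) (e i) (e j)"
proof -
  define m where "m = nat (- cartan D i j)"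
  have N: "serre_len D i j = Suc m"
    using assms by (simp add: serre_len_eq m_def)
  let ?u = "uinv (p1 D i)"
  define z where "z = uinv (- ttheta D i j) * p1 D i ^ m"
  define c where "c r = upow (- ttheta D i j) (- int r) * tp D i ^ (r * (r - 1) div 2)" for r
  have "z * - (ttheta D i j * ?u ^ m) = (uinv (ttheta D i j) * ttheta D i j) * (p1 D i ^ m * ?u ^ m)"
    unfolding z_def by (simp add: uinv_uminus mult_ac)
  then have "z * serre_coeff i j = (uinv (ttheta D i j) * ttheta D i j) * (p1 D i ^ m * ?u ^ m)"
    using serre_coeff_eqs(1)[OF assms] by (simp only: m_def)
  then have z: "z * serre_coeff i j = 1"
    by (simp add: power_uinv_cancel)
  have "c (Suc m - r) * (?u ^ triangle (Suc m - r) * ?u ^ triangle r)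
      = ?u ^ triangle (Suc m) * z ^ Suc m * serre_coeff i j ^ r"
    if "r \<le> Suc m" for r
  proof -
    have "Suc m - (Suc m - r) = r"
      using that by simp
    then have "c (Suc m - r) * (?u ^ triangle (Suc m - r) * ?u ^ triangle r) = ?u ^ triangle (Suc m)
        * z ^ (Suc m - r)"
      unfolding z_def c_def power_mult_distrib
      using triangle_power_reflect[of "p1 D i" "Suc m - r" m]
      by (simp only: upow_minus_nat minus_dvd_iff units mult.assoc tp_eq diff_le_self
          mult.commute[of "?u ^ triangle r"]
          flip: triangle_def) (simp only: mult.left_commute)
    also have "z ^ (Suc m - r) = z ^ (Suc m - r) * (z * serre_coeff i j) ^ r"
      by (simp only: z power_one mult_1_right)
    also have "\<dots> = z ^ Suc m * serre_coeff i j ^ r"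
    proof -
      have "z ^ Suc m = z ^ (Suc m - r) * z ^ r"
        using that by (simp only: le_add_diff_inverse2 flip: power_add)
      then show ?thesis
        by (simp only: power_mult_distrib mult.assoc)
    qed
    finally show ?thesis by (simp only: mult.assoc)
  qed
  then have "(\<Sum>r\<le>Suc m. c (Suc m - r) \<cdot> (angpow D i (e i) (Suc m - r) * e j * angpow D i (e i) r))
     = (?u ^ triangle (Suc m) * z ^ Suc m * uinv (qfact (p1 D i) (Suc m)))
       \<cdot> free.serre (serre_coeff i j) (p1 D i) (Suc m) (e i) (e j)"
    by (rule serre_angpow)
  moreover have "(\<Sum>r\<le>Suc m. c r \<cdot> (angpow D i (e i) r * e j * angpow D i (e i) (Suc m - r)))
     = (\<Sum>r\<le>Suc m. c (Suc m - r) \<cdot> (angpow D i (e i) (Suc m - r) * e j * angpow D i (e i) r))"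
    by (rule sum.reindex_bij_witness[of _ "\<lambda>r. Suc m - r" "\<lambda>r. Suc m - r"]) auto
  ultimately show ?thesis
    unfolding N c_def[symmetric] by metis
qed

end

section \<open>Verma-type representations on the free algebra\<close>

lemma (in ring_algebra) lift_lift: "lift h (free.lift g x) = lift (\<lambda>j. lift h (g j)) x"
  by (induction x rule: free_induct) simp_all

lemma divpow_lift: "free.lift h (divpow D i x n) = divpow D i (free.lift h x) n"
  by (simp add: divpow_def)

lemma U_rels_intros:
  "x (K i) * x (KI i) - 1 \<in> U_rels D x"
  "x (KI i) * x (K i) - 1 \<in> U_rels D x"
  "x (K i) * x (K j) - x (K j) * x (K i) \<in> U_rels D x"
  "x (K i) * x (E j) * x (KI i) - p2 D i j \<cdot> x (E j) \<in> U_rels D x"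
  "x (K i) * x (F j) * x (KI i) - uinv (p2 D i j) \<cdot> x (F j) \<in> U_rels D x"
  "x (E i) * x (F j) - theta D j i \<cdot> (x (F j) * x (E i))
     - (if i = j then uinv (p1 D i - uinv (p1 D i)) \<cdot> (x (K i) - x (KI i)) else 0) \<in> U_rels D x"
  "i \<noteq> j \<Longrightarrow> (\<Sum>r\<le>serre_len D i j. (- cc D i j * uinv (theta D j i)) ^ r
     \<cdot> (divpow D i (x (F i)) (serre_len D i j - r) * x (F j) * divpow D i (x (F i)) r)) \<in> U_rels D x"
  "i \<noteq> j \<Longrightarrow> (\<Sum>r\<le>serre_len D i j. (- cc D i j * theta D i j) ^ r
     \<cdot> (divpow D i (x (E i)) (serre_len D i j - r) * x (E j) * divpow D i (x (E i)) r)) \<in> U_rels D x"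
  unfolding U_rels_def Let_def o_apply by blast+

lemma U_rels_cases [consumes 1, case_names KKI KIK KK KE KF EF FS ES]:
  assumes "r \<in> U_rels D x"
  obtains i where "r = x (K i) * x (KI i) - 1"
  | i where "r = x (KI i) * x (K i) - 1"
  | i j where "r = x (K i) * x (K j) - x (K j) * x (K i)"
  | i j where "r = x (K i) * x (E j) * x (KI i) - p2 D i j \<cdot> x (E j)"
  | i j where "r = x (K i) * x (F j) * x (KI i) - uinv (p2 D i j) \<cdot> x (F j)"
  | i j where "r = x (E i) * x (F j) - theta D j i \<cdot> (x (F j) * x (E i))
     - (if i = j then uinv (p1 D i - uinv (p1 D i)) \<cdot> (x (K i) - x (KI i)) else 0)"
  | i j where "i \<noteq> j" "r = (\<Sum>r\<le>serre_len D i j. (- cc D i j * uinv (theta D j i)) ^ r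
     \<cdot> (divpow D i (x (F i)) (serre_len D i j - r) * x (F j) * divpow D i (x (F i)) r))"
  | i j where "i \<noteq> j" "r = (\<Sum>r\<le>serre_len D i j. (- cc D i j * theta D i j) ^ r
     \<cdot> (divpow D i (x (E i)) (serre_len D i j - r) * x (E j) * divpow D i (x (E i)) r))"
  using assms unfolding U_rels_def Let_def o_apply by blast

lemma U_rels_lift:
  assumes "r \<in> U_rels D x"
  shows "free.lift h r \<in> U_rels D (\<lambda>g. free.lift h (x g))"
  using assms
proof (cases rule: U_rels_cases)
  case (EF i j)
  show ?thesis
    using U_rels_intros(6)[of "\<lambda>g. free.lift h (x g)" i j D] unfolding EF by (simp split: if_splits)
next
  case (FS i j)
  show ?thesis
    using U_rels_intros(7)[of i j D "\<lambda>g. free.lift h (x g)"] unfolding FS(2) by (simp add: FS(1)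
        divpow_lift)
next
  case (ES i j)
  show ?thesis
    using U_rels_intros(8)[of i j D "\<lambda>g. free.lift h (x g)"] unfolding ES(2) by (simp add: ES(1)
        divpow_lift)
qed (use U_rels_intros[where x = "\<lambda>g. free.lift h (x g)" and D = D] in auto)

lemma cU_rels_cases [consumes 1, case_names KKI KIK KK KE KF EF FS ES]:
  assumes "r \<in> cU_rels D"
  obtains i where "r = var (K i) * var (KI i) - 1"
  | i where "r = var (KI i) * var (K i) - 1"
  | i j where "r = var (K i) * var (K j) - var (K j) * var (K i)"
  | i j where "r = var (K i) * var (E j) * var (KI i) - upow (tp D i) (cartan D i j) \<cdot> var (E j)"
  | i j where "r = var (K i) * var (F j) * var (KI i) - upow (tp D i) (- cartan D i j) \<cdot> var (F j)"
  | i j where "r = var (E i) * var (F j) - ttheta D j i \<cdot> (var (F j) * var (E i))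
     - (if i = j then uinv (1 - tp D i) \<cdot> (1 - var (K i)) else 0)"
  | i j where "i \<noteq> j" "r = (\<Sum>r\<le>serre_len D i j.
      (upow (- ttheta D j i) (- int r) * tp D i ^ (r * (r - 1) div 2))
       \<cdot> (angpow D i (var (F i)) (serre_len D i j - r) * var (F j) * angpow D i (var (F i)) r))"
  | i j where "i \<noteq> j" "r = (\<Sum>r\<le>serre_len D i j.
      (upow (- ttheta D i j) (- int r) * tp D i ^ (r * (r - 1) div 2))
       \<cdot> (angpow D i (var (E i)) r * var (E j) * angpow D i (var (E i)) (serre_len D i j - r)))"
  using assms unfolding cU_rels_def Let_def o_apply by blast

lemma cU_rels_FS:
  "i \<noteq> j \<Longrightarrow> (\<Sum>r\<le>serre_len D i j.
      (upow (- ttheta D j i) (- int r) * tp D i ^ (r * (r - 1) div 2))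
       \<cdot> (angpow D i (var (F i)) (serre_len D i j - r) * var (F j) * angpow D i (var (F i)) r)) \<in>
           cU_rels D"
  unfolding cU_rels_def Let_def o_apply by blast

lemma UT_rels_intros:
  "r \<in> U_rels D (\<lambda>g. var (Base g)) \<Longrightarrow> r \<in> UT_rels D"
  "var (T i) * var (TI i) - 1 \<in> UT_rels D"
  "var (TI i) * var (T i) - 1 \<in> UT_rels D"
  "var (T i) * var (Base (F j)) * var (TI i) - uinv (theta D j i) \<cdot> var (Base (F j)) \<in> UT_rels D"
  unfolding UT_rels_def Let_def o_def by blast+

lemma UT_rels_cases [consumes 1, case_names U TTI TIT TT TE TF TK]:
  assumes "r \<in> UT_rels D"
  obtains "r \<in> U_rels D (\<lambda>g. var (Base g))"
  | i where "r = var (T i) * var (TI i) - 1"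
  | i where "r = var (TI i) * var (T i) - 1"
  | i j where "r = var (T i) * var (T j) - var (T j) * var (T i)"
  | i j where "r = var (T i) * var (Base (E j)) * var (TI i) - theta D j i \<cdot> var (Base (E j))"
  | i j where "r = var (T i) * var (Base (F j)) * var (TI i) - uinv (theta D j i) \<cdot> var (Base (F j))"
  | i j where "r = var (T i) * var (Base (K j)) * var (TI i) - var (Base (K j))"
  using assms unfolding UT_rels_def Let_def o_def by blast

lemma dg_inv_mult: "(\<And>k. \<chi> k * \<chi>' k = 1) \<Longrightarrow> dg \<chi> * dg \<chi>' = 1"
  by (simp add: dg_mult)

lemma dg_conj_F:
  "(\<And>k. \<chi> k * \<chi>' k = 1) \<Longrightarrow> dg \<chi> * lmult (var j) * dg \<chi>' = escale (\<chi> j) (lmult (var j))"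
  by (simp add: dg_lmult_var mult.assoc dg_inv_mult)

lemma (in skew_system) dg_conj_E:
  "(\<And>k. \<chi> k * \<chi>' k = 1) \<Longrightarrow> dg \<chi> * E_op j * dg \<chi>' = escale (\<chi>' j) (E_op j)"
  by (simp add: E_dg mult.assoc) (simp add: dg_inv_mult flip: mult.assoc)

section \<open>Kernels of the maps from the free algebra\<close>

context quantum_datum
begin

text \<open>The coefficients 1 and 0 make \<open>H i\<close> the identity, so that
  \<open>E_op\<close> satisfies the commutation rule of the boson algebra.\<close>

sublocale boson: skew_system D "\<lambda>i j. ttheta D j i" "\<lambda>i j. 1" "\<lambda>i j. 1" "\<lambda>i. 1" "\<lambda>i. 0" serre_coeff
  by (rule skew_system_boson)

lemma boson_serre_mult_mem: "i \<noteq> j \<Longrightarrow> boson_serre D var i j * x \<in> serre_ideal"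
  unfolding serre_ideal_def by (intro idl_mult_right idl_base) blast

lemma serre_ideal_ops:
  "0 \<in> serre_ideal" "x \<in> serre_ideal \<Longrightarrow> y \<in> serre_ideal \<Longrightarrow> x + y \<in> serre_ideal" "x \<in> serre_ideal \<Longrightarrow> y \<in>
      serre_ideal \<Longrightarrow> x - y \<in> serre_ideal"
  "x \<in> serre_ideal \<Longrightarrow> c \<cdot> x \<in> serre_ideal" "x \<in> serre_ideal \<Longrightarrow> y * x \<in> serre_ideal"
  unfolding serre_ideal_def by (simp_all add: idl_add idl_diff idl_scale idl_mult_left)

lemma lift_serre_ideal:
  assumes "\<And>g x. x \<in> serre_ideal \<Longrightarrow> app (\<rho> g) x \<in> serre_ideal" "x \<in> serre_ideal"
  shows "app (endo.lift \<rho> X) x \<in> serre_ideal"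
  using assms(2) by (induction X arbitrary: x rule: free_induct) (simp_all add: assms(1) serre_ideal_ops)

text \<open>This expresses an action on \<open>A / S\<close> without forming the quotient:
  generators preserve \<open>serre_ideal\<close>, and relators send everything into it.\<close>

lemma lift_idl_serre_ideal:
  assumes "\<And>g x. x \<in> serre_ideal \<Longrightarrow> app (\<rho> g) x \<in> serre_ideal" "\<And>r x. r \<in> R \<Longrightarrow> app (endo.lift \<rho> r) x \<in>
      serre_ideal"
    and "X \<in> idl R"
  shows "app (endo.lift \<rho> X) x \<in> serre_ideal"
  using assms(3) by (induction X arbitrary: x rule: idl.induct) (simp_all add: assms(1,2)
      lift_serre_ideal serre_ideal_ops)

lemma cU_kernel:
  fixes X :: "('i, 'k) free"
  assumes "free.lift (\<lambda>j. var (F j)) X \<in> idl (cU_rels D)"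
  shows "X \<in> serre_ideal"
proof -
  let ?u = "\<lambda>i. uinv (1 - tp D i)"
  interpret C: skew_system D "\<lambda>i j. ttheta D j i" "\<lambda>i j. 1" "\<lambda>i j. uinv ((p2 D i j)\<^sup>2)"
    ?u "\<lambda>i. - ?u i" serre_coeff
    by (rule skew_system_cU)
  \<comment> \<open>The Verma module on whose highest weight vector 1 every \<open>K i\<close> acts
    as the identity; the coefficients of \<open>C.H\<close> are those of (1 - K_i) / (1 -
    tp_i).\<close>
  define \<rho> :: "'i ugen \<Rightarrow> ('i, 'k) endo" where
    "\<rho> g = (case g of E i \<Rightarrow> C.E_op i | F i \<Rightarrow> lmult (var i)
       | K i \<Rightarrow> dg (\<lambda>j. uinv ((p2 D i j)\<^sup>2)) | KI i \<Rightarrow> dg (\<lambda>j. (p2 D i j)\<^sup>2))" for g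
  have \<rho> [simp]: "\<rho> (E i) = C.E_op i" "\<rho> (F i) = lmult (var i)"
    "\<rho> (K i) = dg (\<lambda>j. uinv ((p2 D i j)\<^sup>2))" "\<rho> (KI i) = dg (\<lambda>j. (p2 D i j)\<^sup>2)" for i
    by (simp_all add: \<rho>_def)
  have J: "app (\<rho> g) x \<in> serre_ideal" if "x \<in> serre_ideal" for g x
    using that by (cases g) (simp_all add: C.E_op_serre_ideal C.dg_serre_ideal serre_ideal_ops)
  have rels: "app (endo.lift \<rho> r) x \<in> serre_ideal" if "r \<in> cU_rels D" for r x
    using that
  proof (cases rule: cU_rels_cases)
    case (KKI i)
    have "endo.lift \<rho> r = 0"
      unfolding KKI by (simp add: dg_inv_mult)
    then show ?thesis by (simp add: serre_ideal_ops)
  next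
    case (KIK i)
    have "endo.lift \<rho> r = 0"
      unfolding KIK by (simp add: dg_inv_mult)
    then show ?thesis by (simp add: serre_ideal_ops)
  next
    case (KK i j)
    have "endo.lift \<rho> r = 0"
      unfolding KK by (simp add: dg_commute)
    then show ?thesis by (simp add: serre_ideal_ops)
  next
    case (KE i j)
    have "endo.lift \<rho> r = 0"
      unfolding KE by (simp add: C.dg_conj_E upow_tp)
    then show ?thesis by (simp add: serre_ideal_ops)
  next
    case (KF i j)
    have "endo.lift \<rho> r = 0"
      unfolding KF by (simp add: dg_conj_F upow_tp_minus)
    then show ?thesis by (simp add: serre_ideal_ops)
  next
    case (EF i j)
    have "endo.lift \<rho> r = 0"
      unfolding EF by (simp add: C.EF C.H_def endo.sc_diff_right endo.sc_minus_left)
    then show ?thesis by (simp add: serre_ideal_ops)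
  next
    \<comment> \<open>Unlike the other relators this one need not act as 0 on the free algebra: it
      is left multiplication by an element of \<open>serre_ideal\<close>.\<close>
    case (FS i j)
    obtain C where "r = C \<cdot> boson_serre D (\<lambda>j. var (F j)) i j"
      using cU_F_serre[OF FS(1), of "\<lambda>j. var (F j)"] unfolding FS(2)[symmetric] by blast
    then have "r = free.lift (\<lambda>j. var (F j)) (C \<cdot> boson_serre D var i j)"
      by (simp add: boson_serre_lift o_def)
    then have "endo.lift \<rho> r = lmult (C \<cdot> boson_serre D var i j)"
      by (simp only: endo.lift_lift endo.lift_var \<rho> lift_lmult lift_var_id)
    then show ?thesis by (simp add: serre_ideal_ops boson_serre_mult_mem[OF FS(1)])
  next
    case (ES i j)
    obtain C where "r = C \<cdot> free.serre (serre_coeff i j) (p1 D i) (serre_len D i j) (var (E i)) (var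
        (E j))"
      using cU_E_serre[OF ES(1), of "\<lambda>j. var (E j)"] unfolding ES(2)[symmetric] by blast
    then have "endo.lift \<rho> r = 0"
      using C.E_serre[OF ES(1)] by simp
    then show ?thesis by (simp add: serre_ideal_ops)
  qed
  have "app (endo.lift \<rho> (free.lift (\<lambda>j. var (F j)) X)) 1 \<in> serre_ideal"
    by (rule lift_idl_serre_ideal[OF J rels assms])
  then show "X \<in> serre_ideal"
    by (simp only: endo.lift_lift endo.lift_var \<rho> lift_lmult lift_var_id app_lmult mult_1_right)
qed

lemma cU_kernel_iff: "free.lift (\<lambda>j. var (F j)) X \<in> idl (cU_rels D) \<longleftrightarrow> X \<in> serre_ideal"
proof
  assume "X \<in> serre_ideal"
  then show "free.lift (\<lambda>j. var (F j)) X \<in> idl (cU_rels D)"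
    unfolding serre_ideal_def
  proof (rule lift_idl)
    fix r :: "('i, 'k) free" assume "r \<in> {boson_serre D var i j |i j. i \<noteq> j}"
    then obtain i j where r: "r = boson_serre D var i j" "i \<noteq> j" by blast
    obtain C where C: "C dvd 1" "C \<cdot> boson_serre D (\<lambda>j. var (F j)) i j \<in> cU_rels D"
      using cU_F_serre[OF r(2), of "\<lambda>j. var (F j)"] cU_rels_FS[OF r(2), of D] by auto
    then have "uinv C \<cdot> C \<cdot> boson_serre D (\<lambda>j. var (F j)) i j \<in> idl (cU_rels D)"
      by (intro idl_scale idl_base)
    with C(1) show "free.lift (\<lambda>j. var (F j)) r \<in> idl (cU_rels D)"
      by (simp add: r(1) boson_serre_lift o_def)
  qed
qed (rule cU_kernel)

text \<open>The scalar \<open>z\<close> is the eigenvalue of every \<open>K i\<close> on the highest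
  weight vector 1, while every \<open>T i\<close> fixes 1. The action of the \<open>E i\<close>
  depends on \<open>z\<close> too, but stays hidden because the elements to be evaluated contain
  only \<open>F\<close>, \<open>K\<close>, \<open>T\<close> and inverses.\<close>

lemma UT_rep:
  assumes z [simp]: "z dvd 1"
  obtains \<rho> :: "'i tgen \<Rightarrow> ('i, 'k) endo" where
    "\<And>i. \<rho> (Base (F i)) = lmult (var i)"
    "\<And>i. \<rho> (Base (K i)) = escale z (dg (\<lambda>j. uinv (p2 D i j)))"
    "\<And>i. \<rho> (Base (KI i)) = escale (uinv z) (dg (p2 D i))"
    "\<And>i. \<rho> (T i) = dg (\<lambda>j. uinv (theta D j i))"
    "\<And>i. \<rho> (TI i) = dg (\<lambda>j. theta D j i)"
    "\<And>X x. X \<in> idl (UT_rels D) \<Longrightarrow> app (endo.lift \<rho> X) x \<in> serre_ideal"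
proof -
  let ?u = "\<lambda>i. uinv (p1 D i - uinv (p1 D i))"
  interpret V: skew_system D "\<lambda>i j. theta D j i" "\<lambda>i j. uinv (p2 D i j)" "p2 D"
    "\<lambda>i. ?u i * z" "\<lambda>i. - (?u i * uinv z)" "\<lambda>i j. - cc D i j * theta D i j"
    by (rule skew_system_U)
  define \<rho> :: "'i tgen \<Rightarrow> ('i, 'k) endo" where
    "\<rho> g = (case g of
        Base b \<Rightarrow> (case b of E i \<Rightarrow> V.E_op i | F i \<Rightarrow> lmult (var i)
         | K i \<Rightarrow> escale z (dg (\<lambda>j. uinv (p2 D i j))) | KI i \<Rightarrow> escale (uinv z) (dg (p2 D i)))
       | T i \<Rightarrow> dg (\<lambda>j. uinv (theta D j i)) | TI i \<Rightarrow> dg (\<lambda>j. theta D j i))" for g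
  have \<rho>: "\<rho> (Base (E i)) = V.E_op i" "\<rho> (Base (F i)) = lmult (var i)"
    "\<rho> (Base (K i)) = escale z (dg (\<lambda>j. uinv (p2 D i j)))"
    "\<rho> (Base (KI i)) = escale (uinv z) (dg (p2 D i))"
    "\<rho> (T i) = dg (\<lambda>j. uinv (theta D j i))" "\<rho> (TI i) = dg (\<lambda>j. theta D j i)" for i
    by (simp_all add: \<rho>_def)
  have J: "app (\<rho> g) x \<in> serre_ideal" if "x \<in> serre_ideal" for g x
  proof (cases g)
    case (Base b)
    then show ?thesis
      using that by (cases b) (simp_all add: \<rho> V.E_op_serre_ideal V.dg_serre_ideal serre_ideal_ops)
  qed (use that in \<open>simp_all add: \<rho> V.dg_serre_ideal\<close>)
  have rels: "app (endo.lift \<rho> r) x \<in> serre_ideal" if "r \<in> UT_rels D" for r x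
    using that
  proof (cases rule: UT_rels_cases)
    case U
    then show ?thesis
    proof (cases rule: U_rels_cases)
      case (KKI i)
      have "endo.lift \<rho> r = 0"
        unfolding KKI by (simp add: \<rho> dg_inv_mult)
      then show ?thesis by (simp add: serre_ideal_ops)
    next
      case (KIK i)
      have "endo.lift \<rho> r = 0"
        unfolding KIK by (simp add: \<rho> dg_inv_mult)
      then show ?thesis by (simp add: serre_ideal_ops)
    next
      case (KK i j)
      have "endo.lift \<rho> r = 0"
        unfolding KK by (simp add: \<rho> dg_commute)
      then show ?thesis by (simp add: serre_ideal_ops)
    next
      case (KE i j)
      have "endo.lift \<rho> r = 0"
        unfolding KE by (simp add: \<rho> V.dg_conj_E)
      then show ?thesis by (simp add: serre_ideal_ops)
    next
      case (KF i j)
      have "endo.lift \<rho> r = 0"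
        unfolding KF by (simp add: \<rho> dg_conj_F)
      then show ?thesis by (simp add: serre_ideal_ops)
    next
      case (EF i j)
      have "endo.lift \<rho> r = 0"
        unfolding EF by (simp add: \<rho> V.EF V.H_def endo.sc_diff_right endo.sc_minus_left)
      then show ?thesis by (simp add: serre_ideal_ops)
    next
      case (FS i j)
      obtain C where "r = C \<cdot> boson_serre D (\<lambda>j. var (Base (F j))) i j"
        using U_F_serre[OF FS(1), of "\<lambda>j. var (Base (F j))"] FS(2) by blast
      then have "r = free.lift (\<lambda>j. var (Base (F j))) (C \<cdot> boson_serre D var i j)"
        by (simp add: boson_serre_lift o_def)
      then have "endo.lift \<rho> r = lmult (C \<cdot> boson_serre D var i j)"
        by (simp only: endo.lift_lift endo.lift_var \<rho> lift_lmult lift_var_id)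
      then show ?thesis by (simp add: serre_ideal_ops boson_serre_mult_mem[OF FS(1)])
    next
      case (ES i j)
      then have "r = uinv (qfact (p1 D i) (serre_len D i j)) \<cdot>
          free.serre (- cc D i j * theta D i j) (p1 D i) (serre_len D i j) (var (Base (E i))) (var
              (Base (E j)))"
        using U_E_serre[of i j "\<lambda>j. var (Base (E j))"] by simp
      then have "endo.lift \<rho> r = 0"
        using V.E_serre[OF ES(1)] by (simp add: \<rho>)
      then show ?thesis by (simp add: serre_ideal_ops)
    qed
  next
    case (TTI i)
    have "endo.lift \<rho> r = 0"
      unfolding TTI by (simp add: \<rho> dg_inv_mult)
    then show ?thesis by (simp add: serre_ideal_ops)
  next
    case (TIT i)
    have "endo.lift \<rho> r = 0"
      unfolding TIT by (simp add: \<rho> dg_inv_mult)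
    then show ?thesis by (simp add: serre_ideal_ops)
  next
    case (TT i j)
    have "endo.lift \<rho> r = 0"
      unfolding TT by (simp add: \<rho> dg_commute)
    then show ?thesis by (simp add: serre_ideal_ops)
  next
    case (TE i j)
    have "endo.lift \<rho> r = 0"
      unfolding TE by (simp add: \<rho> V.dg_conj_E)
    then show ?thesis by (simp add: serre_ideal_ops)
  next
    case (TF i j)
    have "endo.lift \<rho> r = 0"
      unfolding TF by (simp add: \<rho> dg_conj_F)
    then show ?thesis by (simp add: serre_ideal_ops)
  next
    case (TK i j)
    \<comment> \<open>Diagonal automorphisms commute, so conjugation by one does not affect
      another.\<close>
    have "dg (\<lambda>j. uinv (theta D j i)) * dg (\<lambda>k. uinv (p2 D j k)) * dg (\<lambda>j. theta D j i)
      = dg (\<lambda>k. uinv (p2 D j k))"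
      by (simp add: dg_mult mult.assoc mult.left_commute[of "uinv (theta D _ i)"])
    then have "endo.lift \<rho> r = 0"
      unfolding TK by (simp add: \<rho>)
    then show ?thesis by (simp add: serre_ideal_ops)
  qed
  show thesis
    by (rule that[of \<rho>]) (fact \<rho> | rule lift_idl_serre_ideal[OF J rels])+
qed

abbreviation \<psi>T :: "('i, 'k) free \<Rightarrow> ('i tgen, 'k) free" where
  "\<psi>T \<equiv> free.lift (\<lambda>j. var (Base (F j)))"

lemma UT_kernel:
  assumes "\<psi>T X \<in> idl (UT_rels D)"
  shows "X \<in> serre_ideal"
proof -
  obtain \<rho> where \<rho>: "\<And>i. \<rho> (Base (F i)) = lmult (var i)"
    and J: "\<And>X x. X \<in> idl (UT_rels D) \<Longrightarrow> app (endo.lift \<rho> X) x \<in> serre_ideal"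
    using UT_rep[of 1] by (metis dvd_refl)
  have "app (endo.lift \<rho> (\<psi>T X)) 1 \<in> serre_ideal"
    by (rule J[OF assms])
  then show ?thesis
    by (simp only: endo.lift_lift endo.lift_var \<rho> lift_lmult lift_var_id app_lmult mult_1_right)
qed

text \<open>One inclusion passes through the extended algebra: relators of \<open>U\<close> become
  relators there, so its Verma module detects elements of \<open>U\<close> as well. For the other
  one, \<open>serre_ideal\<close> is generated by unit multiples of relators.\<close>

lemma U_kernel_iff: "free.lift (\<lambda>j. var (F j)) X \<in> idl (U_rels D var) \<longleftrightarrow> X \<in> serre_ideal"
proof
  assume "free.lift (\<lambda>j. var (F j)) X \<in> idl (U_rels D var)"
  then have "free.lift (\<lambda>g. var (Base g)) (free.lift (\<lambda>j. var (F j)) X) \<in> idl (UT_rels D)"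
  proof (rule lift_idl)
    fix r :: "('i ugen, 'k) free" assume "r \<in> U_rels D var"
    then have "free.lift (\<lambda>g. var (Base g)) r \<in> U_rels D (\<lambda>g. free.lift (\<lambda>g. var (Base g)) (var g))"
      by (rule U_rels_lift)
    then show "free.lift (\<lambda>g. var (Base g)) r \<in> idl (UT_rels D)"
      by (intro idl_base UT_rels_intros(1)) simp
  qed
  then show "X \<in> serre_ideal"
    by (intro UT_kernel) (simp add: free.lift_lift)
next
  assume "X \<in> serre_ideal"
  then show "free.lift (\<lambda>j. var (F j)) X \<in> idl (U_rels D var)"
    unfolding serre_ideal_def
  proof (rule lift_idl)
    fix r :: "('i, 'k) free" assume "r \<in> {boson_serre D var i j |i j. i \<noteq> j}"
    then obtain i j where r: "r = boson_serre D var i j" "i \<noteq> j" by blast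
    define C where "C = qfact (p1 D i) (serre_len D i j)"
    have "uinv C \<cdot> boson_serre D (\<lambda>j. var (F j)) i j \<in> U_rels D var"
      using U_F_serre[OF r(2), of "\<lambda>j. var (F j)"] U_rels_intros(7)[OF r(2), of D var] by (simp add:
          C_def)
    then have "C \<cdot> uinv C \<cdot> boson_serre D (\<lambda>j. var (F j)) i j \<in> idl (U_rels D var)"
      by (intro idl_scale idl_base)
    moreover have "C dvd 1" by (simp add: C_def)
    ultimately show "free.lift (\<lambda>j. var (F j)) r \<in> idl (U_rels D var)"
      by (simp add: r(1) boson_serre_lift o_def)
  qed
qed

end

section \<open>The operators $e_i'$\<close>

context quantum_datum
begin

section \<open>Commutation in the extended algebra\<close>

lemma UT_cong:
  "r \<in> UT_rels D \<Longrightarrow> r = x - y \<Longrightarrow> idl_cong (UT_rels D) x y"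
  by (simp add: idl_cong_def idl_base)

lemma UT_invertible:
  "idl_cong (UT_rels D) (var (TI i) * var (T i)) 1"
  "idl_cong (UT_rels D) (var (Base (KI i)) * var (Base (K i))) 1"
  "idl_cong (UT_rels D) (var (Base (K i)) * var (Base (KI i))) 1"
  "idl_cong (UT_rels D) (var (T i) * var (TI i)) 1"
  by (rule UT_cong[OF _ refl], intro UT_rels_intros U_rels_intros)+

lemma conj_cong:
  fixes R :: "('g, 'k) free set"
  assumes inv: "idl_cong R (s' * s) 1" "idl_cong R (s * s') 1"
    and f: "\<And>j. idl_cong R (s * f j * s') (\<chi> j \<cdot> f j)"
  shows "idl_cong R (s * free.lift f X * s') (free.lift f (app (dg \<chi>) X))"
proof (induction X rule: free_induct)
  case one
  then show ?case using inv(2) by simp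
next
  case (add x y)
  then show ?case by (simp add: algebra_simps idl_cong_add)
next
  case (scale c x)
  then show ?case by (simp add: idl_cong_scale)
next
  case (var j x)
  \<comment> \<open>Inserting \<open>s' * s\<close> after the first letter splits the conjugate of a
    product into a product of conjugates.\<close>
  have "idl_cong R (s * f j * (1 * (free.lift f x * s'))) (s * f j * ((s' * s) * (free.lift f x * s')))"
    by (intro idl_cong_mult idl_cong_refl idl_cong_sym[OF inv(1)])
  also have "\<dots> = (s * f j * s') * (s * free.lift f x * s')"
    by (simp add: mult.assoc)
  also have "idl_cong R \<dots> ((\<chi> j \<cdot> f j) * free.lift f (app (dg \<chi>) x))"
    by (intro idl_cong_mult f var)
  finally show ?case
    by (simp add: mult.assoc)
qed

lemma T_conj: "idl_cong (UT_rels D) (var (TI i) * \<psi>T X * var (T i)) (\<psi>T (app (dg (\<lambda>j. theta D j i)) X))"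
proof (rule conj_cong)
  fix j
  let ?f = "var (Base (F j)) :: ('i tgen, 'k) free"
  \<comment> \<open>The relation conjugates in the opposite direction; conjugating it back and
    rescaling inverts it.\<close>
  have "idl_cong (UT_rels D) (var (T i) * ?f * var (TI i)) (uinv (theta D j i) \<cdot> ?f)"
    by (rule UT_cong[OF _ refl]) (rule UT_rels_intros)
  then have "idl_cong (UT_rels D) (theta D j i \<cdot> (var (TI i) * (var (T i) * ?f * var (TI i)) * var (T i)))
      (theta D j i \<cdot> (var (TI i) * (uinv (theta D j i) \<cdot> ?f) * var (T i)))"
    by (intro idl_cong_scale idl_cong_mult idl_cong_refl)
  then have "idl_cong (UT_rels D) (theta D j i \<cdot> ((var (TI i) * var (T i)) * ?f * (var (TI i) * var
      (T i))))
      (var (TI i) * ?f * var (T i))"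
    by (simp add: mult.assoc)
  moreover have "idl_cong (UT_rels D) (theta D j i \<cdot> ((var (TI i) * var (T i)) * ?f * (var (TI i) *
      var (T i))))
     (theta D j i \<cdot> (1 * ?f * 1))"
    by (intro idl_cong_scale idl_cong_mult idl_cong_refl UT_invertible)
  ultimately show "idl_cong (UT_rels D) (var (TI i) * ?f * var (T i)) (theta D j i \<cdot> ?f)"
    using idl_cong_trans idl_cong_sym by fastforce
qed (rule UT_invertible)+

lemma K_conj: "idl_cong (UT_rels D) (var (Base (K i)) * \<psi>T X * var (Base (KI i)))
   (\<psi>T (app (dg (\<lambda>j. uinv (p2 D i j))) X))"
proof (rule conj_cong)
  fix j
  show "idl_cong (UT_rels D) (var (Base (K i)) * var (Base (F j)) * var (Base (KI i)))
    (uinv (p2 D i j) \<cdot> var (Base (F j)))"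
    by (rule UT_cong[OF _ refl]) (intro UT_rels_intros U_rels_intros)
qed (rule UT_invertible)+

lemma K_move: "idl_cong (UT_rels D) (var (Base (K i)) * \<psi>T X)
   (\<psi>T (app (dg (\<lambda>j. uinv (p2 D i j))) X) * var (Base (K i)))"
proof -
  have "idl_cong (UT_rels D) (var (Base (K i)) * \<psi>T X * 1)
     (var (Base (K i)) * \<psi>T X * (var (Base (KI i)) * var (Base (K i))))"
    by (intro idl_cong_mult idl_cong_refl idl_cong_sym[OF UT_invertible(2)])
  also have "\<dots> = (var (Base (K i)) * \<psi>T X * var (Base (KI i))) * var (Base (K i))"
    by (simp add: mult.assoc)
  also have "idl_cong (UT_rels D) \<dots> (\<psi>T (app (dg (\<lambda>j. uinv (p2 D i j))) X) * var (Base (K i)))"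
    by (intro idl_cong_mult idl_cong_refl K_conj)
  finally show ?thesis by simp
qed

lemma KI_move: "idl_cong (UT_rels D) (var (Base (F j)) * var (Base (KI i)))
   (uinv (p2 D i j) \<cdot> (var (Base (KI i)) * var (Base (F j))))"
proof -
  let ?f = "var (Base (F j)) :: ('i tgen, 'k) free"
  have "idl_cong (UT_rels D) (1 * (?f * var (Base (KI i)))) ((var (Base (KI i)) * var (Base (K i)))
      * (?f * var (Base (KI i))))"
    by (intro idl_cong_mult idl_cong_refl idl_cong_sym[OF UT_invertible(2)])
  also have "\<dots> = var (Base (KI i)) * (var (Base (K i)) * ?f * var (Base (KI i)))"
    by (simp add: mult.assoc)
  also have "idl_cong (UT_rels D) \<dots> (var (Base (KI i)) * (uinv (p2 D i j) \<cdot> ?f))"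
    by (intro idl_cong_mult idl_cong_refl UT_cong[OF _ refl]) (intro UT_rels_intros U_rels_intros)
  finally show ?thesis by simp
qed

text \<open>The operator sending \<open>P\<close> to \<open>T\<^sub>i\<inverse> Q T\<^sub>i\<close>, in the notation of the defining equation of \<open>e\<^sub>i'\<close>.\<close>

definition e_dprime :: "'i \<Rightarrow> ('i, 'k) endo" where
  "e_dprime i = der (\<lambda>j. theta D j i) i (dg (\<lambda>j. uinv (p2 D i j)))"

text \<open>Induction on the first letter determines both operators. In the \<open>K\<close> part
  the letter contributes theta_ji, and \<open>K i\<close> is moved to the right past the rest, hence
  the scaling in \<open>e_dprime\<close>. In the \<open>KI\<close> part the letter must pass
  \<open>KI i\<close>, which gives a further factor p_ij^(-1); together this is the constant
  \<open>ttheta D j i\<close> of the boson algebra.\<close>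

lemma e_commutation:
  "idl_cong (UT_rels D) (var (Base (E i)) * \<psi>T X)
    (\<psi>T (app (dg (\<lambda>j. theta D j i)) X) * var (Base (E i))
     + uinv (p1 D i - uinv (p1 D i)) \<cdot> (\<psi>T (app (e_dprime i) X) * var (Base (K i))
        - var (Base (KI i)) * \<psi>T (app (boson.E_op i) X)))"
proof (induction X rule: free_induct)
  case one
  then show ?case by (simp add: e_dprime_def)
next
  case (add x y)
  from idl_cong_add[OF this] show ?case
    by (simp add: algebra_simps free.sc_add_right free.sc_diff_right)
next
  case (scale c x)
  from idl_cong_scale[OF this, of c] show ?case
    by (simp add: free.sc_add_right free.sc_diff_right mult.commute)
next
  case (var j x)
  define e f k k' c where defs: "e = (var (Base (E i)) :: ('i tgen, 'k) free)"
    "f = (var (Base (F j)) :: ('i tgen, 'k) free)" "k = (var (Base (K i)) :: ('i tgen, 'k) free)"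
    "k' = (var (Base (KI i)) :: ('i tgen, 'k) free)" "c = uinv (p1 D i - uinv (p1 D i))"
  define t u where "t = theta D j i" "u = uinv (p2 D i j)"
  let ?\<delta> = "if i = j then c \<cdot> (k - k') else 0"
  let ?X = "\<psi>T x" and ?dX = "\<psi>T (app (dg (\<lambda>j. theta D j i)) x)"
    and ?Q = "\<psi>T (app (e_dprime i) x)" and ?R = "\<psi>T (app (boson.E_op i) x)"
    and ?kX = "\<psi>T (app (dg (\<lambda>j. uinv (p2 D i j))) x)"
  have boson_H: "boson.H i = 1"
    by (simp add: boson.H_def)
  have IH: "idl_cong (UT_rels D) (e * ?X) (?dX * e + c \<cdot> (?Q * k - k' * ?R))"
    using var by (simp add: defs)
  have ef: "idl_cong (UT_rels D) (e * f) (t \<cdot> (f * e) + ?\<delta>)"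
    by (rule UT_cong[OF UT_rels_intros(1)[OF U_rels_intros(6)[of _ i j]]]) (simp add: defs t_u_def)
  have "idl_cong (UT_rels D) ((e * f) * ?X) ((t \<cdot> (f * e) + ?\<delta>) * ?X)"
    by (intro idl_cong_mult idl_cong_refl ef)
  also have "\<dots> = t \<cdot> (f * (e * ?X)) + (if i = j then c \<cdot> (k * ?X - k' * ?X) else 0)"
    by (simp add: algebra_simps)
  also have "idl_cong (UT_rels D) \<dots> (t \<cdot> (f * (?dX * e + c \<cdot> (?Q * k - k' * ?R)))
      + (if i = j then c \<cdot> (?kX * k - k' * ?X) else 0))"
    using IH K_move[of i x] unfolding defs[symmetric]
    by (auto intro!: idl_cong_add idl_cong_scale idl_cong_diff idl_cong_mult)
  also have "\<dots> = (t \<cdot> (f * ?dX * e) + c \<cdot> t \<cdot> (f * ?Q * k) - c \<cdot> t \<cdot> ((f * k') * ?R))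
      + (if i = j then c \<cdot> (?kX * k - k' * ?X) else 0)"
    by (simp add: algebra_simps free.sc_add_right free.sc_diff_right)
  also have "idl_cong (UT_rels D) \<dots> ((t \<cdot> (f * ?dX * e) + c \<cdot> t \<cdot> (f * ?Q * k) - c \<cdot> t \<cdot> ((u \<cdot> (k' *
      f)) * ?R))
      + (if i = j then c \<cdot> (?kX * k - k' * ?X) else 0))"
    by (intro idl_cong_add idl_cong_scale idl_cong_diff idl_cong_mult idl_cong_refl
        KI_move[of j i, folded defs t_u_def])
  also have "\<dots> = \<psi>T (app (dg (\<lambda>j. theta D j i)) (var j * x)) * e
     + c \<cdot> (\<psi>T (app (e_dprime i) (var j * x)) * k - k' * \<psi>T (app (boson.E_op i) (var j * x)))"
    unfolding e_dprime_def boson.E_op_def boson_H der_var_mult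
    by (simp add: algebra_simps free.sc_add_right free.sc_diff_right ttheta_eq t_u_def
        flip: defs e_dprime_def boson.E_op_def[unfolded boson_H])
  finally show ?case
    unfolding defs by (simp add: mult.assoc)
qed

section \<open>The negative parts as quotients of one free algebra\<close>

definition pi_U :: "('i, 'k) free \<Rightarrow> ('i ugen, 'k) free set" where
  "pi_U X = cls (U_rels D var) (free.lift (\<lambda>j. var (F j)) X)"

definition pi_cU :: "('i, 'k) free \<Rightarrow> ('i ugen, 'k) free set" where
  "pi_cU X = cls (cU_rels D) (free.lift (\<lambda>j. var (F j)) X)"

lemma pi_U_eq_iff: "pi_U X = pi_U Y \<longleftrightarrow> X - Y \<in> serre_ideal"
  by (simp add: pi_U_def cls_eq_iff idl_cong_def U_kernel_iff flip: free.lift_diff)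

lemma pi_cU_eq_iff: "pi_cU X = pi_cU Y \<longleftrightarrow> X - Y \<in> serre_ideal"
  by (simp add: pi_cU_def cls_eq_iff idl_cong_def cU_kernel_iff flip: free.lift_diff)

lemma pi_gen: "pi_U (var i) = U_gen D (F i)" "pi_cU (var i) = cU_gen D (F i)"
  by (simp_all add: pi_U_def pi_cU_def U_gen_def cU_gen_def)

sublocale Um: free_image "Uminus D" pi_U
  using free_image.free_image_generated_subalgebra[OF free_image_presented, of "U_rels D var" "\<lambda>j.
      var (F j)"]
  by (simp add: Uminus_def U_def U_gen_def pi_U_def[abs_def])

sublocale cUm: free_image "cUminus D" pi_cU
  using free_image.free_image_generated_subalgebra[OF free_image_presented, of "cU_rels D" "\<lambda>j. var
      (F j)"]
  by (simp add: cUminus_def cU_def cU_gen_def pi_cU_def[abs_def])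

text \<open>Both projections have kernel \<open>serre_ideal\<close>, so sending the class of
  \<open>X\<close> to the class of \<open>X\<close> is well defined.\<close>

lemma minus_iso_pi: "minus_iso D (pi_U X) = pi_cU X"
  using Um.gen_hom_eq[OF cUm.free_hom_axioms, of X]
  by (simp add: minus_iso_def pi_gen pi_U_eq_iff pi_cU_eq_iff)

lemma UT_incl_cls: "UT_incl D (cls (U_rels D var) X) = cls (UT_rels D) (free.lift (\<lambda>g. var (Base g)) X)"
proof -
  interpret S: free_image "presented (U_rels D var)" "cls (U_rels D var)"
    by (rule free_image_presented)
  interpret T: free_image "presented (UT_rels D)" "cls (UT_rels D)"
    by (rule free_image_presented)
  let ?\<psi> = "\<lambda>X. cls (UT_rels D) (free.lift (\<lambda>g. var (Base g)) X)"
  have "free_hom (UT D) ?\<psi>"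
    unfolding UT_def by standard (simp_all add: T.pi_add T.pi_mult T.pi_one T.pi_zero T.pi_scale)
  moreover have "?\<psi> X = ?\<psi> Y" if "cls (U_rels D var) X = cls (U_rels D var) Y" for X Y
  proof -
    have "X - Y \<in> idl (U_rels D var)"
      using that by (simp add: cls_eq_iff idl_cong_def)
    then have "free.lift (\<lambda>g. var (Base g)) (X - Y) \<in> idl (UT_rels D)"
    proof (rule lift_idl)
      fix r :: "('i ugen, 'k) free" assume "r \<in> U_rels D var"
      then show "free.lift (\<lambda>g. var (Base g)) r \<in> idl (UT_rels D)"
        using U_rels_lift[of r D var "\<lambda>g. var (Base g)"] by (intro idl_base UT_rels_intros(1)) simp
    qed
    then show ?thesis
      by (simp add: cls_eq_iff idl_cong_def)
  qed
  ultimately have "gen_hom (presented (U_rels D var)) (UT D) (\<lambda>g. cls (U_rels D var) (var g))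
      (\<lambda>g. ?\<psi> (var g)) (cls (U_rels D var) X) = ?\<psi> X"
    by (rule S.gen_hom_eq)
  then show ?thesis
    by (simp add: UT_incl_def U_def U_gen_def[abs_def] UT_gen_def[abs_def] o_def)
qed

lemma UT_incl_pi: "UT_incl D (pi_U X) = cls (UT_rels D) (\<psi>T X)"
  by (simp add: pi_U_def UT_incl_cls free.lift_lift)

section \<open>Existence and uniqueness in the equation defining the boson operators\<close>

lemma eprime_eq_iff:
  "eprime_eq D i (pi_U P) (pi_U Q) (pi_U R) \<longleftrightarrow> idl_cong (UT_rels D)
     (var (Base (E i)) * \<psi>T P - var (TI i) * \<psi>T P * var (T i) * var (Base (E i)))
     (uinv (p1 D i - uinv (p1 D i)) \<cdot>
       (var (TI i) * \<psi>T Q * var (T i) * var (Base (K i)) - var (Base (KI i)) * \<psi>T R))"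
proof -
  interpret T: free_image "presented (UT_rels D)" "cls (UT_rels D)"
    by (rule free_image_presented)
  show ?thesis
    unfolding eprime_eq_def Let_def UT_def UT_gen_def UT_incl_pi
    by (simp flip: T.pi_mult T.pi_diff T.pi_scale add: cls_eq_iff)
qed

lemma eprime_eq_exists:
  "eprime_eq D i (pi_U P) (pi_U (app (dg (\<lambda>j. uinv (theta D j i)) * e_dprime i) P)) (pi_U (app
      (boson.E_op i) P))"
proof -
  define Q where "Q = app (e_dprime i) P"
  \<comment> \<open>\<open>e_dprime\<close> yields the element already conjugated by
    \<open>T i\<close>; the inverse rescaling recovers the \<open>Q\<close> of the equation.\<close>
  define Q' where "Q' = app (dg (\<lambda>j. uinv (theta D j i))) Q"
  have "app (dg (\<lambda>j. theta D j i)) Q' = app (dg (\<lambda>j. theta D j i) * dg (\<lambda>j. uinv (theta D j i))) Q"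
    by (simp add: Q'_def)
  then have Q': "app (dg (\<lambda>j. theta D j i)) Q' = Q"
    by (simp add: dg_inv_mult del: app_simps(6))
  let ?c = "uinv (p1 D i - uinv (p1 D i))"
  have "idl_cong (UT_rels D)
     (var (Base (E i)) * \<psi>T P - (var (TI i) * \<psi>T P * var (T i)) * var (Base (E i)))
     ((\<psi>T (app (dg (\<lambda>j. theta D j i)) P) * var (Base (E i))
     + ?c \<cdot> (\<psi>T Q * var (Base (K i)) - var (Base (KI i)) * \<psi>T (app (boson.E_op i) P)))
     - \<psi>T (app (dg (\<lambda>j. theta D j i)) P) * var (Base (E i)))"
    unfolding Q_def by (intro idl_cong_diff e_commutation idl_cong_mult T_conj idl_cong_refl)
  also have "\<dots> = ?c \<cdot> (\<psi>T (app (dg (\<lambda>j. theta D j i)) Q') * var (Base (K i)) - var (Base (KI i)) *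
      \<psi>T (app (boson.E_op i) P))"
    unfolding Q' by simp
  also have "idl_cong (UT_rels D) \<dots>
      (?c \<cdot> ((var (TI i) * \<psi>T Q' * var (T i)) * var (Base (K i)) - var (Base (KI i)) * \<psi>T (app
          (boson.E_op i) P)))"
    by (intro idl_cong_scale idl_cong_diff idl_cong_mult idl_cong_sym[OF T_conj] idl_cong_refl)
  finally show ?thesis
    unfolding eprime_eq_iff by (simp add: Q'_def Q_def)
qed

text \<open>Evaluated at 1 in the module of highest weight \<open>z\<close>, the assumption says
  that \<open>z\<close> times a rescaling of \<open>Q\<close> minus \<open>uinv z\<close> times a
  rescaling of \<open>R\<close> lies in \<open>serre_ideal\<close>. Taking \<open>z\<close> to be 1
  and p_i and eliminating \<open>Q\<close> leaves \<open>R\<close> with the coefficient p_i -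
  p_i^(-1) up to sign, which is a unit.\<close>

lemma UT_independent:
  assumes "var (TI i) * \<psi>T Q * var (T i) * var (Base (K i)) - var (Base (KI i)) * \<psi>T R \<in> idl (UT_rels D)"
  shows "Q \<in> serre_ideal" "R \<in> serre_ideal"
proof -
  let ?A = "app (dg (\<lambda>j. theta D j i)) Q" and ?B = "app (dg (p2 D i)) R"
  have *: "z \<cdot> ?A - uinv z \<cdot> ?B \<in> serre_ideal" if z: "z dvd 1" for z
  proof -
    obtain \<rho> where \<rho>:
      "\<And>i. \<rho> (Base (F i)) = lmult (var i)"
      "\<And>i. \<rho> (Base (K i)) = escale z (dg (\<lambda>j. uinv (p2 D i j)))"
      "\<And>i. \<rho> (Base (KI i)) = escale (uinv z) (dg (p2 D i))"
      "\<And>i. \<rho> (T i) = dg (\<lambda>j. uinv (theta D j i))"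
      "\<And>i. \<rho> (TI i) = dg (\<lambda>j. theta D j i)"
      and J: "\<And>X x. X \<in> idl (UT_rels D) \<Longrightarrow> app (endo.lift \<rho> X) x \<in> serre_ideal"
      by (rule UT_rep[OF z]) blast
    have \<psi>: "endo.lift \<rho> (\<psi>T X) = lmult X" for X
      by (simp only: endo.lift_lift endo.lift_var \<rho> lift_lmult lift_var_id)
    show ?thesis
      using J[OF assms, of 1] by (simp add: \<rho> \<psi>)
  qed
  have AB: "?A - ?B \<in> serre_ideal"
    using *[of 1] by simp
  let ?q = "p1 D i"
  have "?q \<cdot> (?A - ?B) - (?q \<cdot> ?A - uinv ?q \<cdot> ?B) \<in> serre_ideal"
    by (intro serre_ideal_ops(3) serre_ideal_ops(4) AB *) simp
  then have "uinv (?q - uinv ?q) \<cdot> (?q \<cdot> (?A - ?B) - (?q \<cdot> ?A - uinv ?q \<cdot> ?B)) \<in> serre_ideal"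
    by (rule serre_ideal_ops)
  moreover have "uinv (?q - uinv ?q) \<cdot> (?q \<cdot> (?A - ?B) - (?q \<cdot> ?A - uinv ?q \<cdot> ?B))
      = - (uinv (?q - uinv ?q) * (?q - uinv ?q)) \<cdot> ?B"
    by (simp add: free.sc_diff_right free.sc_diff_left free.sc_minus_left right_diff_distrib)
  ultimately have B: "(- 1) \<cdot> ?B \<in> serre_ideal"
    by simp
  have B: "?B \<in> serre_ideal"
    using serre_ideal_ops(4)[OF B, of "-1"] by simp
  have A: "?A \<in> serre_ideal"
    using serre_ideal_ops(2)[OF AB B] by simp
  have "R = app (dg (\<lambda>j. uinv (p2 D i j)) * dg (p2 D i)) R"
    by (simp add: dg_inv_mult del: app_simps(6))
  then show "R \<in> serre_ideal"
    using boson.dg_serre_ideal[OF B, of "\<lambda>j. uinv (p2 D i j)"] by simp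
  have "Q = app (dg (\<lambda>j. uinv (theta D j i)) * dg (\<lambda>j. theta D j i)) Q"
    by (simp add: dg_inv_mult del: app_simps(6))
  then show "Q \<in> serre_ideal"
    using boson.dg_serre_ideal[OF A, of "\<lambda>j. uinv (theta D j i)"] by simp
qed

lemma eprime_eq_unique:
  assumes "eprime_eq D i (pi_U P) (pi_U Q) (pi_U R)" "eprime_eq D i (pi_U P) (pi_U Q') (pi_U R')"
  shows "pi_U Q = pi_U Q'" "pi_U R = pi_U R'"
proof -
  let ?c = "uinv (p1 D i - uinv (p1 D i))"
  let ?f = "\<lambda>Q R. var (TI i) * \<psi>T Q * var (T i) * var (Base (K i)) - var (Base (KI i)) * \<psi>T R"
  have "idl_cong (UT_rels D) (?c \<cdot> ?f Q R) (?c \<cdot> ?f Q' R')"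
    using assms idl_cong_trans idl_cong_sym unfolding eprime_eq_iff by blast
  then have "idl_cong (UT_rels D) ((p1 D i - uinv (p1 D i)) \<cdot> ?c \<cdot> ?f Q R) ((p1 D i - uinv (p1 D i))
      \<cdot> ?c \<cdot> ?f Q' R')"
    by (rule idl_cong_scale)
  then have "?f Q R - ?f Q' R' \<in> idl (UT_rels D)"
    by (simp add: idl_cong_def del: mult_uinv uinv_mult_self add: mult_uinv[OF generic_diff_unit1[OF
        generic_p1]])
  moreover have "?f Q R - ?f Q' R' = ?f (Q - Q') (R - R')"
    by (simp add: algebra_simps)
  ultimately show "pi_U Q = pi_U Q'" "pi_U R = pi_U R'"
    using UT_independent[of i "Q - Q'" "R - R'"] by (simp_all add: pi_U_eq_iff)
qed

lemma eprime_pi: "eprime D i (pi_U P) = pi_U (app (boson.E_op i) P)"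
proof -
  let ?Q = "pi_U (app (dg (\<lambda>j. uinv (theta D j i)) * e_dprime i) P)" and ?R = "pi_U (app (boson.E_op
      i) P)"
  have "(THE (Q, R). Q \<in> carrier (Uminus D) \<and> R \<in> carrier (Uminus D) \<and> eprime_eq D i (pi_U P) Q R) =
      (?Q, ?R)"
  proof (rule the_equality)
    show "case (?Q, ?R) of (Q, R) \<Rightarrow> Q \<in> carrier (Uminus D) \<and> R \<in> carrier (Uminus D) \<and> eprime_eq D i
        (pi_U P) Q R"
      using eprime_eq_exists[of i P] by simp
  next
    fix QR assume "case QR of (Q, R) \<Rightarrow> Q \<in> carrier (Uminus D) \<and> R \<in> carrier (Uminus D) \<and> eprime_eq D
        i (pi_U P) Q R"
    then obtain Q R where QR: "QR = (pi_U Q, pi_U R)" "eprime_eq D i (pi_U P) (pi_U Q) (pi_U R)"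
      by (auto elim!: Um.carrierE split: prod.splits)
    then show "QR = (?Q, ?R)"
      using eprime_eq_unique[OF QR(2) eprime_eq_exists] by simp
  qed
  then show ?thesis by (simp add: eprime_def)
qed

lemma cU_eprime_pi: "cU_eprime D i (pi_cU P) = pi_cU (app (boson.E_op i) P)"
proof -
  have "inj_on (minus_iso D) (carrier (Uminus D))"
    by (auto simp: inj_on_def Um.carrier_eq minus_iso_pi pi_U_eq_iff pi_cU_eq_iff)
  then have "inv_into (carrier (Uminus D)) (minus_iso D) (pi_cU P) = pi_U P"
    using inv_into_f_f[of "minus_iso D" "carrier (Uminus D)" "pi_U P"] by (simp add: minus_iso_pi)
  then show ?thesis
    by (simp add: cU_eprime_def eprime_pi minus_iso_pi)
qed

section \<open>The action of the quantum boson algebra\<close>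

fun boson_op :: "'i bgen \<Rightarrow> ('i, 'k) endo" where
  "boson_op (BE i) = boson.E_op i"
| "boson_op (BF i) = lmult (var i)"

lemma boson_op_serre_ideal: "x \<in> serre_ideal \<Longrightarrow> app (boson_op g) x \<in> serre_ideal"
  by (cases g) (simp_all add: boson.E_op_serre_ideal serre_ideal_ops)

lemma boson_rels_op:
  assumes "r \<in> boson_rels D"
  shows "app (endo.lift boson_op r) x \<in> serre_ideal"
proof -
  consider i j where "r = var (BE i) * var (BF j) - ttheta D j i \<cdot> (var (BF j) * var (BE i)) - (if i
      = j then 1 else 0)"
    | i j where "i \<noteq> j" "r = boson_serre D (var \<circ> BE) i j"
    | i j where "i \<noteq> j" "r = boson_serre D (var \<circ> BF) i j"
    using assms unfolding boson_rels_def by blast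
  then show ?thesis
  proof cases
    case 1
    then have "endo.lift boson_op r = 0"
      by (simp add: boson.EF boson.H_def)
    then show ?thesis by (simp add: serre_ideal_ops)
  next
    case 2
    then have "endo.lift boson_op r = 0"
      using boson.E_serre[OF 2(1)] by (simp add: boson_serre_eq)
    then show ?thesis by (simp add: serre_ideal_ops)
  next
    case 3
    have "r = free.lift (\<lambda>j. var (BF j)) (boson_serre D var i j)"
      using 3 by (simp add: boson_serre_lift o_def)
    then have "endo.lift boson_op r = lmult (boson_serre D var i j)"
      by (simp only: endo.lift_lift endo.lift_var boson_op.simps lift_lmult lift_var_id)
    then show ?thesis by (simp add: boson_serre_mult_mem[OF 3(1)])
  qed
qed

text \<open>The projection is a parameter, so both modules arise from one action on the free
  algebra.\<close>

definition boson_act :: "(('i, 'k) free \<Rightarrow> 'm) \<Rightarrow> ('i bgen, 'k) free set \<Rightarrow> 'm \<Rightarrow> 'm" where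
  "boson_act \<pi> b x =
     \<pi> (app (endo.lift boson_op (SOME X. cls (boson_rels D) X = b)) (SOME P. \<pi> P = x))"

lemma boson_act_cls:
  assumes \<pi>: "\<And>X Y. \<pi> X = \<pi> Y \<longleftrightarrow> X - Y \<in> serre_ideal"
  shows "boson_act \<pi> (cls (boson_rels D) X) (\<pi> P) = \<pi> (app (endo.lift boson_op X) P)"
proof -
  define X' where "X' = (SOME Y. cls (boson_rels D) Y = cls (boson_rels D) X)"
  define P' where "P' = (SOME Q. \<pi> Q = \<pi> P)"
  have "cls (boson_rels D) X' = cls (boson_rels D) X"
    unfolding X'_def by (rule someI) (rule refl)
  then have X': "X' - X \<in> idl (boson_rels D)"
    by (simp add: cls_eq_iff idl_cong_def)
  have "\<pi> P' = \<pi> P"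
    unfolding P'_def by (rule someI) (rule refl)
  then have P': "P' - P \<in> serre_ideal"
    by (simp only: \<pi>)
  \<comment> \<open>The change of both representatives is split so that one summand has a relator
    combination as operator and the other has an argument in \<open>serre_ideal\<close>.\<close>
  have "app (endo.lift boson_op (X' - X)) P' + app (endo.lift boson_op X) (P' - P) \<in> serre_ideal"
    by (intro serre_ideal_ops(2) lift_idl_serre_ideal[OF boson_op_serre_ideal boson_rels_op X']
        lift_serre_ideal[OF boson_op_serre_ideal P'])
  then have "\<pi> (app (endo.lift boson_op X') P') = \<pi> (app (endo.lift boson_op X) P)"
    by (simp add: \<pi>)
  then show ?thesis
    by (simp only: boson_act_def X'_def P'_def)
qed

lemma boson_module:
  assumes "free_image M \<pi>" and \<pi>: "\<And>X Y. \<pi> X = \<pi> Y \<longleftrightarrow> X - Y \<in> serre_ideal"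
  shows "algebra_left_module (boson D) M (boson_act \<pi>)"
proof -
  interpret M: free_image M \<pi> by fact
  interpret B: free_image "boson D" "cls (boson_rels D)"
    unfolding boson_def by (rule free_image_presented)
  note act = boson_act_cls[OF \<pi>]
  show ?thesis
  proof (intro algebra_left_module.intro B.ring_axioms M.abelian_group_axioms
      algebra_left_module_axioms.intro)
    fix b c x y t
    assume "b \<in> carrier (boson D)" "x \<in> carrier M"
    then obtain X P where X: "b = cls (boson_rels D) X" and P: "x = \<pi> P"
      by (auto elim!: B.carrierE M.carrierE)
    show "boson_act \<pi> b x \<in> carrier M"
      by (simp add: X P act)
    show "boson_act \<pi> (t \<odot>\<^bsub>boson D\<^esub> b) x = t \<odot>\<^bsub>M\<^esub> boson_act \<pi> b x"
      by (simp add: X P act flip: B.pi_scale M.pi_scale)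
    show "boson_act \<pi> b (x \<oplus>\<^bsub>M\<^esub> y) = boson_act \<pi> b x \<oplus>\<^bsub>M\<^esub> boson_act \<pi> b y"
      if "y \<in> carrier M"
      using that by (auto elim!: M.carrierE simp: X P act simp flip: M.pi_add)
    assume "c \<in> carrier (boson D)"
    then obtain Y where Y: "c = cls (boson_rels D) Y"
      by (auto elim!: B.carrierE)
    show "boson_act \<pi> (b \<oplus>\<^bsub>boson D\<^esub> c) x = boson_act \<pi> b x \<oplus>\<^bsub>M\<^esub> boson_act \<pi> c x"
      by (simp add: X Y P act flip: B.pi_add M.pi_add)
    show "boson_act \<pi> (b \<otimes>\<^bsub>boson D\<^esub> c) x = boson_act \<pi> b (boson_act \<pi> c x)"
      by (simp add: X Y P act flip: B.pi_mult)
  next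
    fix x assume "x \<in> carrier M"
    then show "boson_act \<pi> \<one>\<^bsub>boson D\<^esub> x = x"
      by (auto elim!: M.carrierE simp: act simp flip: B.pi_one)
  qed
qed

text \<open>In terms of representatives \<open>minus_iso\<close> is the identity, and both actions
  are given by the same operators.\<close>

lemma minus_iso_module_iso:
  "minus_iso D \<in> module_isos (boson D) (Uminus D) (boson_act pi_U) (cUminus D) (boson_act pi_cU)"
proof -
  interpret B: free_image "boson D" "cls (boson_rels D)"
    unfolding boson_def by (rule free_image_presented)
  have "bij_betw (minus_iso D) (carrier (Uminus D)) (carrier (cUminus D))"
    unfolding Um.carrier_eq cUm.carrier_eq bij_betw_def
    by (auto simp: inj_on_def image_image minus_iso_pi pi_U_eq_iff pi_cU_eq_iff)
  then show ?thesis
    unfolding module_isos_def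
    by (auto elim!: B.carrierE Um.carrierE simp: minus_iso_pi boson_act_cls pi_U_eq_iff pi_cU_eq_iff
        simp flip: Um.pi_add cUm.pi_add)
qed

end

theorem proposition3p8:
  fixes D :: "('i, 'k::comm_ring_1) datum"
  assumes "symmetrizable_cartan (cartan D)"
    and "admissible_parameters D"
  shows "\<exists>\<rho> \<sigma>.
    algebra_left_module (boson D) (Uminus D) \<rho> \<and>
    (\<forall>i. \<forall>x \<in> carrier (Uminus D).
       \<rho> (boson_gen D (BF i)) x = U_gen D (F i) \<otimes>\<^bsub>Uminus D\<^esub> x \<and>
       \<rho> (boson_gen D (BE i)) x = eprime D i x) \<and>
    algebra_left_module (boson D) (cUminus D) \<sigma> \<and>
    (\<forall>i. \<forall>x \<in> carrier (cUminus D).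
       \<sigma> (boson_gen D (BF i)) x = cU_gen D (F i) \<otimes>\<^bsub>cUminus D\<^esub> x \<and>
       \<sigma> (boson_gen D (BE i)) x = cU_eprime D i x) \<and>
    module_isos (boson D) (Uminus D) \<rho> (cUminus D) \<sigma> \<noteq> {}"
proof -
  interpret quantum_datum D
    by standard (fact assms)+
  note act_U = boson_act_cls[OF pi_U_eq_iff] and act_cU = boson_act_cls[OF pi_cU_eq_iff]
  show ?thesis
  proof (rule exI[of _ "boson_act pi_U"], rule exI[of _ "boson_act pi_cU"], intro conjI allI ballI)
    fix i x assume "x \<in> carrier (Uminus D)"
    then obtain P where x: "x = pi_U P" ..
    show "boson_act pi_U (boson_gen D (BF i)) x = U_gen D (F i) \<otimes>\<^bsub>Uminus D\<^esub> x"
      by (simp add: x boson_gen_def act_U Um.pi_mult pi_gen)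
    show "boson_act pi_U (boson_gen D (BE i)) x = eprime D i x"
      by (simp add: x boson_gen_def act_U eprime_pi)
  next
    fix i x assume "x \<in> carrier (cUminus D)"
    then obtain P where x: "x = pi_cU P" ..
    show "boson_act pi_cU (boson_gen D (BF i)) x = cU_gen D (F i) \<otimes>\<^bsub>cUminus D\<^esub> x"
      by (simp add: x boson_gen_def act_cU cUm.pi_mult pi_gen)
    show "boson_act pi_cU (boson_gen D (BE i)) x = cU_eprime D i x"
      by (simp add: x boson_gen_def act_cU cU_eprime_pi)
  next
    show "algebra_left_module (boson D) (Uminus D) (boson_act pi_U)"
      by (rule boson_module[OF Um.free_image_axioms pi_U_eq_iff])
    show "algebra_left_module (boson D) (cUminus D) (boson_act pi_cU)"
      by (rule boson_module[OF cUm.free_image_axioms pi_cU_eq_iff])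
    show "module_isos (boson D) (Uminus D) (boson_act pi_U) (cUminus D) (boson_act pi_cU) \<noteq> {}"
      using minus_iso_module_iso by blast
  qed
qed

end
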